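(* Let $M$ be a smooth finite-dimensional manifold, $V$ a Banach space, $\mathcal G=(\psi,U)$ a gauge on $M$, $\mathbf y=(y,y^\dagger)\in CRP_{\mathbf X}(M)$, and $\boldsymbol\alpha=(\alpha,\alpha^\dagger)\in CRP_y^U(M,V)$. For $(s,t)\in\Delta_{[0,T]}$ with $t-s$ sufficiently small set $$\tilde z_{s,t}:=\alpha_s\left(\psi(y_s,y_t)+S^{\mathcal G}_{y_s}\left(y_s^{\dagger\otimes2}\mathbb X_{s,t}\right)\right)+\alpha_s^\dagger\left(I\otimes y_s^\dagger\right)\mathbb X_{s,t}.$$ Then there exists a unique $\mathbf z=(z,z^\dagger)\in CRP_{\mathbf X}(V)$ such that $z_0=0$, $z_t-z_s\approx_3\tilde z_{s,t}$, and $z_s^\dagger=\alpha_s\circ y_s^\dagger$ for all $s\in[0,T]$.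
   Context: Rough paths. $W=\mathbb R^k$, $T>0$, $1\le p<3$, $\Delta_{[0,T]}=\{(s,t):0\le s\le t\le T\}$. A control is a continuous $\omega:\Delta_{[0,T]}\to[0,\infty)$ with $\omega(s,s)=0$ and $\omega(s,t)+\omega(t,u)\le\omega(s,u)$ for $s\le t\le u$. $\mathbf X=(x,\mathbb X)$ is a fixed weak-geometric $p$-rough path with control $\omega$: $x:[0,T]\to W$ and $\mathbb X:\Delta_{[0,T]}\to W\otimes W$ are continuous and, with $x_{s,t}:=x_t-x_s$, one has $\mathbb X_{s,u}=\mathbb X_{s,t}+\mathbb X_{t,u}+x_{s,t}\otimes x_{t,u}$ for $s\le t\le u$, $|x_{s,t}|\le\omega(s,t)^{1/p}$, $|\mathbb X_{s,t}|\le\omega(s,t)^{2/p}$, and the symmetric part of $\mathbb X_{s,t}$ equals $\frac12x_{s,t}\otimes x_{s,t}$. $F_{s,t}\approx_iG_{s,t}$ means: there are $C<\infty$, $\delta>0$ (with $\delta$ small enough that all expressions are defined) such that $|F_{s,t}-G_{s,t}|\le C\omega(s,t)^{i/p}$ for all $0\le s\le t\le T$ with $t-s\le\delta$; for values in spaces built from $T_{y_s}M$ the norm is the (operator) norm from any fixed Riemannian metric on $M$. $CRP_{\mathbf X}(V)$: continuous pairs $(z,z^\dagger)$, $z:[0,T]\to V$, $z^\dagger:[0,T]\to L(W,V)$, for which there is $C$ with $|z_t-z_s-z_s^\dagger x_{s,t}|\le C\omega(s,t)^{2/p}$ and $|z_t^\dagger-z_s^\dagger|\le C\omega(s,t)^{1/p}$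 for all $0\le s\le t\le T$. Gauges. A diagonal domain is an open $\mathcal D\subseteq M\times M$ containing the diagonal. A logarithm is a smooth $\psi:\mathcal D\to TM$ with $\psi(m,n)\in T_mM$, $\psi(m,m)=0_m$, and differential of $\psi(m,\cdot)$ at $m$ equal to the identity of $T_mM$. A parallelism is a smooth map $(n,m)\in\mathcal D\mapsto U(n,m)\in L(T_mM,T_nM)$ with $U(m,m)=I$. A gauge is a pair $(\psi,U)$ of these with common domain $\mathcal D$. $CRP_{\mathbf X}(M)$: continuous pairs $(y,y^\dagger)$, $y:[0,T]\to M$, $y_s^\dagger\in L(W,T_{y_s}M)$, with $\psi(y_s,y_t)\approx_2y_s^\dagger x_{s,t}$ and $U(y_s,y_t)y_t^\dagger\approx_1y_s^\dagger$ (this does not depend on the gauge chosen). $CRP_y^U(M,V)$ ($U$-controlled one-forms along $y$): pairs $(\alpha,\alpha^\dagger)$ with $\alpha_s\in L(T_{y_s}M,V)$, $\alpha_s^\dagger\in L(W\otimes T_{y_s}M,V)$, $\alpha_t\circ U(y_t,y_s)-\alpha_s-\alpha_s^\dagger(x_{s,t}\otimes(\cdot))\approx_20$ and $\alpha_t^\dagger\circ(I\otimes U(y_t,y_s))-\alpha_s^\dagger\approx_10$. Compatibility tensor. For parallelisms $\tilde U,U$: $S_m^{\tilde U,U}\in L(T_mM\otimes T_mM,T_mM)$, $S_m^{\tilde U,U}[v\otimes w]:=v\left[n\mapsto U(n,m)^{-1}\tilde U(n,m)w\right]$ (derivative at $m$ in direction $v$ of a $T_mM$-valued function). For a gauge $\mathcal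 G=(\psi,U)$: $S^{\mathcal G}:=S^{U^\psi,U}$ where $U^\psi(m,n):=$ differential of $\psi(m,\cdot)$ at $n$, viewed as a map $T_nM\to T_mM$. $y_s^{\dagger\otimes2}:=y_s^\dagger\otimes y_s^\dagger$. *)

theory Defs
  imports "HOL-Analysis.Analysis" "HOL-Library.Function_Algebras" "HOL-Library.FuncSet"
begin

section \<open>Linear algebra preliminaries\<close>

text \<open>Pointwise scalar multiplication; together with Function_Algebras this makes spaces of
  functions into real vector spaces.\<close>

instantiation "fun" :: (type, real_vector) real_vector
begin

definition scaleR_fun :: "real \<Rightarrow> ('a \<Rightarrow> 'b) \<Rightarrow> 'a \<Rightarrow> 'b"
  where "scaleR_fun r f = (\<lambda>x. r *\<^sub>R f x)"

instance
  by standard (simp_all add: scaleR_fun_def fun_eq_iff scaleR_add_right scaleR_add_left)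

end

definition lin_on :: "'a::real_vector set \<Rightarrow> ('a \<Rightarrow> 'b::real_vector) \<Rightarrow> bool"
  where "lin_on S f \<longleftrightarrow>
    (\<forall>u\<in>S. \<forall>v\<in>S. f (u + v) = f u + f v) \<and> (\<forall>r. \<forall>u\<in>S. f (r *\<^sub>R u) = r *\<^sub>R f u)"

text \<open>Operator norm of a linear map defined on the subspace \<open>S\<close>, where \<open>n1\<close> and \<open>n2\<close> are the
  norms on the source and on the target.\<close>

definition op_norm :: "'a set \<Rightarrow> ('a \<Rightarrow> real) \<Rightarrow> ('b \<Rightarrow> real) \<Rightarrow> ('a \<Rightarrow> 'b) \<Rightarrow> real"
  where "op_norm S n1 n2 f = (SUP v\<in>{v \<in> S. n1 v \<le> 1}. n2 (f v))"

text \<open>\<open>W \<otimes> W\<close> for \<open>W = real ^ 'k\<close> is the space of matrices.\<close>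

definition outer :: "real ^ 'k \<Rightarrow> real ^ 'k \<Rightarrow> real ^ 'k ^ 'k"
  where "outer v w = (\<chi> i j. v $ i * w $ j)"

text \<open>For a vector space \<open>E\<close>, the space \<open>W \<otimes> E\<close> is modelled as \<open>'k \<Rightarrow> E\<close>: the family \<open>\<tau>\<close> stands
  for the sum of \<open>e\<^sub>i \<otimes> \<tau> i\<close> over the standard basis \<open>e\<close> of \<open>W\<close>.\<close>

definition wtensor :: "real ^ 'k \<Rightarrow> 'b::real_vector \<Rightarrow> ('k \<Rightarrow> 'b)"
  where "wtensor w v = (\<lambda>i. w $ i *\<^sub>R v)"

text \<open>\<open>(I \<otimes> L) : W \<otimes> E \<rightarrow> W \<otimes> F\<close>, and its special case with \<open>E = W\<close>.\<close>

definition id_tensor :: "('b \<Rightarrow> 'c) \<Rightarrow> ('k \<Rightarrow> 'b) \<Rightarrow> ('k \<Rightarrow> 'c)"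
  where "id_tensor L \<tau> = (\<lambda>i. L (\<tau> i))"

definition id_tensor_mat :: "(real ^ 'k \<Rightarrow> 'c) \<Rightarrow> real ^ 'k ^ 'k \<Rightarrow> ('k \<Rightarrow> 'c)"
  where "id_tensor_mat L X = id_tensor L (\<lambda>i. X $ i)"

text \<open>A linear map on \<open>E \<otimes> E\<close> is given by the corresponding bilinear map \<open>B\<close> on \<open>E \<times> E\<close>. For linear
  \<open>a : W \<rightarrow> E\<close> and \<open>X \<in> W \<otimes> W\<close> this is the value of that linear map on \<open>(a \<otimes> a) X\<close>.\<close>

definition apply_tensor_square ::
    "('b \<Rightarrow> 'b \<Rightarrow> 'c::real_vector) \<Rightarrow> (real ^ 'k \<Rightarrow> 'b) \<Rightarrow> real ^ 'k ^ 'k \<Rightarrow> 'c"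
  where "apply_tensor_square B a X =
    (\<Sum>i\<in>UNIV. \<Sum>j\<in>UNIV. X $ i $ j *\<^sub>R B (a (axis i 1)) (a (axis j 1)))"


section \<open>Smooth manifolds\<close>

text \<open>Smoothness on open sets: all iterated directional derivatives exist as Frechet derivatives
  and are continuous (equivalent to \<open>C\<^sup>k\<close> because the source will be finite-dimensional).\<close>

primrec Ck_on :: "nat \<Rightarrow> ('a::real_normed_vector \<Rightarrow> 'b::real_normed_vector) \<Rightarrow> 'a set \<Rightarrow> bool"
  where
    "Ck_on 0 f S \<longleftrightarrow> continuous_on S f"
  | "Ck_on (Suc k) f S \<longleftrightarrow>
       (\<forall>x\<in>S. f differentiable (at x)) \<and> (\<forall>v. Ck_on k (\<lambda>x. frechet_derivative f (at x) v) S)"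

definition smooth_on :: "('a::real_normed_vector \<Rightarrow> 'b::real_normed_vector) \<Rightarrow> 'a set \<Rightarrow> bool"
  where "smooth_on f S \<longleftrightarrow> (\<forall>k. Ck_on k f S)"

text \<open>A chart is a pair of its domain and its coordinate map (relevant on the domain only).\<close>

type_synonym ('m, 'e) chart = "'m set \<times> ('m \<Rightarrow> 'e)"

definition cimage :: "('m, 'e) chart \<Rightarrow> 'e set"
  where "cimage c = snd c ` fst c"

definition cinv :: "('m, 'e) chart \<Rightarrow> 'e \<Rightarrow> 'm"
  where "cinv c = inv_into (fst c) (snd c)"

definition transition :: "('m, 'e) chart \<Rightarrow> ('m, 'e) chart \<Rightarrow> 'e \<Rightarrow> 'e"
  where "transition c c' = snd c' \<circ> cinv c"

definition is_chart :: "('m::topological_space, 'e::topological_space) chart \<Rightarrow> bool"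
  where "is_chart c \<longleftrightarrow> open (fst c) \<and> open (cimage c) \<and>
    homeomorphism (fst c) (cimage c) (snd c) (cinv c)"

text \<open>The manifold is the whole type \<open>'m\<close>, with smooth structure given by the atlas \<open>A\<close>. The model
  space is a finite-dimensional normed space; in contrast to class \<open>euclidean_space\<close> this does
  not exclude dimension 0.\<close>

definition smooth_manifold ::
    "('m::{t2_space, second_countable_topology}, 'e::real_normed_vector) chart set \<Rightarrow> bool"
  where "smooth_manifold A \<longleftrightarrow>
    (\<exists>B::'e set. finite B \<and> span B = UNIV) \<and>
    (\<forall>c\<in>A. is_chart c) \<and> (\<Union>c\<in>A. fst c) = UNIV \<and>
    (\<forall>c\<in>A. \<forall>c'\<in>A. smooth_on (transition c c') (snd c ` (fst c \<inter> fst c')))"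

text \<open>A tangent vector at \<open>m\<close> is the family of its coordinates in all charts of the atlas around \<open>m\<close>,
  which transform by the derivatives of the chart transitions. The entries for all other pairs of type
  \<open>chart\<close> are 0, so that the tangent space is a subspace of a function space. The base
  point is not part of the vector: an element of the tangent bundle is a pair \<open>(m, v)\<close>.\<close>

type_synonym ('m, 'e) tvec = "('m, 'e) chart \<Rightarrow> 'e"

definition tangent_space ::
    "('m, 'e::real_normed_vector) chart set \<Rightarrow> 'm \<Rightarrow> ('m, 'e) tvec set"
  where "tangent_space A m = {v.
    (\<forall>c\<in>A. \<forall>c'\<in>A. m \<in> fst c \<and> m \<in> fst c' \<longrightarrow>
       v c' = frechet_derivative (transition c c') (at (snd c m)) (v c)) \<and>
    (\<forall>c. c \<notin> A \<or> m \<notin> fst c \<longrightarrow> v c = 0)}"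

text \<open>The tangent vector at \<open>m\<close> with coordinates \<open>e\<close> in the chart \<open>c\<close>.\<close>

definition tangent_of ::
    "('m, 'e::real_normed_vector) chart set \<Rightarrow> ('m, 'e) chart \<Rightarrow> 'm \<Rightarrow> 'e \<Rightarrow> ('m, 'e) tvec"
  where "tangent_of A c m e = (\<lambda>c'. if c' \<in> A \<and> m \<in> fst c'
    then frechet_derivative (transition c c') (at (snd c m)) e else 0)"

text \<open>Derivative at \<open>m\<close>, in the direction of the tangent vector \<open>v\<close> at \<open>m\<close>, of a function \<open>f\<close> on the
  manifold with values in a fixed tangent space, computed componentwise in an arbitrary chart around \<open>m\<close>.\<close>

definition dir_deriv ::
    "('m, 'e::real_normed_vector) chart set \<Rightarrow> 'm \<Rightarrow> ('m, 'e) tvec \<Rightarrow> ('m \<Rightarrow> ('m, 'e) tvec)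
      \<Rightarrow> ('m, 'e) tvec"
  where "dir_deriv A m v f = (let c = (SOME c. c \<in> A \<and> m \<in> fst c) in
    (\<lambda>c'. frechet_derivative (\<lambda>x. f (cinv c x) c') (at (snd c m)) (v c)))"

definition riemannian_metric ::
    "('m, 'e::real_normed_vector) chart set \<Rightarrow> ('m \<Rightarrow> ('m, 'e) tvec \<Rightarrow> ('m, 'e) tvec \<Rightarrow> real) \<Rightarrow> bool"
  where "riemannian_metric A g \<longleftrightarrow>
    (\<forall>m. \<forall>u\<in>tangent_space A m. lin_on (tangent_space A m) (g m u)) \<and>
    (\<forall>m. \<forall>u\<in>tangent_space A m. \<forall>v\<in>tangent_space A m. g m u v = g m v u) \<and>
    (\<forall>m. \<forall>u\<in>tangent_space A m. u \<noteq> 0 \<longrightarrow> g m u u > 0) \<and>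
    (\<forall>c\<in>A. \<forall>e e'. smooth_on
       (\<lambda>x. g (cinv c x) (tangent_of A c (cinv c x) e) (tangent_of A c (cinv c x) e')) (cimage c))"

definition gnorm :: "('m \<Rightarrow> ('m, 'e) tvec \<Rightarrow> ('m, 'e) tvec \<Rightarrow> real) \<Rightarrow> 'm \<Rightarrow> ('m, 'e) tvec \<Rightarrow> real"
  where "gnorm g m v = sqrt (g m v v)"

text \<open>The space \<open>W \<otimes> T\<^sub>mM\<close> and its Hilbert tensor norm.\<close>

definition wtangent_space ::
    "('m, 'e::real_normed_vector) chart set \<Rightarrow> 'm \<Rightarrow> ('k \<Rightarrow> ('m, 'e) tvec) set"
  where "wtangent_space A m = {\<tau>. \<forall>i. \<tau> i \<in> tangent_space A m}"

definition wgnorm ::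
    "('m \<Rightarrow> ('m, 'e) tvec \<Rightarrow> ('m, 'e) tvec \<Rightarrow> real) \<Rightarrow> 'm \<Rightarrow> ('k::finite \<Rightarrow> ('m, 'e) tvec) \<Rightarrow> real"
  where "wgnorm g m \<tau> = sqrt (\<Sum>i\<in>UNIV. g m (\<tau> i) (\<tau> i))"


section \<open>Gauges\<close>

definition diagonal_domain :: "('m::topological_space \<times> 'm) set \<Rightarrow> bool"
  where "diagonal_domain D \<longleftrightarrow> open D \<and> (\<forall>m. (m, m) \<in> D)"

definition coord_domain ::
    "('m \<times> 'm) set \<Rightarrow> ('m, 'e) chart \<Rightarrow> ('m, 'e) chart \<Rightarrow> ('e \<times> 'e) set"
  where "coord_domain D c c' = {(a, b). a \<in> cimage c \<and> b \<in> cimage c' \<and> (cinv c a, cinv c' b) \<in> D}"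

text \<open>Smoothness of \<open>\<psi>\<close> is smoothness into the tangent bundle: in the bundle chart over \<open>c\<close>, the base
  component of \<open>\<psi> m n\<close> is just \<open>m\<close>, so only the fibre component has to be considered.\<close>

definition logarithm ::
    "('m::topological_space, 'e::real_normed_vector) chart set \<Rightarrow> ('m \<times> 'm) set
      \<Rightarrow> ('m \<Rightarrow> 'm \<Rightarrow> ('m, 'e) tvec) \<Rightarrow> bool"
  where "logarithm A D \<psi> \<longleftrightarrow>
    (\<forall>(m, n)\<in>D. \<psi> m n \<in> tangent_space A m) \<and>
    (\<forall>c\<in>A. \<forall>c'\<in>A. smooth_on (\<lambda>(a, b). \<psi> (cinv c a) (cinv c' b) c) (coord_domain D c c')) \<and>
    (\<forall>m. \<psi> m m = 0) \<and>
    (\<forall>m. \<forall>v\<in>tangent_space A m. dir_deriv A m v (\<psi> m) = v)"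

text \<open>\<open>U n m\<close> maps the tangent space at \<open>m\<close> to the one at \<open>n\<close>; smoothness means that its matrix
  coefficients in all pairs of charts are smooth.\<close>

definition parallelism ::
    "('m::topological_space, 'e::real_normed_vector) chart set \<Rightarrow> ('m \<times> 'm) set
      \<Rightarrow> ('m \<Rightarrow> 'm \<Rightarrow> ('m, 'e) tvec \<Rightarrow> ('m, 'e) tvec) \<Rightarrow> bool"
  where "parallelism A D U \<longleftrightarrow>
    (\<forall>(n, m)\<in>D. lin_on (tangent_space A m) (U n m) \<and>
       U n m ` tangent_space A m \<subseteq> tangent_space A n) \<and>
    (\<forall>c\<in>A. \<forall>c'\<in>A. \<forall>e. smooth_on
       (\<lambda>(a, b). U (cinv c a) (cinv c' b) (tangent_of A c' (cinv c' b) e) c) (coord_domain D c c')) \<and>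
    (\<forall>m. \<forall>v\<in>tangent_space A m. U m m v = v)"

definition manifold_gauge ::
    "('m::topological_space, 'e::real_normed_vector) chart set \<Rightarrow> ('m \<times> 'm) set
      \<Rightarrow> ('m \<Rightarrow> 'm \<Rightarrow> ('m, 'e) tvec) \<Rightarrow> ('m \<Rightarrow> 'm \<Rightarrow> ('m, 'e) tvec \<Rightarrow> ('m, 'e) tvec) \<Rightarrow> bool"
  where "manifold_gauge A D \<psi> U \<longleftrightarrow> diagonal_domain D \<and> logarithm A D \<psi> \<and> parallelism A D U"

text \<open>The parallelism induced by a logarithm: \<open>log_parallelism A \<psi> m n\<close> is the differential of
  \<open>\<psi> m\<close> at \<open>n\<close>.\<close>

definition log_parallelism ::
    "('m, 'e::real_normed_vector) chart set \<Rightarrow> ('m \<Rightarrow> 'm \<Rightarrow> ('m, 'e) tvec)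
      \<Rightarrow> 'm \<Rightarrow> 'm \<Rightarrow> ('m, 'e) tvec \<Rightarrow> ('m, 'e) tvec"
  where "log_parallelism A \<psi> m n = (\<lambda>v. dir_deriv A n v (\<psi> m))"

text \<open>\<open>compat_tensor A U' U m v w\<close> is the value at \<open>v \<otimes> w\<close> of the tensor of the pair \<open>(U', U)\<close>.
  The inverse of \<open>U n m\<close> exists for \<open>n\<close> near \<open>m\<close>, which is all that the derivative depends on.\<close>

definition compat_tensor ::
    "('m, 'e::real_normed_vector) chart set
      \<Rightarrow> ('m \<Rightarrow> 'm \<Rightarrow> ('m, 'e) tvec \<Rightarrow> ('m, 'e) tvec)
      \<Rightarrow> ('m \<Rightarrow> 'm \<Rightarrow> ('m, 'e) tvec \<Rightarrow> ('m, 'e) tvec)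
      \<Rightarrow> 'm \<Rightarrow> ('m, 'e) tvec \<Rightarrow> ('m, 'e) tvec \<Rightarrow> ('m, 'e) tvec"
  where "compat_tensor A U' U m v w =
    dir_deriv A m v (\<lambda>n. inv_into (tangent_space A m) (U n m) (U' n m w))"

definition gauge_tensor ::
    "('m, 'e::real_normed_vector) chart set \<Rightarrow> ('m \<Rightarrow> 'm \<Rightarrow> ('m, 'e) tvec)
      \<Rightarrow> ('m \<Rightarrow> 'm \<Rightarrow> ('m, 'e) tvec \<Rightarrow> ('m, 'e) tvec)
      \<Rightarrow> 'm \<Rightarrow> ('m, 'e) tvec \<Rightarrow> ('m, 'e) tvec \<Rightarrow> ('m, 'e) tvec"
  where "gauge_tensor A \<psi> U = compat_tensor A (log_parallelism A \<psi>) U"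


section \<open>Rough paths and controlled rough paths\<close>

definition Delta :: "real \<Rightarrow> (real \<times> real) set"
  where "Delta T = {(s, t). 0 \<le> s \<and> s \<le> t \<and> t \<le> T}"

definition control :: "real \<Rightarrow> (real \<Rightarrow> real \<Rightarrow> real) \<Rightarrow> bool"
  where "control T \<omega> \<longleftrightarrow>
    continuous_on (Delta T) (\<lambda>(s, t). \<omega> s t) \<and>
    (\<forall>(s, t)\<in>Delta T. 0 \<le> \<omega> s t) \<and>
    (\<forall>s\<in>{0..T}. \<omega> s s = 0) \<and>
    (\<forall>s t u. 0 \<le> s \<and> s \<le> t \<and> t \<le> u \<and> u \<le> T \<longrightarrow> \<omega> s t + \<omega> t u \<le> \<omega> s u)"

definition weak_geometric_rough_path ::
    "real \<Rightarrow> real \<Rightarrow> (real \<Rightarrow> real \<Rightarrow> real) \<Rightarrow> (real \<Rightarrow> real ^ 'k) \<Rightarrow> (real \<Rightarrow> real \<Rightarrow> real ^ 'k ^ 'k) \<Rightarrow> bool"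
  where "weak_geometric_rough_path T p \<omega> x X \<longleftrightarrow>
    continuous_on {0..T} x \<and> continuous_on (Delta T) (\<lambda>(s, t). X s t) \<and>
    (\<forall>s t u. 0 \<le> s \<and> s \<le> t \<and> t \<le> u \<and> u \<le> T \<longrightarrow>
       X s u = X s t + X t u + outer (x t - x s) (x u - x t)) \<and>
    (\<forall>(s, t)\<in>Delta T.
       norm (x t - x s) \<le> \<omega> s t powr (1 / p) \<and>
       norm (X s t) \<le> \<omega> s t powr (2 / p) \<and>
       (1 / 2) *\<^sub>R (X s t + transpose (X s t)) = (1 / 2) *\<^sub>R outer (x t - x s) (x t - x s))"

text \<open>The relation \<open>F \<approx>\<^sub>i G\<close>: \<open>nrm s\<close> is the norm of the space in which \<open>F s t\<close> and \<open>G s t\<close> lie, and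
  \<open>dfd s t\<close> expresses that both are defined, which is to hold for all \<open>t - s \<le> \<delta>\<close>.\<close>

definition approx ::
    "real \<Rightarrow> real \<Rightarrow> (real \<Rightarrow> real \<Rightarrow> real) \<Rightarrow> nat \<Rightarrow> (real \<Rightarrow> real \<Rightarrow> bool) \<Rightarrow> (real \<Rightarrow> 'b::minus \<Rightarrow> real)
      \<Rightarrow> (real \<Rightarrow> real \<Rightarrow> 'b) \<Rightarrow> (real \<Rightarrow> real \<Rightarrow> 'b) \<Rightarrow> bool"
  where "approx T p \<omega> i dfd nrm F G \<longleftrightarrow>
    (\<exists>C. \<exists>\<delta>>0. \<forall>(s, t)\<in>Delta T. t - s \<le> \<delta> \<longrightarrow>
       dfd s t \<and> nrm s (F s t - G s t) \<le> C * \<omega> s t powr (real i / p))"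

text \<open>Paths on \<open>[0, T]\<close> are represented by functions in \<open>extensional {0..T}\<close>, so that equality
  of paths is equality of functions.\<close>

definition CRP_space ::
    "real \<Rightarrow> real \<Rightarrow> (real \<Rightarrow> real \<Rightarrow> real) \<Rightarrow> (real \<Rightarrow> real ^ 'k)
      \<Rightarrow> ((real \<Rightarrow> 'v::real_normed_vector) \<times> (real \<Rightarrow> (real ^ 'k) \<Rightarrow>\<^sub>L 'v)) set"
  where "CRP_space T p \<omega> x = {(z, zd).
    z \<in> extensional {0..T} \<and> zd \<in> extensional {0..T} \<and>
    continuous_on {0..T} z \<and> continuous_on {0..T} zd \<and>
    (\<exists>C. \<forall>(s, t)\<in>Delta T.
       norm (z t - z s - blinfun_apply (zd s) (x t - x s)) \<le> C * \<omega> s t powr (2 / p) \<and>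
       norm (zd t - zd s) \<le> C * \<omega> s t powr (1 / p))}"

text \<open>Continuity of \<open>yd\<close> is continuity as a path in the bundle of linear maps from \<open>W\<close> to the tangent
  spaces: over each chart domain its coordinates are continuous.\<close>

definition CRP_manifold ::
    "('m::topological_space, 'e::real_normed_vector) chart set
      \<Rightarrow> ('m \<Rightarrow> ('m, 'e) tvec \<Rightarrow> ('m, 'e) tvec \<Rightarrow> real)
      \<Rightarrow> ('m \<times> 'm) set \<Rightarrow> ('m \<Rightarrow> 'm \<Rightarrow> ('m, 'e) tvec) \<Rightarrow> ('m \<Rightarrow> 'm \<Rightarrow> ('m, 'e) tvec \<Rightarrow> ('m, 'e) tvec)
      \<Rightarrow> real \<Rightarrow> real \<Rightarrow> (real \<Rightarrow> real \<Rightarrow> real) \<Rightarrow> (real \<Rightarrow> real ^ 'k)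
      \<Rightarrow> ((real \<Rightarrow> 'm) \<times> (real \<Rightarrow> real ^ 'k \<Rightarrow> ('m, 'e) tvec)) set"
  where "CRP_manifold A g D \<psi> U T p \<omega> x = {(y, yd).
    continuous_on {0..T} y \<and>
    (\<forall>s\<in>{0..T}. linear (yd s) \<and> range (yd s) \<subseteq> tangent_space A (y s)) \<and>
    (\<forall>c\<in>A. \<forall>w. continuous_on {s \<in> {0..T}. y s \<in> fst c} (\<lambda>s. yd s w c)) \<and>
    approx T p \<omega> 2 (\<lambda>s t. (y s, y t) \<in> D) (\<lambda>s. gnorm g (y s))
      (\<lambda>s t. \<psi> (y s) (y t)) (\<lambda>s t. yd s (x t - x s)) \<and>
    approx T p \<omega> 1 (\<lambda>s t. (y s, y t) \<in> D) (\<lambda>s. op_norm UNIV norm (gnorm g (y s)))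
      (\<lambda>s t. U (y s) (y t) \<circ> yd t) (\<lambda>s t. yd s)}"

definition CRP_forms ::
    "('m::topological_space, 'e::real_normed_vector) chart set
      \<Rightarrow> ('m \<Rightarrow> ('m, 'e) tvec \<Rightarrow> ('m, 'e) tvec \<Rightarrow> real)
      \<Rightarrow> ('m \<times> 'm) set \<Rightarrow> ('m \<Rightarrow> 'm \<Rightarrow> ('m, 'e) tvec \<Rightarrow> ('m, 'e) tvec)
      \<Rightarrow> real \<Rightarrow> real \<Rightarrow> (real \<Rightarrow> real \<Rightarrow> real) \<Rightarrow> (real \<Rightarrow> real ^ 'k) \<Rightarrow> (real \<Rightarrow> 'm)
      \<Rightarrow> ((real \<Rightarrow> ('m, 'e) tvec \<Rightarrow> 'v::real_normed_vector) \<times>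
          (real \<Rightarrow> ('k \<Rightarrow> ('m, 'e) tvec) \<Rightarrow> 'v)) set"
  where "CRP_forms A g D U T p \<omega> x y = {(\<alpha>, \<alpha>d).
    (\<forall>s\<in>{0..T}. lin_on (tangent_space A (y s)) (\<alpha> s) \<and> lin_on (wtangent_space A (y s)) (\<alpha>d s)) \<and>
    approx T p \<omega> 2 (\<lambda>s t. (y t, y s) \<in> D)
      (\<lambda>s. op_norm (tangent_space A (y s)) (gnorm g (y s)) norm)
      (\<lambda>s t. (\<alpha> t \<circ> U (y t) (y s)) - \<alpha> s - (\<lambda>v. \<alpha>d s (wtensor (x t - x s) v)))
      (\<lambda>s t. 0) \<and>
    approx T p \<omega> 1 (\<lambda>s t. (y t, y s) \<in> D)
      (\<lambda>s. op_norm (wtangent_space A (y s)) (wgnorm g (y s)) norm)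
      (\<lambda>s t. (\<alpha>d t \<circ> id_tensor (U (y t) (y s))) - \<alpha>d s)
      (\<lambda>s t. 0)}"

definition ztilde ::
    "('m, 'e::real_normed_vector) chart set
      \<Rightarrow> ('m \<Rightarrow> 'm \<Rightarrow> ('m, 'e) tvec) \<Rightarrow> ('m \<Rightarrow> 'm \<Rightarrow> ('m, 'e) tvec \<Rightarrow> ('m, 'e) tvec)
      \<Rightarrow> (real \<Rightarrow> real \<Rightarrow> real ^ 'k ^ 'k)
      \<Rightarrow> (real \<Rightarrow> 'm) \<Rightarrow> (real \<Rightarrow> real ^ 'k \<Rightarrow> ('m, 'e) tvec)
      \<Rightarrow> (real \<Rightarrow> ('m, 'e) tvec \<Rightarrow> 'v::real_normed_vector)
      \<Rightarrow> (real \<Rightarrow> ('k \<Rightarrow> ('m, 'e) tvec) \<Rightarrow> 'v) \<Rightarrow> real \<Rightarrow> real \<Rightarrow> 'v"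
  where "ztilde A \<psi> U X y yd \<alpha> \<alpha>d s t =
    \<alpha> s (\<psi> (y s) (y t) + apply_tensor_square (gauge_tensor A \<psi> U (y s)) (yd s) (X s t))
    + \<alpha>d s (id_tensor_mat (yd s) (X s t))"

end

theory Submission
  imports Defs
begin

text \<open>In a chart, let \<open>\<Psi>\<close> and \<open>u\<close> be the coordinate expressions of the logarithm and of the parallelism.
  The defect \<open>\<Xi>\<^sub>s\<^sub>v - \<Xi>\<^sub>s\<^sub>t - \<Xi>\<^sub>t\<^sub>v\<close> of the germ \<open>\<Xi>\<close> splits, by Chen's relation and the two controlled
  expansions of the one-form, into terms of order 3 and \<open>\<beta>\<^sub>t\<close> applied to
  \<open>u(b, a)(\<Psi>(a, c) - \<Psi>(a, b)) - \<Psi>(b, c) + S\<^sub>a(b - a, c - b)\<close>, where \<open>a\<close>, \<open>b\<close>, \<open>c\<close> are the positions at the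
  times \<open>s\<close>, \<open>t\<close>, \<open>v\<close>. The compatibility tensor is what makes the last expression
  of third order. Compactness of \<open>[0, T]\<close> makes the constants uniform, and as \<open>3 / p > 1\<close> the germ can be
  sewn to a unique additive functional.\<close>

section \<open>Finite-dimensional normed spaces\<close>

text \<open>All orders are counted in \<open>h s t = \<omega> s t powr (1 / p)\<close>: increments
  of \<open>x\<close> and of the coordinates of \<open>y\<close> have order 1, \<open>X\<close> has
  order 2, and the defect must reach order 3. Two encodings shape the work. The model space is only
  a normed space spanned by a finite set, and smoothness is given for one direction at a time; so
  boundedness, compactness and locally uniform constants come from coordinates in a basis, where
  finitely many directions suffice. The compatibility tensor is the derivative of a pointwise
  \<open>inv_into\<close> on families of coordinates over all charts; it has to be recognised as the
  bilinear map \<open>chart_tensor\<close>, in which the derivative of the parallelism has a minus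
  sign because the parallelism is inverted. The Riemannian norms of the hypotheses are exchanged for
  the chart norm, with which they are comparable near a point. Finally, sewing controls the path on
  short intervals, whereas \<open>CRP_space\<close> asks for all pairs of times; the length of the
  intervals is doubled until it reaches \<open>T\<close>.\<close>

definition fin_basis :: "'a::real_vector set \<Rightarrow> bool"
  where "fin_basis B \<longleftrightarrow> finite B \<and> independent B \<and> span B = UNIV"

lemma fin_basis_exists:
  assumes "finite S" "span S = (UNIV :: 'a::real_vector set)"
  shows "\<exists>B::'a set. fin_basis B"
proof -
  obtain B where "B \<subseteq> S" "independent B" "S \<subseteq> span B" using maximal_independent_subset[of S] by blast
  then have "finite B" "span B = UNIV" using assms finite_subset span_mono[of S "span B"] by (auto simp: span_span)
  then show ?thesis using \<open>independent B\<close> by (auto simp: fin_basis_def)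
qed

text \<open>The logarithm and the parallelism are functions of two points; in a chart their Taylor
  expansion takes place on the product of the model space with itself, which therefore needs a basis
  too.\<close>

lemma fin_basis_prod_exists:
  assumes "fin_basis (B :: 'a::real_vector set)"
  shows "\<exists>B'::('a \<times> 'a) set. fin_basis B'"
proof (rule fin_basis_exists)
  let ?S = "(\<lambda>b. (b, 0)) ` B \<union> (\<lambda>b. (0, b)) ` B"
  show "finite ?S" using assms by (auto simp: fin_basis_def)
  have l: "linear (\<lambda>b::'a. (b, 0::'a))" "linear (\<lambda>b::'a. (0::'a, b))"
    by (auto intro!: linearI simp: zero_prod_def)
  have "(u, v) \<in> span ?S" for u v
  proof -
    have sub: "span ((\<lambda>b. (b, 0)) ` B) \<subseteq> span ?S" "span ((\<lambda>b. (0, b)) ` B) \<subseteq> span ?S"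
      by (intro span_mono; blast)+
    have "(u, 0) \<in> (\<lambda>b. (b, 0)) ` span B" "(0, v) \<in> (\<lambda>b. (0, b)) ` span B"
      using assms by (auto simp: fin_basis_def)
    then have "(u, 0) \<in> span ?S" "(0, v) \<in> span ?S"
      using sub linear_span_image[OF l(1), of B] linear_span_image[OF l(2), of B] by auto
    then have "(u, 0) + (0, v) \<in> span ?S" by (rule span_add)
    then show ?thesis by simp
  qed
  then show "span ?S = UNIV" by auto
qed

lemma fin_basis_coords:
  assumes "fin_basis B"
  shows "(\<Sum>b\<in>B. representation B v b *\<^sub>R b) = v"
    and "representation B (u + v) b = representation B u b + representation B v b"
    and "representation B (r *\<^sub>R v) b = r * representation B v b"
    and "b \<notin> B \<Longrightarrow> representation B v b = 0"
proof -
  have B: "finite B" "independent B" "span B = UNIV" using assms by (auto simp: fin_basis_def)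
  show "(\<Sum>b\<in>B. representation B v b *\<^sub>R b) = v"
    using B by (intro sum_representation_eq) auto
  show "representation B (u + v) b = representation B u b + representation B v b"
    using B by (simp add: representation_add)
  show "representation B (r *\<^sub>R v) b = r * representation B v b"
    using B by (simp add: representation_scale)
  show "b \<notin> B \<Longrightarrow> representation B v b = 0"
    using representation_ne_zero by blast
qed

lemma fin_basis_linear_expand:
  assumes "fin_basis B" "linear f"
  shows "f v = (\<Sum>b\<in>B. representation B v b *\<^sub>R f b)"
proof -
  have "f v = f (\<Sum>b\<in>B. representation B v b *\<^sub>R b)" by (simp add: fin_basis_coords(1)[OF assms(1)])
  then show ?thesis by (simp add: linear_sum[OF assms(2)] linear_scale[OF assms(2)])
qed

text \<open>Compactness of the unit sphere of the coordinate maximum norm, a finite union of compact boxes,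
  replaces local compactness of the space.\<close>

lemma pos_quadratic_coercive:
  fixes Q :: "'a::real_vector \<Rightarrow> real"
  assumes B: "fin_basis B"
    and cont: "continuous_on UNIV (\<lambda>f::'a \<Rightarrow> real. Q (\<Sum>b\<in>B. f b *\<^sub>R b))"
    and pos: "\<And>v. v \<noteq> 0 \<Longrightarrow> Q v > 0" and hom: "\<And>r v. Q (r *\<^sub>R v) = r\<^sup>2 * Q v"
  shows "\<exists>l>0. \<forall>v. \<forall>b. l * (representation B v b)\<^sup>2 \<le> Q v"
proof -
  have fin: "finite B" and ind: "independent B" using B by (auto simp: fin_basis_def)
  \<comment> \<open>In the box of \<open>c\<close> the coordinate \<open>c\<close> is 1 or -1 and
    the other basis coordinates lie in [-1, 1]. The index set is the whole type, with the factor {0}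
    off \<open>B\<close>, so that Tychonoff's theorem applies to the product topology of
    functions.\<close>
  define K where "K = (\<Union>c\<in>B. PiE UNIV (\<lambda>b. if b = c then {-1, 1} else if b \<in> B then {-1..1} else {0::real}))"
  have "compact K" unfolding K_def
  proof (rule compact_UN[OF fin])
    fix c
    have "compactin (product_topology (\<lambda>i::'a. euclidean::real topology) UNIV)
       (PiE UNIV (\<lambda>b. if b = c then {-1, 1} else if b \<in> B then {-1..1} else {0::real}))"
      unfolding compactin_PiE by auto
    then show "compact (PiE UNIV (\<lambda>b. if b = c then {-1, 1} else if b \<in> B then {-1..1} else {0::real}))"
      by (simp add: euclidean_product_topology flip: compactin_euclidean_iff)
  qed
  have ne: "(\<Sum>b\<in>B. f b *\<^sub>R b) \<noteq> 0" if "f \<in> K" for f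
  proof
    assume "(\<Sum>b\<in>B. f b *\<^sub>R b) = 0"
    then have "\<forall>b\<in>B. f b = 0" using ind fin by (auto simp: independent_explicit_finite_subsets)
    moreover obtain c where c: "c \<in> B" "f \<in> PiE UNIV (\<lambda>b. if b = c then {-1, 1} else if b \<in> B then {-1..1} else {0::real})"
      using \<open>f \<in> K\<close> unfolding K_def by blast
    from PiE_mem[OF c(2), of c] have "f c \<noteq> 0" by auto
    ultimately show False using c(1) by auto
  qed
  have "\<exists>l>0. \<forall>f\<in>K. l \<le> Q (\<Sum>b\<in>B. f b *\<^sub>R b)"
  proof (cases "K = {}")
    \<comment> \<open>This happens in dimension 0 only, where there is no box; any positive
      \<open>l\<close> serves then.\<close>
    case True
    then show ?thesis by (auto intro: exI[of _ 1])
  next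
    case False
    obtain f0 where "f0 \<in> K" "\<forall>f\<in>K. Q (\<Sum>b\<in>B. f0 b *\<^sub>R b) \<le> Q (\<Sum>b\<in>B. f b *\<^sub>R b)"
      using continuous_attains_inf[OF \<open>compact K\<close> False continuous_on_subset[OF cont]] by blast
    then show ?thesis using pos[OF ne[of f0]] by blast
  qed
  then obtain l where l: "l > 0" "\<And>f. f \<in> K \<Longrightarrow> l \<le> Q (\<Sum>b\<in>B. f b *\<^sub>R b)" by blast
  have Q0: "Q 0 = 0" using hom[of 0 0] by simp
  have "l * (representation B v b)\<^sup>2 \<le> Q v" for v b
  proof (cases "representation B v b = 0")
    case True
    then show ?thesis using pos[of v] Q0 by (cases "v = 0") auto
  next
    case False
    let ?r = "representation B v"
    have bB: "b \<in> B" using False fin_basis_coords(4)[OF B] by blast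
    \<comment> \<open>Dividing by the largest modulus of a coordinate moves \<open>v\<close> into
      \<open>K\<close>, into the box of an index \<open>c\<close> where the maximum is attained;
      quadratic homogeneity brings the factor \<open>M\<close> back.\<close>
    define M where "M = Max ((\<lambda>b. \<bar>?r b\<bar>) ` B)"
    have Mle: "\<bar>?r b\<bar> \<le> M" if "b \<in> B" for b unfolding M_def using fin that by (intro Max_ge) auto
    have "M \<in> (\<lambda>b. \<bar>?r b\<bar>) ` B" unfolding M_def using fin bB by (intro Max_in) auto
    then obtain c where c: "c \<in> B" "M = \<bar>?r c\<bar>" by auto
    have M0: "M > 0" using Mle[OF bB] False by linarith
    define f where "f b' = ?r b' / M" for b'
    have "f \<in> K"
      unfolding K_def
    proof (rule UN_I[OF c(1)], rule PiE_I)
      fix d :: 'a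
      have "\<bar>?r d\<bar> \<le> M" "d \<notin> B \<Longrightarrow> ?r d = 0"
        using Mle[of d] fin_basis_coords(4)[OF B, of d v] M0 by (cases "d \<in> B"; auto)+
      then show "f d \<in> (if d = c then {-1, 1} else if d \<in> B then {-1..1} else {0})"
        using M0 c(2) unfolding f_def by (auto simp: field_simps abs_le_iff abs_if split: if_splits)
    qed auto
    have "v = M *\<^sub>R (\<Sum>b\<in>B. f b *\<^sub>R b)"
      using M0 fin_basis_coords(1)[OF B, of v] by (simp add: scaleR_sum_right f_def)
    then have "Q v = M\<^sup>2 * Q (\<Sum>b\<in>B. f b *\<^sub>R b)" using hom by metis
    moreover have "l * (?r b)\<^sup>2 \<le> l * M\<^sup>2" using l(1) Mle[OF bB] abs_le_square_iff[of "?r b" M] M0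
      by (intro mult_left_mono) auto
    moreover have "l * M\<^sup>2 \<le> M\<^sup>2 * Q (\<Sum>b\<in>B. f b *\<^sub>R b)" using l(2)[OF \<open>f \<in> K\<close>]
      by (subst mult.commute, intro mult_left_mono) auto
    ultimately show ?thesis by linarith
  qed
  then show ?thesis using l(1) by blast
qed

text \<open>Coercivity of the squared norm, that is, the equivalence of norms in finite dimension.
  Constants that are uniform in a direction come from here.\<close>

lemma fin_basis_coord_bound:
  assumes "fin_basis (B :: 'a::real_normed_vector set)"
  shows "\<exists>C>0. \<forall>v. \<forall>b. \<bar>representation B v b\<bar> \<le> C * norm v"
proof -
  have "continuous_on UNIV (\<lambda>f::'a \<Rightarrow> real. (norm (\<Sum>b\<in>B. f b *\<^sub>R b))\<^sup>2)"
    by (intro continuous_intros continuous_on_product_coordinates)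
  then obtain l where l: "l > 0" "\<And>v b. l * (representation B v b)\<^sup>2 \<le> (norm v)\<^sup>2"
    using pos_quadratic_coercive[OF assms, of "\<lambda>v. (norm v)\<^sup>2"] by (auto simp: power_mult_distrib)
  have "\<bar>representation B v b\<bar> \<le> (1 / sqrt l) * norm v" for v b
  proof -
    have "sqrt (l * (representation B v b)\<^sup>2) \<le> norm v" using l(2) by (intro real_le_lsqrt) auto
    then show ?thesis using l(1) by (simp add: real_sqrt_mult field_simps)
  qed
  then show ?thesis using l(1) by (intro exI[of _ "1 / sqrt l"]) auto
qed

text \<open>Expansion in the basis turns bounds at the finitely many basis vectors into an operator
  bound. Since smoothness is formulated for one fixed direction at a time, this is the way to
  estimates that are uniform over all directions.\<close>

lemma fin_basis_norm_le:
  assumes B: "fin_basis (B :: 'a::real_normed_vector set)"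
    and C: "\<And>v b. \<bar>representation B v b\<bar> \<le> C * norm v"
    and "linear f" and M: "\<And>b. b \<in> B \<Longrightarrow> norm (f b :: 'b::real_normed_vector) \<le> M b"
  shows "norm (f v) \<le> (C * (\<Sum>b\<in>B. M b)) * norm v"
proof -
  have "norm (f v) \<le> (\<Sum>b\<in>B. norm (representation B v b *\<^sub>R f b))"
    unfolding fin_basis_linear_expand[OF B assms(3), of v] by (rule norm_sum)
  also have "\<dots> \<le> (\<Sum>b\<in>B. C * norm v * M b)"
  proof (rule sum_mono)
    fix b assume "b \<in> B"
    then show "norm (representation B v b *\<^sub>R f b) \<le> C * norm v * M b"
      using C[of v b] M[of b] order_trans[OF abs_ge_zero C[of v b]] by (auto intro!: mult_mono)
  qed
  also have "\<dots> = (C * (\<Sum>b\<in>B. M b)) * norm v"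
    by (simp add: sum_distrib_left sum_distrib_right algebra_simps)
  finally show ?thesis .
qed

lemma fin_basis_bounded_linear:
  assumes B: "fin_basis (B :: 'a::real_normed_vector set)" and "linear (f :: 'a \<Rightarrow> 'b::real_normed_vector)"
  shows "bounded_linear f"
proof -
  obtain C where "\<And>v b. \<bar>representation B v b\<bar> \<le> C * norm v" using fin_basis_coord_bound[OF B] by blast
  from fin_basis_norm_le[OF B this assms(2), of "\<lambda>b. norm (f b)"]
  show ?thesis using assms(2)
    by (intro bounded_linear_intro[where K = "C * (\<Sum>b\<in>B. norm (f b))"])
      (auto simp: linear_add linear_scale mult.commute)
qed

text \<open>Continuity of \<open>F x b\<close> in \<open>x\<close> for each fixed \<open>b\<close>
  already bounds the operators locally uniformly: near \<open>x0\<close> the norms of the finitely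
  many values at basis vectors exceed those at \<open>x0\<close> by less than 1.\<close>

lemma fin_basis_bound_near:
  fixes F :: "'a::real_normed_vector \<Rightarrow> 'b::real_normed_vector \<Rightarrow> 'c::real_normed_vector"
  assumes B: "fin_basis (B :: 'b set)" and lin: "\<And>x. x \<in> S \<Longrightarrow> linear (F x)"
    and S: "open S" "x0 \<in> S" and cont: "\<And>b. continuous_on S (\<lambda>x. F x b)"
  shows "\<exists>r>0. \<exists>C\<ge>0. ball x0 r \<subseteq> S \<and> (\<forall>x\<in>ball x0 r. \<forall>v. norm (F x v) \<le> C * norm v)"
proof -
  have fin: "finite B" using B by (auto simp: fin_basis_def)
  obtain C where C: "C > 0" "\<And>v b. \<bar>representation B v b\<bar> \<le> C * norm v" using fin_basis_coord_bound[OF B] by blast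
  have "\<forall>\<^sub>F x in nhds x0. norm (F x b) < norm (F x0 b) + 1" for b
  proof -
    have "((\<lambda>x. F x b) \<longlongrightarrow> F x0 b) (nhds x0)"
      using cont[of b] S tendsto_at_iff_tendsto_nhds[of "\<lambda>x. F x b" x0]
      by (auto simp: continuous_on_eq_continuous_at isCont_def)
    then have "((\<lambda>x. norm (F x b)) \<longlongrightarrow> norm (F x0 b)) (nhds x0)" by (rule tendsto_norm)
    then show ?thesis by (rule order_tendstoD(2)) simp
  qed
  then have "\<forall>\<^sub>F x in nhds x0. \<forall>b\<in>B. norm (F x b) < norm (F x0 b) + 1"
    using fin by (simp add: eventually_ball_finite_distrib)
  moreover have "\<forall>\<^sub>F x in nhds x0. x \<in> S" using S by (rule eventually_nhds_in_open)
  ultimately have "\<forall>\<^sub>F x in nhds x0. x \<in> S \<and> (\<forall>b\<in>B. norm (F x b) < norm (F x0 b) + 1)"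
    by (auto intro: eventually_conj)
  then obtain r where r: "r > 0" "\<And>x. dist x x0 < r \<Longrightarrow> x \<in> S \<and> (\<forall>b\<in>B. norm (F x b) < norm (F x0 b) + 1)"
    unfolding eventually_nhds_metric by blast
  have "norm (F x v) \<le> (C * (\<Sum>b\<in>B. norm (F x0 b) + 1)) * norm v" if "x \<in> ball x0 r" for x v
    using r(2)[of x] that lin[of x]
    by (intro fin_basis_norm_le[OF B C(2)]) (auto simp: dist_commute less_imp_le)
  moreover have "ball x0 r \<subseteq> S" using r(2) by (auto simp: dist_commute)
  moreover have "C * (\<Sum>b\<in>B. norm (F x0 b) + 1) \<ge> 0" using C(1) by (auto intro!: mult_nonneg_nonneg sum_nonneg)
  ultimately show ?thesis using r(1) by blast
qed

section \<open>Locally uniform Lipschitz and Taylor estimates\<close>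

lemma Ck_on_imp_continuous_on: "Ck_on k f S \<Longrightarrow> continuous_on S f"
  by (cases k) (auto intro!: continuous_at_imp_continuous_on differentiable_imp_continuous_within)

lemma Ck_on_has_derivative:
  "Ck_on (Suc k) f S \<Longrightarrow> x \<in> S \<Longrightarrow> (f has_derivative frechet_derivative f (at x)) (at x)"
  by (auto simp: frechet_derivative_works[symmetric])

text \<open>The derivative is linear and, for each direction, continuous in the point, hence bounded
  on a ball; the mean value inequality on the convex ball then gives the Lipschitz bound.\<close>

lemma C1_locally_lipschitz:
  fixes f :: "'a::real_normed_vector \<Rightarrow> 'b::real_normed_vector"
  assumes B: "fin_basis (B :: 'a set)" and f: "Ck_on 1 f S" and S: "open S" "x0 \<in> S"
  shows "\<exists>r>0. \<exists>C\<ge>0. ball x0 r \<subseteq> S \<and>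
    (\<forall>x\<in>ball x0 r. \<forall>v. norm (frechet_derivative f (at x) v) \<le> C * norm v) \<and>
    (\<forall>x\<in>ball x0 r. \<forall>y\<in>ball x0 r. norm (f x - f y) \<le> C * norm (x - y))"
proof -
  have d: "(f has_derivative frechet_derivative f (at x)) (at x)" if "x \<in> S" for x
    using Ck_on_has_derivative[of 0 f S] f that by simp
  obtain r C where r: "r > 0" "C \<ge> 0" "ball x0 r \<subseteq> S"
     "\<forall>x\<in>ball x0 r. \<forall>v. norm (frechet_derivative f (at x) v) \<le> C * norm v"
    using fin_basis_bound_near[OF B _ S, of "\<lambda>x. frechet_derivative f (at x)"] f
      has_derivative_linear[OF d] by auto
  have "norm (f x - f y) \<le> C * norm (x - y)" if "x \<in> ball x0 r" "y \<in> ball x0 r" for x y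
  proof (rule differentiable_bound[OF convex_ball _ _ that])
    fix z assume z: "z \<in> ball x0 r"
    show "(f has_derivative frechet_derivative f (at z)) (at z within ball x0 r)"
      using z r(3) by (intro has_derivative_at_withinI[OF d]) auto
    show "onorm (frechet_derivative f (at z)) \<le> C" using r z by (intro onorm_bound) auto
  qed
  then show ?thesis using r by blast
qed

text \<open>Applied to the directional derivatives along basis vectors, the case of one derivative
  shows that the derivative is Lipschitz in operator norm. The point \<open>z\<close> at which the
  derivative is frozen is independent of \<open>x\<close> and \<open>y\<close>, because later it is
  a diagonal point, where the derivatives of a gauge are known or define the tensor.\<close>

lemma C2_taylor:
  fixes f :: "'a::real_normed_vector \<Rightarrow> 'b::real_normed_vector"
  assumes B: "fin_basis (B :: 'a set)" and f: "Ck_on 2 f S" and S: "open S" "x0 \<in> S"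
  shows "\<exists>r>0. \<exists>C\<ge>0. ball x0 r \<subseteq> S \<and>
    (\<forall>x\<in>ball x0 r. \<forall>v. norm (frechet_derivative f (at x) v) \<le> C * norm v) \<and>
    (\<forall>x\<in>ball x0 r. \<forall>y\<in>ball x0 r. norm (f x - f y) \<le> C * norm (x - y)) \<and>
    (\<forall>x\<in>ball x0 r. \<forall>y\<in>ball x0 r. \<forall>v.
      norm (frechet_derivative f (at x) v - frechet_derivative f (at y) v) \<le> C * norm (x - y) * norm v) \<and>
    (\<forall>x\<in>ball x0 r. \<forall>y\<in>ball x0 r. \<forall>z\<in>ball x0 r.
      norm (f x - f y - frechet_derivative f (at z) (x - y)) \<le> C * norm (x - y) * (norm (x - y) + norm (y - z)))"
proof -
  let ?D = "\<lambda>x. frechet_derivative f (at x)"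
  have fin: "finite B" using B by (auto simp: fin_basis_def)
  have f1: "Ck_on 1 f S" and fd: "Ck_on 1 (\<lambda>x. ?D x v) S" for v
    using f Ck_on_imp_continuous_on[of 1 "\<lambda>x. ?D x v" S for v] by (auto simp: numeral_2_eq_2)
  have d: "(f has_derivative ?D x) (at x)" if "x \<in> S" for x
    using Ck_on_has_derivative[of 0 f S] f1 that by simp
  obtain r1 C1 where r1: "r1 > 0" "C1 \<ge> 0" "ball x0 r1 \<subseteq> S"
    "\<forall>x\<in>ball x0 r1. \<forall>v. norm (?D x v) \<le> C1 * norm v"
    "\<forall>x\<in>ball x0 r1. \<forall>y\<in>ball x0 r1. norm (f x - f y) \<le> C1 * norm (x - y)"
    using C1_locally_lipschitz[OF B f1 S] by blast
  have "\<forall>v. \<exists>r C. r > 0 \<and> C \<ge> 0 \<and> (\<forall>x\<in>ball x0 r. \<forall>y\<in>ball x0 r. norm (?D x v - ?D y v) \<le> C * norm (x - y))"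
    using C1_locally_lipschitz[OF B fd S] by blast
  then obtain rr CC where rc: "\<And>v. rr v > 0" "\<And>v. CC v \<ge> 0"
    "\<And>v x y. x \<in> ball x0 (rr v) \<Longrightarrow> y \<in> ball x0 (rr v) \<Longrightarrow> norm (?D x v - ?D y v) \<le> CC v * norm (x - y)"
    by metis
  obtain K where K: "K > 0" "\<And>v b. \<bar>representation B v b\<bar> \<le> K * norm v" using fin_basis_coord_bound[OF B] by blast
  \<comment> \<open>Radii and constants exist for each direction separately; only the finitely many
    of the basis vectors enter.\<close>
  define r where "r = Min (insert r1 (rr ` B))"
  have r: "r > 0" "r \<le> r1" "\<And>b. b \<in> B \<Longrightarrow> r \<le> rr b" unfolding r_def using fin r1 rc by auto
  define C2 where "C2 = K * (\<Sum>b\<in>B. CC b)"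
  have C2: "C2 \<ge> 0" unfolding C2_def using K rc by (auto intro!: mult_nonneg_nonneg sum_nonneg)
  have inS: "x \<in> S" "x \<in> ball x0 r1" if "x \<in> ball x0 r" for x using that r r1 by auto
  have lip: "norm (?D x v - ?D y v) \<le> C2 * norm (x - y) * norm v" if "x \<in> ball x0 r" "y \<in> ball x0 r" for x y v
  proof -
    have "linear (\<lambda>v. ?D x v - ?D y v)"
      using has_derivative_linear[OF d] inS that by (intro linear_compose_sub) auto
    then have "norm (?D x v - ?D y v) \<le> (K * (\<Sum>b\<in>B. CC b * norm (x - y))) * norm v"
    proof (rule fin_basis_norm_le[OF B K(2)])
      fix b assume "b \<in> B"
      then show "norm (?D x b - ?D y b) \<le> CC b * norm (x - y)" using rc(3)[of x b y] r(3)[of b] that by auto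
    qed
    then show ?thesis unfolding C2_def by (simp add: sum_distrib_right mult.assoc)
  qed
  have tay: "norm (f x - f y - ?D z (x - y)) \<le> C2 * norm (x - y) * (norm (x - y) + norm (y - z))"
    if "x \<in> ball x0 r" "y \<in> ball x0 r" "z \<in> ball x0 r" for x y z
  proof -
    have seg: "closed_segment x y \<subseteq> ball x0 r" using that by (intro closed_segment_subset) auto
    have lz: "bounded_linear (?D z)" using d inS that has_derivative_bounded_linear by blast
    \<comment> \<open>Mean value inequality for \<open>f\<close> minus its linearisation at
      \<open>z\<close> on the segment: the derivative at \<open>w\<close> is
      \<open>?D w - ?D z\<close>, which is small because \<open>w\<close> is no farther from
      \<open>z\<close> than \<open>norm (x - y) + norm (y - z)\<close>.\<close>
    have "norm ((f x - ?D z x) - (f y - ?D z y)) \<le> (C2 * (norm (x - y) + norm (y - z))) * norm (x - y)"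
    proof (rule differentiable_bound[of "closed_segment x y"])
      fix w assume w: "w \<in> closed_segment x y"
      then have wb: "w \<in> ball x0 r" using seg by auto
      show "((\<lambda>x. f x - ?D z x) has_derivative (\<lambda>v. ?D w v - ?D z v)) (at w within closed_segment x y)"
        using inS wb by (intro has_derivative_diff has_derivative_at_withinI[OF d] bounded_linear_imp_has_derivative lz) auto
      have "norm (w - z) \<le> norm (w - y) + norm (y - z)" by (rule norm_diff_triangle_le) auto
      also have "norm (w - y) \<le> norm (x - y)" using segment_bound[OF w] by (simp add: norm_minus_commute)
      finally have "C2 * norm (w - z) \<le> C2 * (norm (x - y) + norm (y - z))" using C2 by (simp add: mult_left_mono)
      then show "onorm (\<lambda>v. ?D w v - ?D z v) \<le> C2 * (norm (x - y) + norm (y - z))"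
        using lip[OF wb that(3)] C2
        by (intro onorm_bound) (auto intro!: order_trans[OF lip[OF wb that(3)]] mult_right_mono mult_nonneg_nonneg)
    qed auto
    then show ?thesis by (simp add: linear_diff[OF bounded_linear.linear[OF lz]] algebra_simps)
  qed
  let ?C = "max C1 C2"
  have "C1 \<le> ?C" "C2 \<le> ?C" "ball x0 r \<subseteq> S" using inS by auto
  have le: "a \<le> ?C * u" if "a \<le> C1 * u \<or> a \<le> C2 * u" "u \<ge> 0" for a u :: real
    using that mult_right_mono[OF \<open>C1 \<le> ?C\<close> that(2)] mult_right_mono[OF \<open>C2 \<le> ?C\<close> that(2)] by linarith
  show ?thesis
    using r(1) C2 \<open>ball x0 r \<subseteq> S\<close> r1(4,5) inS lip tay
    by (intro exI[of _ r] exI[of _ ?C] conjI ballI allI) (auto simp: mult.assoc intro!: le)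
qed

section \<open>Gauges in a chart\<close>

text \<open>The gauge tensor in a chart, for the coordinate expressions of a logarithm and of a parallelism.
  Expanding the second argument in a basis makes linearity in that argument immediate.\<close>

definition chart_tensor ::
    "'e::real_normed_vector set \<Rightarrow> ('e \<Rightarrow> 'e \<Rightarrow> 'e) \<Rightarrow> ('e \<Rightarrow> 'e \<Rightarrow> 'e \<Rightarrow> 'e) \<Rightarrow> 'e \<Rightarrow> 'e \<Rightarrow> 'e \<Rightarrow> 'e"
  where "chart_tensor B \<Psi> u a v w = (\<Sum>b\<in>B. representation B w b *\<^sub>R
    (frechet_derivative (\<lambda>p. frechet_derivative (\<lambda>(a, b). \<Psi> a b) (at p) (0, b)) (at (a, a)) (v, 0)
     - frechet_derivative (\<lambda>(a, b'). u a b' b) (at (a, a)) (v, 0)))"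

text \<open>In the last estimate, the expression without the tensor vanishes for \<open>a = b\<close> and for \<open>b = c\<close>, so its
  leading term is the mixed second derivative at \<open>(b, b)\<close>, which is the gauge tensor.\<close>

lemma gauge_chart_estimates:
  fixes \<Psi> :: "'e::real_normed_vector \<Rightarrow> 'e \<Rightarrow> 'e" and u :: "'e \<Rightarrow> 'e \<Rightarrow> 'e \<Rightarrow> 'e"
  assumes B: "fin_basis (B :: 'e set)" and N: "open N" "(a0, a0) \<in> N"
    and \<Psi>_smooth: "smooth_on (\<lambda>(a, b). \<Psi> a b) N" and u_smooth: "\<And>e. smooth_on (\<lambda>(a, b). u a b e) N"
    and \<Psi>_diag: "\<And>a. (a, a) \<in> N \<Longrightarrow> \<Psi> a a = 0"
    and \<Psi>_deriv: "\<And>a w. (a, a) \<in> N \<Longrightarrow> frechet_derivative (\<lambda>(a, b). \<Psi> a b) (at (a, a)) (0, w) = w"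
    and u_diag: "\<And>a e. (a, a) \<in> N \<Longrightarrow> u a a e = e"
    and u_lin: "\<And>a b. (a, b) \<in> N \<Longrightarrow> linear (u a b)"
  defines "S \<equiv> chart_tensor B \<Psi> u"
  shows "\<exists>r>0. \<exists>C\<ge>0. ball a0 r \<times> ball a0 r \<subseteq> N \<and> (\<forall>a\<in>ball a0 r. \<forall>b\<in>ball a0 r. \<forall>c\<in>ball a0 r.
    norm (\<Psi> a c - \<Psi> a b - (c - b)) \<le> C * (norm (c - b) * (norm (c - b) + norm (b - a))) \<and>
    (\<forall>e. norm (u b a e - e) \<le> C * (norm (b - a) * norm e)) \<and>
    (\<forall>v w. norm (S a v w) \<le> C * (norm v * norm w)) \<and>
    (\<forall>v w. norm (S a v w - S b v w) \<le> C * (norm (a - b) * norm v * norm w)) \<and>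
    norm (u b a (\<Psi> a c - \<Psi> a b) - \<Psi> b c - S b (a - b) (c - b))
      \<le> C * (norm (a - b) * norm (c - b) * (norm (a - b) + norm (c - b))))"
proof -
  let ?f = "\<lambda>(a, b). \<Psi> a b"
  let ?D = "\<lambda>f p. frechet_derivative f (at p)"
  let ?g = "\<lambda>i p. ?D ?f p (0, i)"
  let ?u = "\<lambda>i (a, b). u a b i"
  have fin: "finite B" using B by (auto simp: fin_basis_def)
  obtain K where K: "K > 0" "\<And>v b. \<bar>representation B v b\<bar> \<le> K * norm v" using fin_basis_coord_bound[OF B] by blast
  obtain B' :: "('e \<times> 'e) set" where B': "fin_basis B'" using fin_basis_prod_exists[OF B] by blast
  \<comment> \<open>Three derivatives of the logarithm are spent: the second-order estimate is
    applied to \<open>?g i\<close>, which is already a first derivative.\<close>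
  have f2: "Ck_on 2 ?f N" and g2: "Ck_on 2 (?g i) N" and u2: "Ck_on 2 (?u i) N" for i
  proof -
    have "Ck_on (Suc 2) ?f N" using \<Psi>_smooth unfolding smooth_on_def by blast
    then show "Ck_on 2 (?g i) N" unfolding Ck_on.simps by blast
    show "Ck_on 2 ?f N" "Ck_on 2 (?u i) N" using \<Psi>_smooth u_smooth unfolding smooth_on_def by blast+
  qed
  \<comment> \<open>The conclusion of \<open>C2_taylor\<close> at the diagonal point, to be used for
    the logarithm itself and, for each basis vector \<open>i\<close>, for its second-slot derivative
    \<open>?g i\<close> and for the column \<open>?u i\<close> of the parallelism.\<close>
  define tay where "tay f r C \<longleftrightarrow> ball (a0, a0) r \<subseteq> N \<and> (\<forall>x\<in>ball (a0, a0) r. \<forall>v. norm (?D f x v) \<le> C * norm v) \<and>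
    (\<forall>x\<in>ball (a0, a0) r. \<forall>y\<in>ball (a0, a0) r. norm (f x - f y) \<le> C * norm (x - y)) \<and>
    (\<forall>x\<in>ball (a0, a0) r. \<forall>y\<in>ball (a0, a0) r. \<forall>v. norm (?D f x v - ?D f y v) \<le> C * norm (x - y) * norm v) \<and>
    (\<forall>x\<in>ball (a0, a0) r. \<forall>y\<in>ball (a0, a0) r. \<forall>z\<in>ball (a0, a0) r.
      norm (f x - f y - ?D f z (x - y)) \<le> C * norm (x - y) * (norm (x - y) + norm (y - z)))"
    for f :: "'e \<times> 'e \<Rightarrow> 'e" and r C
  have tayI: "\<exists>r>0. \<exists>C\<ge>0. tay f r C" if "Ck_on 2 f N" for f
    unfolding tay_def by (rule C2_taylor[OF B' that N])
  obtain rp Cp where p: "rp > 0" "Cp \<ge> 0" "tay ?f rp Cp" using tayI[OF f2] by blast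
  have "\<forall>i. \<exists>r C. r > 0 \<and> C \<ge> 0 \<and> tay (?g i) r C" using tayI[OF g2] by blast
  then obtain rg Cg where g: "\<And>i. rg i > 0" "\<And>i. Cg i \<ge> 0" "\<And>i. tay (?g i) (rg i) (Cg i)" by metis
  have "\<forall>i. \<exists>r C. r > 0 \<and> C \<ge> 0 \<and> tay (?u i) r C" using tayI[OF u2] by blast
  then obtain ru Cu where u: "\<And>i. ru i > 0" "\<And>i. Cu i \<ge> 0" "\<And>i. tay (?u i) (ru i) (Cu i)" by metis
  \<comment> \<open>Halved because a pair of points of the ball of radius \<open>r\<close> lies only
    within \<open>2 * r\<close> of \<open>(a0, a0)\<close>.\<close>
  define r where "r = Min (insert rp (rg ` B \<union> ru ` B)) / 2"
  have r: "r > 0" unfolding r_def using fin p g u by auto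
  have rle: "2 * r \<le> rp" "\<And>i. i \<in> B \<Longrightarrow> 2 * r \<le> rg i" "\<And>i. i \<in> B \<Longrightarrow> 2 * r \<le> ru i"
    unfolding r_def using fin by auto
  define CU where "CU = K * (\<Sum>i\<in>B. Cu i)"
  define CG where "CG = K * (\<Sum>i\<in>B. Cg i)"
  have C0: "CU \<ge> 0" "CG \<ge> 0" unfolding CU_def CG_def using K g u by (auto intro!: mult_nonneg_nonneg sum_nonneg)
  have pball: "(a, b) \<in> ball (a0, a0) R" if "a \<in> ball a0 r" "b \<in> ball a0 r" "2 * r \<le> R" for a b R
  proof -
    have "norm ((a0, a0) - (a, b)) \<le> norm (a0 - a) + norm (a0 - b)" by (simp add: norm_Pair_le)
    then show ?thesis using that by (auto simp: dist_norm)
  qed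
  have pO: "(a, b) \<in> N" if "a \<in> ball a0 r" "b \<in> ball a0 r" for a b
    using pball[OF that rle(1)] p(3) unfolding tay_def by blast
  have lin_bound: "norm (\<Sum>i\<in>B. representation B w i *\<^sub>R h i) \<le> K * (\<Sum>i\<in>B. M i) * norm w"
    if "\<And>i. i \<in> B \<Longrightarrow> norm (h i) \<le> M i" for h :: "'e \<Rightarrow> 'e" and M w
  proof -
    have "norm (\<Sum>i\<in>B. representation B w i *\<^sub>R h i) \<le> (\<Sum>i\<in>B. (K * norm w) * M i)"
    proof (rule sum_norm_le)
      fix i assume "i \<in> B"
      then show "norm (representation B w i *\<^sub>R h i) \<le> (K * norm w) * M i"
        using K(2)[of w i] that[of i] order_trans[OF abs_ge_zero K(2)[of w i]] by (auto intro!: mult_mono)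
    qed
    then show ?thesis by (simp add: sum_distrib_left sum_distrib_right algebra_simps)
  qed
  \<comment> \<open>The derivative is frozen at \<open>(a, a)\<close>, where the second-slot
    derivative of the logarithm is the identity.\<close>
  have E5: "norm (\<Psi> a c - \<Psi> a b - (c - b)) \<le> Cp * (norm (c - b) * (norm (c - b) + norm (b - a)))"
    if "a \<in> ball a0 r" "b \<in> ball a0 r" "c \<in> ball a0 r" for a b c
  proof -
    have "norm (?f (a, c) - ?f (a, b) - ?D ?f (a, a) ((a, c) - (a, b)))
        \<le> Cp * norm ((a, c) - (a, b)) * (norm ((a, c) - (a, b)) + norm ((a, b) - (a, a)))"
      using p(3) pball[OF that(1,3) rle(1)] pball[OF that(1,2) rle(1)] pball[OF that(1,1) rle(1)]
      unfolding tay_def by blast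
    then show ?thesis using \<Psi>_deriv[OF pO[OF that(1,1)], of "c - b"] by (simp add: mult.assoc norm_Pair)
  qed
  have u_lin': "linear (\<lambda>e. u b a e - e)" if "a \<in> ball a0 r" "b \<in> ball a0 r" for a b
    by (rule linear_compose_sub[OF u_lin[OF pO[OF that(2,1)]]]) (rule linear_ident)
  have E2: "norm (u b a e - e) \<le> CU * (norm (b - a) * norm e)"
    if "a \<in> ball a0 r" "b \<in> ball a0 r" for a b e
  proof -
    have "norm (u b a e - e) \<le> (K * (\<Sum>i\<in>B. Cu i * norm (b - a))) * norm e"
    proof (rule fin_basis_norm_le[OF B K(2) u_lin'[OF that]])
      fix i assume i: "i \<in> B"
      have "norm (?u i (b, a) - ?u i (b, b)) \<le> Cu i * norm ((b, a) - (b, b))"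
        using u(3)[of i] pball[OF that(2,1) rle(3)[OF i]] pball[OF that(2,2) rle(3)[OF i]]
        unfolding tay_def by blast
      then show "norm (u b a i - i) \<le> Cu i * norm (b - a)"
        using u_diag[OF pO[OF that(2,2)]] by (simp add: norm_Pair norm_minus_commute)
    qed
    then show ?thesis unfolding CU_def by (simp add: sum_distrib_right mult.assoc)
  qed
  let ?h = "\<lambda>a v i. ?D (?g i) (a, a) (v, 0) - ?D (?u i) (a, a) (v, 0)"
  have S: "S a v w = (\<Sum>i\<in>B. representation B w i *\<^sub>R ?h a v i)" for a v w
    unfolding S_def chart_tensor_def ..
  have sums: "(\<Sum>i\<in>B. (Cg i + Cu i) * c) = ((\<Sum>i\<in>B. Cg i) + (\<Sum>i\<in>B. Cu i)) * c" for c
    by (simp only: sum_distrib_right[symmetric] sum.distrib)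
  have E4: "norm (S a v w) \<le> (CG + CU) * (norm v * norm w)" if a: "a \<in> ball a0 r" for a v w
  proof -
    have "norm (S a v w) \<le> K * (\<Sum>i\<in>B. (Cg i + Cu i) * norm v) * norm w"
      unfolding S
    proof (rule lin_bound)
      fix i assume i: "i \<in> B"
      have "norm (?D (?g i) (a, a) (v, 0)) \<le> Cg i * norm (v, 0::'e)"
        using g(3)[of i] pball[OF a a rle(2)[OF i]] unfolding tay_def by blast
      moreover have "norm (?D (?u i) (a, a) (v, 0)) \<le> Cu i * norm (v, 0::'e)"
        using u(3)[of i] pball[OF a a rle(3)[OF i]] unfolding tay_def by blast
      ultimately have "norm (?h a v i) \<le> Cg i * norm (v, 0::'e) + Cu i * norm (v, 0::'e)"
        by (intro norm_triangle_le_diff add_mono)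
      then show "norm (?h a v i) \<le> (Cg i + Cu i) * norm v" by (simp add: norm_Pair algebra_simps)
    qed
    also have "\<dots> = (CG + CU) * (norm v * norm w)"
      unfolding sums CG_def CU_def by (simp add: ring_distribs mult_ac)
    finally show ?thesis .
  qed
  have E4': "norm (S a v w - S b v w) \<le> (2 * CG + 2 * CU) * (norm (a - b) * norm v * norm w)"
    if ab: "a \<in> ball a0 r" "b \<in> ball a0 r" for a b v w
  proof -
    have n: "norm ((a, a) - (b, b)) \<le> 2 * norm (a - b)" using norm_Pair_le[of "a - b" "a - b"] by simp
    have eq: "S a v w - S b v w = (\<Sum>i\<in>B. representation B w i *\<^sub>R (?h a v i - ?h b v i))"
      unfolding S by (simp add: sum_subtractf scaleR_diff_right)
    have "norm (S a v w - S b v w) \<le> K * (\<Sum>i\<in>B. (Cg i + Cu i) * (2 * norm (a - b) * norm v)) * norm w"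
      unfolding eq
    proof (rule lin_bound)
      fix i assume i: "i \<in> B"
      have "norm (?D (?g i) (a, a) (v, 0) - ?D (?g i) (b, b) (v, 0)) \<le> Cg i * norm ((a, a) - (b, b)) * norm (v, 0::'e)"
        using g(3)[of i] pball[OF ab(1,1) rle(2)[OF i]] pball[OF ab(2,2) rle(2)[OF i]] unfolding tay_def by blast
      also have "\<dots> \<le> Cg i * (2 * norm (a - b)) * norm (v, 0::'e)" using n g(2)[of i] by (intro mult_right_mono mult_left_mono) auto
      finally have 1: "norm (?D (?g i) (a, a) (v, 0) - ?D (?g i) (b, b) (v, 0)) \<le> Cg i * (2 * norm (a - b)) * norm v"
        by (simp add: norm_Pair)
      have "norm (?D (?u i) (a, a) (v, 0) - ?D (?u i) (b, b) (v, 0)) \<le> Cu i * norm ((a, a) - (b, b)) * norm (v, 0::'e)"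
        using u(3)[of i] pball[OF ab(1,1) rle(3)[OF i]] pball[OF ab(2,2) rle(3)[OF i]] unfolding tay_def by blast
      also have "\<dots> \<le> Cu i * (2 * norm (a - b)) * norm (v, 0::'e)" using n u(2)[of i] by (intro mult_right_mono mult_left_mono) auto
      finally have 2: "norm (?D (?u i) (a, a) (v, 0) - ?D (?u i) (b, b) (v, 0)) \<le> Cu i * (2 * norm (a - b)) * norm v"
        by (simp add: norm_Pair)
      have "?h a v i - ?h b v i = (?D (?g i) (a, a) (v, 0) - ?D (?g i) (b, b) (v, 0)) - (?D (?u i) (a, a) (v, 0) - ?D (?u i) (b, b) (v, 0))"
        by simp
      also have "norm \<dots> \<le> Cg i * (2 * norm (a - b)) * norm v + Cu i * (2 * norm (a - b)) * norm v"
        by (rule norm_triangle_le_diff[OF add_mono[OF 1 2]])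
      finally show "norm (?h a v i - ?h b v i) \<le> (Cg i + Cu i) * (2 * norm (a - b) * norm v)" by (simp add: algebra_simps)
    qed
    also have "\<dots> = (2 * CG + 2 * CU) * (norm (a - b) * norm v * norm w)"
      unfolding sums CG_def CU_def by (simp add: ring_distribs mult_ac)
    finally show ?thesis .
  qed
  have E3: "norm (u b a (\<Psi> a c - \<Psi> a b) - \<Psi> b c - S b (a - b) (c - b))
      \<le> (CU * Cp + 2 * CU + CG) * (norm (a - b) * norm (c - b) * (norm (a - b) + norm (c - b)))"
    if abc: "a \<in> ball a0 r" "b \<in> ball a0 r" "c \<in> ball a0 r" for a b c
  proof -
    let ?\<Delta> = "\<Psi> a c - \<Psi> a b" and ?e = "c - b"
    let ?ab = "norm (a - b)" and ?cb = "norm (c - b)"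
    \<comment> \<open>The two halves of the tensor, both in the direction \<open>a - b\<close> of
      the first slot: \<open>\<Lambda>\<close> is the mixed derivative of the logarithm at
      \<open>(b, b)\<close>, \<open>\<Gamma>\<close> the derivative of the parallelism there. The
      claim splits into three parts: \<open>u b a\<close> minus the identity on the remainder of
      \<open>E5\<close>, the change of \<open>u b a\<close> against \<open>\<Gamma>\<close>, and the
      difference of the logarithm in its first slot against \<open>\<Lambda>\<close>.\<close>
    define \<Lambda> where "\<Lambda> w = (\<Sum>i\<in>B. representation B w i *\<^sub>R ?D (?g i) (b, b) (a - b, 0))" for w
    define \<Gamma> where "\<Gamma> w = (\<Sum>i\<in>B. representation B w i *\<^sub>R ?D (?u i) (b, b) (a - b, 0))" for w
    have lin\<Lambda>: "linear \<Lambda>" and lin\<Gamma>: "linear \<Gamma>" unfolding \<Lambda>_def \<Gamma>_def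
      by (auto intro!: linearI simp: fin_basis_coords[OF B] scaleR_add_left sum.distrib scaleR_sum_right)
    have ri: "representation B i j = (if j = i then 1 else 0)" if "i \<in> B" for i j
      using that B representation_basis[of B i] by (auto simp: fin_basis_def)
    have \<Lambda>i: "\<Lambda> i = ?D (?g i) (b, b) (a - b, 0)" if "i \<in> B" for i
    proof -
      have "\<Lambda> i = (\<Sum>j\<in>B. if j = i then ?D (?g j) (b, b) (a - b, 0) else 0)"
        unfolding \<Lambda>_def by (intro sum.cong) (auto simp: ri[OF that])
      then show ?thesis using fin that by simp
    qed
    have \<Gamma>i: "\<Gamma> i = ?D (?u i) (b, b) (a - b, 0)" if "i \<in> B" for i
    proof -
      have "\<Gamma> i = (\<Sum>j\<in>B. if j = i then ?D (?u j) (b, b) (a - b, 0) else 0)"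
        unfolding \<Gamma>_def by (intro sum.cong) (auto simp: ri[OF that])
      then show ?thesis using fin that by simp
    qed
    have S_eq: "S b (a - b) ?e = \<Lambda> ?e - \<Gamma> ?e" unfolding S \<Lambda>_def \<Gamma>_def
      by (simp add: sum_subtractf scaleR_diff_right)
    have P1: "norm (u b a (?\<Delta> - ?e) - (?\<Delta> - ?e)) \<le> CU * Cp * (?ab * ?cb * (?ab + ?cb))"
    proof -
      have "norm (u b a (?\<Delta> - ?e) - (?\<Delta> - ?e)) \<le> CU * (norm (b - a) * norm (?\<Delta> - ?e))" by (rule E2[OF abc(1,2)])
      also have "\<dots> \<le> CU * (norm (b - a) * (Cp * (?cb * (?cb + norm (b - a)))))"
        using E5[OF abc] C0 by (intro mult_left_mono) auto
      finally show ?thesis by (simp add: norm_minus_commute[of b a] algebra_simps)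
    qed
    \<comment> \<open>From \<open>(b, a)\<close> to \<open>(a, a)\<close> only the first slot moves,
      and \<open>u a a\<close> is the identity. So the first-order term is \<open>\<Gamma>\<close>,
      up to the cost of freezing the derivative at \<open>(b, b)\<close>, and its sign is reversed
      because the move ends at the identity.\<close>
    have P2: "norm (u b a ?e - ?e + \<Gamma> ?e) \<le> 2 * CU * (?ab * ?ab * ?cb)"
    proof -
      have "norm (u b a ?e - ?e + \<Gamma> ?e) \<le> (K * (\<Sum>i\<in>B. Cu i * (2 * ?ab * ?ab))) * norm ?e"
      proof (rule fin_basis_norm_le[OF B K(2)])
        show "linear (\<lambda>e. u b a e - e + \<Gamma> e)" by (intro linear_compose_add u_lin' abc lin\<Gamma>)
        fix i assume i: "i \<in> B"
        have "norm (?u i (a, a) - ?u i (b, a) - ?D (?u i) (b, b) ((a, a) - (b, a)))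
            \<le> Cu i * norm ((a, a) - (b, a)) * (norm ((a, a) - (b, a)) + norm ((b, a) - (b, b)))"
          using u(3)[of i] pball[OF abc(1,1) rle(3)[OF i]] pball[OF abc(2,1) rle(3)[OF i]] pball[OF abc(2,2) rle(3)[OF i]]
          unfolding tay_def by blast
        then have "norm (i - u b a i - \<Gamma> i) \<le> Cu i * (2 * ?ab * ?ab)"
          unfolding \<Gamma>i[OF i] using u_diag[OF pO[OF abc(1,1)]] by (simp add: norm_Pair algebra_simps)
        moreover have "u b a i - i + \<Gamma> i = - (i - u b a i - \<Gamma> i)" by simp
        ultimately show "norm (u b a i - i + \<Gamma> i) \<le> Cu i * (2 * ?ab * ?ab)" by (simp only: norm_minus_cancel)
      qed
      then show ?thesis unfolding CU_def sum_distrib_right[symmetric] by (simp add: algebra_simps)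
    qed
    \<comment> \<open>A second difference: the mean value inequality in the second slot from
      \<open>b\<close> to \<open>c\<close> is applied to a function whose derivative is, by the
      Taylor estimate in the first slot, of order \<open>?ab * (?ab + ?cb)\<close>. At the endpoint
      \<open>b\<close> the term \<open>\<Psi> b b\<close> vanishes.\<close>
    have P3: "norm (?\<Delta> - \<Psi> b c - \<Lambda> ?e) \<le> CG * (?ab * (?ab + ?cb) * ?cb)"
    proof -
      have df: "((\<lambda>y. \<Psi> x y) has_derivative (\<lambda>w. ?D ?f (x, y) (0, w))) (at y within T)"
        if "x \<in> ball a0 r" "y \<in> ball a0 r" for x y T
      proof -
        have "(?f has_derivative ?D ?f (x, y)) (at (x, y))"
          using Ck_on_has_derivative[of 1 ?f N] f2 pO[OF that] by (simp add: numeral_2_eq_2)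
        moreover have "((\<lambda>y. (x, y)) has_derivative (\<lambda>w. (0, w))) (at y)" by (auto intro!: derivative_eq_intros)
        ultimately have "((\<lambda>y. ?f (x, y)) has_derivative (\<lambda>w. ?D ?f (x, y) (0, w))) (at y)"
          using has_derivative_compose[of "\<lambda>y. (x, y)"] by blast
        then show ?thesis by (simp add: has_derivative_at_withinI)
      qed
      have seg: "closed_segment b c \<subseteq> ball a0 r" using abc by (intro closed_segment_subset) auto
      have "norm ((\<Psi> a c - \<Psi> b c - \<Lambda> c) - (\<Psi> a b - \<Psi> b b - \<Lambda> b)) \<le> (CG * (?ab * (?ab + ?cb))) * norm (c - b)"
      proof (rule differentiable_bound[of "closed_segment b c"])
        fix y assume y: "y \<in> closed_segment b c"
        then have yb: "y \<in> ball a0 r" using seg by auto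
        show "((\<lambda>c. \<Psi> a c - \<Psi> b c - \<Lambda> c) has_derivative (\<lambda>w. ?D ?f (a, y) (0, w) - ?D ?f (b, y) (0, w) - \<Lambda> w))
            (at y within closed_segment b c)"
          by (intro has_derivative_diff df abc yb bounded_linear_imp_has_derivative fin_basis_bounded_linear[OF B lin\<Lambda>])
        have lf: "linear (\<lambda>w. ?D ?f (x, y) (0, w))" if "x \<in> ball a0 r" for x
          using df[OF that yb, of UNIV] by (rule has_derivative_linear)
        show "onorm (\<lambda>w. ?D ?f (a, y) (0, w) - ?D ?f (b, y) (0, w) - \<Lambda> w) \<le> CG * (?ab * (?ab + ?cb))"
        proof (rule onorm_bound)
          show "0 \<le> CG * (?ab * (?ab + ?cb))" using C0 by simp
          fix w
          have "norm (?D ?f (a, y) (0, w) - ?D ?f (b, y) (0, w) - \<Lambda> w) \<le> (K * (\<Sum>i\<in>B. Cg i * (?ab * (?ab + ?cb)))) * norm w"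
          proof (rule fin_basis_norm_le[OF B K(2)])
            show "linear (\<lambda>w. ?D ?f (a, y) (0, w) - ?D ?f (b, y) (0, w) - \<Lambda> w)"
              by (intro linear_compose_sub lf abc lin\<Lambda>)
            fix i assume i: "i \<in> B"
            have "norm (?g i (a, y) - ?g i (b, y) - ?D (?g i) (b, b) ((a, y) - (b, y)))
                \<le> Cg i * norm ((a, y) - (b, y)) * (norm ((a, y) - (b, y)) + norm ((b, y) - (b, b)))"
              using g(3)[of i] pball[OF abc(1) yb rle(2)[OF i]] pball[OF abc(2) yb rle(2)[OF i]] pball[OF abc(2,2) rle(2)[OF i]]
              unfolding tay_def by blast
            also have "\<dots> = Cg i * (?ab * (?ab + norm (y - b)))" by (simp add: norm_Pair)
            also have "\<dots> \<le> Cg i * (?ab * (?ab + ?cb))"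
              using segment_bound(1)[OF y] g(2)[of i] by (intro mult_left_mono add_left_mono) (auto simp: norm_minus_commute)
            finally show "norm (?D ?f (a, y) (0, i) - ?D ?f (b, y) (0, i) - \<Lambda> i) \<le> Cg i * (?ab * (?ab + ?cb))"
              unfolding \<Lambda>i[OF i] by simp
          qed
          then show "norm (?D ?f (a, y) (0, w) - ?D ?f (b, y) (0, w) - \<Lambda> w) \<le> CG * (?ab * (?ab + ?cb)) * norm w"
            unfolding CG_def sum_distrib_right[symmetric] by (simp add: algebra_simps)
        qed
      qed auto
      then show ?thesis using \<Psi>_diag[OF pO[OF abc(2,2)]] by (simp add: linear_diff[OF lin\<Lambda>] algebra_simps)
    qed
    have lu: "u b a ?\<Delta> = u b a (?\<Delta> - ?e) + u b a ?e"
      using linear_add[OF u_lin[OF pO[OF abc(2,1)]], of "?\<Delta> - ?e" ?e] by simp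
    have eq: "u b a ?\<Delta> - \<Psi> b c - S b (a - b) ?e
      = (u b a (?\<Delta> - ?e) - (?\<Delta> - ?e)) + (u b a ?e - ?e + \<Gamma> ?e) + (?\<Delta> - \<Psi> b c - \<Lambda> ?e)"
      unfolding S_eq lu by simp
    have "norm (u b a ?\<Delta> - \<Psi> b c - S b (a - b) ?e)
      \<le> CU * Cp * (?ab * ?cb * (?ab + ?cb)) + 2 * CU * (?ab * ?ab * ?cb) + CG * (?ab * (?ab + ?cb) * ?cb)"
      unfolding eq by (rule norm_triangle_le[OF add_mono[OF norm_triangle_le[OF add_mono[OF P1 P2]] P3]])
    moreover have "2 * CU * (?ab * ?ab * ?cb) \<le> 2 * CU * (?ab * ?cb * (?ab + ?cb))"
      using C0 by (intro mult_left_mono) (auto simp: distrib_left mult_ac)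
    moreover have "(CU * Cp + 2 * CU + CG) * (?ab * ?cb * (?ab + ?cb))
      = CU * Cp * (?ab * ?cb * (?ab + ?cb)) + 2 * CU * (?ab * ?cb * (?ab + ?cb)) + CG * (?ab * (?ab + ?cb) * ?cb)"
      by algebra
    ultimately show ?thesis by linarith
  qed
  define C where "C = Cp + 4 * CU + 4 * CG + CU * Cp"
  have le: "x \<le> C * y" if "x \<le> C' * y" "C' \<le> C" "y \<ge> 0" for x y C'
    using that mult_right_mono[OF that(2,3)] by linarith
  have Cs: "Cp \<le> C" "CU \<le> C" "CG + CU \<le> C" "2 * CG + 2 * CU \<le> C" "CU * Cp + 2 * CU + CG \<le> C" "C \<ge> 0"
    unfolding C_def using C0 p(2) mult_nonneg_nonneg[OF C0(1) p(2)] by linarith+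
  have "ball a0 r \<times> ball a0 r \<subseteq> N" using pO by auto
  then show ?thesis
    using r Cs(6)
    by (intro exI[of _ r] exI[of _ C] conjI ballI allI)
      (assumption | rule le[OF E5 Cs(1)] le[OF E2 Cs(2)] le[OF E4 Cs(3)] le[OF E4' Cs(4)] le[OF E3 Cs(5)] | simp)+
qed

section \<open>Almost additivity in a chart\<close>

lemma apply_tensor_square_add:
  "apply_tensor_square B a (X + Y) = apply_tensor_square B a X + apply_tensor_square B a Y"
  by (simp add: apply_tensor_square_def scaleR_add_left sum.distrib)

lemma linear_axis_expand:
  fixes a :: "real ^ 'k \<Rightarrow> 'b::real_vector"
  assumes "linear a"
  shows "a v = (\<Sum>i\<in>UNIV. v $ i *\<^sub>R a (axis i 1))"
proof -
  have "v = (\<Sum>i\<in>UNIV. v $ i *\<^sub>R axis i 1)"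
    by (simp add: basis_expansion scalar_mult_eq_scaleR[symmetric])
  then have "a v = a (\<Sum>i\<in>UNIV. v $ i *\<^sub>R axis i 1)" by simp
  then show ?thesis by (simp add: linear_sum[OF assms] linear_scale[OF assms])
qed

text \<open>Chen's relation contributes a pure tensor; on it the contraction is a plain value of the
  bilinear map, and this is the term that compensates the gauge.\<close>

lemma apply_tensor_square_outer:
  assumes "linear a" and "\<And>v. linear (B v)" and "\<And>w. linear (\<lambda>v. B v w)"
  shows "apply_tensor_square B a (outer x y) = B (a x) (a y)"
proof -
  have "B (a x) (a y) = (\<Sum>i\<in>UNIV. x $ i *\<^sub>R B (a (axis i 1)) (a y))"
    by (subst linear_axis_expand[OF assms(1), of x])
      (simp add: linear_sum[OF assms(3)] linear_scale[OF assms(3)])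
  also have "\<dots> = (\<Sum>i\<in>UNIV. \<Sum>j\<in>UNIV. (x $ i * y $ j) *\<^sub>R B (a (axis i 1)) (a (axis j 1)))"
    by (subst linear_axis_expand[OF assms(1), of y])
      (simp add: linear_sum[OF assms(2)] linear_scale[OF assms(2)] scaleR_sum_right)
  finally show ?thesis by (simp add: apply_tensor_square_def outer_def)
qed

lemma abs_matrix_component_le: "\<bar>X $ i $ j\<bar> \<le> norm (X :: real ^ 'k ^ 'l)"
  using component_le_norm_cart[of "X $ i" j] Finite_Cartesian_Product.norm_nth_le[of X i] by simp

lemma apply_tensor_square_bound:
  fixes X :: "real ^ 'k ^ 'k" and B :: "'b \<Rightarrow> 'b \<Rightarrow> 'c::real_normed_vector"
  assumes "\<And>i j. norm (B (a (axis i 1)) (a (axis j 1))) \<le> M"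
  shows "norm (apply_tensor_square B a X) \<le> real CARD('k) ^ 2 * norm X * M"
proof -
  have "norm (apply_tensor_square B a X) \<le> (\<Sum>i\<in>(UNIV::'k set). \<Sum>j\<in>(UNIV::'k set). norm X * M)"
    unfolding apply_tensor_square_def
    using assms order_trans[OF norm_ge_zero assms]
    by (intro sum_norm_le) (auto intro!: mult_mono abs_matrix_component_le)
  then show ?thesis by (simp add: power2_eq_square)
qed

text \<open>A single number \<open>h\<close> bounds the data of all subintervals, so that each term
  can be counted as a power of \<open>h\<close>. \<open>U\<close> stands for the parallelism from
  the first to the second time and enters through \<open>\<beta>_remainder\<close> and
  \<open>gauge\<close>; the curvature of the situation is thus confined to these two
  hypotheses.\<close>

lemma triple_estimate:
  fixes bs bt :: "real ^ 'k \<Rightarrow> 'e::real_normed_vector" and \<beta>s \<beta>t :: "'e \<Rightarrow> 'v::real_normed_vector"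
    and \<gamma>s \<gamma>t :: "'k \<Rightarrow> 'e \<Rightarrow> 'v" and Ss St :: "'e \<Rightarrow> 'e \<Rightarrow> 'e" and x x' :: "real ^ 'k" and C h :: real
  assumes lin: "linear bs" "linear bt" "linear \<beta>s" "linear \<beta>t" "\<And>i. linear (\<gamma>s i)" "\<And>i. linear (\<gamma>t i)"
      "\<And>v. linear (Ss v)" "\<And>w. linear (\<lambda>v. Ss v w)" "\<And>v. linear (St v)" "\<And>w. linear (\<lambda>v. St v w)"
    and h: "0 \<le> h" and C: "0 \<le> C"
    and bs: "\<And>w. norm (bs w) \<le> C * norm w" and bt: "\<And>w. norm (bt w) \<le> C * norm w"
    and \<beta>s: "\<And>e. norm (\<beta>s e) \<le> C * norm e" and \<beta>t: "\<And>e. norm (\<beta>t e) \<le> C * norm e"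
    and \<gamma>s: "\<And>i e. norm (\<gamma>s i e) \<le> C * norm e" and \<gamma>t: "\<And>i e. norm (\<gamma>t i e) \<le> C * norm e"
    and x: "norm x \<le> h" "norm x' \<le> h" and X: "norm Xtu \<le> h\<^sup>2" "Xsu = Xst + Xtu + outer x x'"
    and b_diff: "\<And>w. norm (bt w - bs w) \<le> C * h * norm w"
    and \<Delta>: "norm (\<Psi>su - \<Psi>st) \<le> C * h" "norm (\<Psi>su - \<Psi>st - bs x') \<le> C * h\<^sup>2"
    and \<beta>_remainder: "\<And>e. norm (\<beta>t (U e) - \<beta>s e - (\<Sum>i\<in>UNIV. x $ i *\<^sub>R \<gamma>s i e)) \<le> C * h\<^sup>2 * norm e"
    and \<beta>_diff: "\<And>e. norm (\<beta>t e - \<beta>s e) \<le> C * h * norm e"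
    and \<gamma>_diff: "\<And>i e. norm (\<gamma>t i e - \<gamma>s i e) \<le> C * h * norm e"
    and Ss: "\<And>v w. norm (Ss v w) \<le> C * norm v * norm w" and St: "\<And>v w. norm (St v w) \<le> C * norm v * norm w"
    and S_diff: "\<And>v w. norm (St v w - Ss v w) \<le> C * h * norm v * norm w"
    and gauge: "norm (U (\<Psi>su - \<Psi>st) - \<Psi>tu + Ss (bs x) (bs x')) \<le> C * h ^ 3"
  shows "norm ((\<beta>s (\<Psi>su + apply_tensor_square Ss bs Xsu) + (\<Sum>i\<in>UNIV. \<gamma>s i (bs (Xsu $ i))))
      - (\<beta>s (\<Psi>st + apply_tensor_square Ss bs Xst) + (\<Sum>i\<in>UNIV. \<gamma>s i (bs (Xst $ i))))
      - (\<beta>t (\<Psi>tu + apply_tensor_square St bt Xtu) + (\<Sum>i\<in>UNIV. \<gamma>t i (bt (Xtu $ i)))))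
    \<le> (2 * C\<^sup>2 + 3 * CARD('k) * C\<^sup>2 + C ^ 4 + 4 * (real CARD('k))\<^sup>2 * C ^ 4) * h ^ 3"
proof -
  define k where "k = real CARD('k)"
  have k: "k \<ge> 0" unfolding k_def by simp
  let ?\<Delta> = "\<Psi>su - \<Psi>st"
  let ?ss = "apply_tensor_square Ss bs" and ?st = "apply_tensor_square St bt"
  \<comment> \<open>Six terms of order 3. \<open>T1\<close>: the remainder of the one-form (order 2)
    on an increment (order 1). \<open>T2\<close>: the gauge remainder. \<open>T3\<close>:
    \<open>x\<close> times the second-order error of \<open>?\<Delta>\<close>. \<open>T4\<close>:
    the change of \<open>\<beta>\<close> on the second-order tensor term. \<open>T5\<close>,
    \<open>T6\<close>: changes of the coefficients against \<open>Xtu\<close>. In the signed sum,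
    \<open>\<beta>t (U ?\<Delta>)\<close> cancels between \<open>T1\<close> and \<open>T2\<close>,
    \<open>\<gamma>s i ?\<Delta>\<close> between \<open>T1\<close> and \<open>T3\<close>, and
    \<open>\<beta>t\<close> of the tensor term between \<open>T2\<close> and
    \<open>T4\<close>.\<close>
  define T1 where "T1 = - (\<beta>t (U ?\<Delta>) - \<beta>s ?\<Delta> - (\<Sum>i\<in>UNIV. x $ i *\<^sub>R \<gamma>s i ?\<Delta>))"
  define T2 where "T2 = \<beta>t (U ?\<Delta> - \<Psi>tu + Ss (bs x) (bs x'))"
  define T3 where "T3 = (\<Sum>i\<in>UNIV. x $ i *\<^sub>R \<gamma>s i (?\<Delta> - bs x'))"
  define T4 where "T4 = \<beta>t (Ss (bs x) (bs x')) - \<beta>s (Ss (bs x) (bs x'))"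
  define T5 where "T5 = \<beta>t (?st Xtu) - \<beta>s (?ss Xtu)"
  define T6 where "T6 = (\<Sum>i\<in>UNIV. \<gamma>t i (bt (Xtu $ i)) - \<gamma>s i (bs (Xtu $ i)))"
  have mixed: "\<gamma>s i (bs (outer x x' $ i)) = x $ i *\<^sub>R \<gamma>s i (bs x')" for i
  proof -
    have "outer x x' $ i = x $ i *\<^sub>R x'" by (simp add: outer_def vec_eq_iff)
    then show ?thesis by (simp add: linear_scale lin)
  qed
  note l = linear_add[OF lin(3)] linear_add[OF lin(4)] linear_diff[OF lin(3)] linear_diff[OF lin(4)]
    linear_add[OF lin(1)] linear_add[OF lin(5)] linear_diff[OF lin(5)]
  have decomp: "(\<beta>s (\<Psi>su + ?ss Xsu) + (\<Sum>i\<in>UNIV. \<gamma>s i (bs (Xsu $ i))))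
      - (\<beta>s (\<Psi>st + ?ss Xst) + (\<Sum>i\<in>UNIV. \<gamma>s i (bs (Xst $ i))))
      - (\<beta>t (\<Psi>tu + ?st Xtu) + (\<Sum>i\<in>UNIV. \<gamma>t i (bt (Xtu $ i)))) = T1 + T2 - T3 - T4 - T5 - T6"
    unfolding T1_def T2_def T3_def T4_def T5_def T6_def X(2)
    by (simp add: apply_tensor_square_add apply_tensor_square_outer[OF lin(1,7,8)] l mixed
        sum.distrib sum_subtractf scaleR_diff_right)
  have h2: "h\<^sup>2 * h = h ^ 3" by (simp add: power2_eq_square power3_eq_cube)
  have T1: "norm T1 \<le> C\<^sup>2 * h ^ 3"
  proof -
    have "norm T1 \<le> C * h\<^sup>2 * norm ?\<Delta>" unfolding T1_def norm_minus_cancel by (rule \<beta>_remainder)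
    also have "\<dots> \<le> C * h\<^sup>2 * (C * h)" using \<Delta>(1) C by (intro mult_left_mono) auto
    finally show ?thesis by (simp add: power2_eq_square power3_eq_cube mult_ac)
  qed
  have T2: "norm T2 \<le> C\<^sup>2 * h ^ 3"
  proof -
    have "norm T2 \<le> C * norm (U ?\<Delta> - \<Psi>tu + Ss (bs x) (bs x'))" unfolding T2_def by (rule \<beta>t)
    also have "\<dots> \<le> C * (C * h ^ 3)" using gauge C by (intro mult_left_mono) auto
    finally show ?thesis by (simp add: power2_eq_square mult_ac)
  qed
  have T3: "norm T3 \<le> k * C\<^sup>2 * h ^ 3"
  proof -
    have "norm T3 \<le> (\<Sum>i\<in>(UNIV::'k set). h * (C * (C * h\<^sup>2)))"
      unfolding T3_def
    proof (rule sum_norm_le)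
      fix i :: 'k
      have "norm (\<gamma>s i (?\<Delta> - bs x')) \<le> C * (C * h\<^sup>2)"
        using \<gamma>s[of i "?\<Delta> - bs x'"] mult_left_mono[OF \<Delta>(2) C] by linarith
      moreover have "\<bar>x $ i\<bar> \<le> h" using component_le_norm_cart[of x i] x(1) by linarith
      ultimately show "norm (x $ i *\<^sub>R \<gamma>s i (?\<Delta> - bs x')) \<le> h * (C * (C * h\<^sup>2))"
        using h by (auto intro!: mult_mono)
    qed
    then show ?thesis by (simp add: k_def power2_eq_square power3_eq_cube mult_ac)
  qed
  have bn: "norm (bs x) \<le> C * h" "norm (bs x') \<le> C * h"
    using bs[of x] bs[of x'] mult_left_mono[OF x(1) C] mult_left_mono[OF x(2) C] by linarith+
  have T4: "norm T4 \<le> C ^ 4 * h ^ 3"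
  proof -
    have "norm T4 \<le> C * h * norm (Ss (bs x) (bs x'))" unfolding T4_def by (rule \<beta>_diff)
    also have "\<dots> \<le> C * h * (C * (C * h) * (C * h))"
      using C h bn by (intro mult_left_mono order_trans[OF Ss] mult_mono) auto
    finally show ?thesis by (simp add: eval_nat_numeral mult_ac)
  qed
  have bsa: "norm (bs (axis i 1)) \<le> C" and bta: "norm (bt (axis i 1)) \<le> C"
    and bda: "norm (bt (axis i 1) - bs (axis i 1)) \<le> C * h" for i
    using bs[of "axis i 1"] bt[of "axis i 1"] b_diff[of "axis i 1"] by simp_all
  have T5: "norm T5 \<le> 4 * k\<^sup>2 * C ^ 4 * h ^ 3"
  proof -
    let ?B = "\<lambda>i j. St (bt (axis i 1)) (bt (axis j 1)) - Ss (bs (axis i 1)) (bs (axis j 1))"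
    have n1: "norm (?st Xtu) \<le> k\<^sup>2 * norm Xtu * (C * C * C)"
      unfolding k_def using C bta
      by (intro apply_tensor_square_bound order_trans[OF St] mult_mono) auto
    have Bb: "norm (?B i j) \<le> 3 * (C * C * C * h)" for i j
    proof -
      let ?bi = "bs (axis i 1)" and ?bj = "bs (axis j 1)" and ?bi' = "bt (axis i 1)" and ?bj' = "bt (axis j 1)"
      \<comment> \<open>Telescoping: the tensor is changed first, then its first slot, then its
        second.\<close>
      have eq: "?B i j = (St ?bi' ?bj' - Ss ?bi' ?bj') + (Ss (?bi' - ?bi) ?bj' + Ss ?bi (?bj' - ?bj))"
        by (simp only: linear_diff[OF lin(7)] linear_diff[OF lin(8)]) simp
      have "norm (St ?bi' ?bj' - Ss ?bi' ?bj') \<le> C * h * C * C"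
        using C h bta by (intro order_trans[OF S_diff] mult_mono) auto
      moreover have "norm (Ss (?bi' - ?bi) ?bj') \<le> C * (C * h) * C"
        using C h bta bda by (intro order_trans[OF Ss] mult_mono) auto
      moreover have "norm (Ss ?bi (?bj' - ?bj)) \<le> C * C * (C * h)"
        using C h bsa bda by (intro order_trans[OF Ss] mult_mono) auto
      ultimately have "norm (?B i j) \<le> C * h * C * C + (C * (C * h) * C + C * C * (C * h))"
        unfolding eq by (intro norm_triangle_le[OF add_mono])
      then show ?thesis by (simp add: mult_ac)
    qed
    have n2: "norm (?st Xtu - ?ss Xtu) \<le> k\<^sup>2 * norm Xtu * (3 * (C * C * C * h))"
    proof -
      have "?st Xtu - ?ss Xtu = (\<Sum>i\<in>UNIV. \<Sum>j\<in>UNIV. Xtu $ i $ j *\<^sub>R ?B i j)"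
        by (simp add: apply_tensor_square_def scaleR_diff_right sum_subtractf)
      moreover have "norm (\<Sum>i\<in>UNIV. \<Sum>j\<in>UNIV. Xtu $ i $ j *\<^sub>R ?B i j)
          \<le> (\<Sum>i\<in>(UNIV::'k set). \<Sum>j\<in>(UNIV::'k set). norm Xtu * (3 * (C * C * C * h)))"
        using Bb C h by (intro sum_norm_le) (auto intro!: mult_mono abs_matrix_component_le)
      ultimately show ?thesis by (simp add: k_def power2_eq_square)
    qed
    have "T5 = (\<beta>t (?st Xtu) - \<beta>s (?st Xtu)) + \<beta>s (?st Xtu - ?ss Xtu)"
      unfolding T5_def by (simp add: linear_diff[OF lin(3)])
    then have "norm T5 \<le> C * h * norm (?st Xtu) + C * norm (?st Xtu - ?ss Xtu)"
      using norm_triangle_le[OF add_mono[OF \<beta>_diff \<beta>s]] by metis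
    also have "\<dots> \<le> C * h * (k\<^sup>2 * norm Xtu * (C * C * C)) + C * (k\<^sup>2 * norm Xtu * (3 * (C * C * C * h)))"
      using n1 n2 C h by (intro add_mono mult_left_mono) auto
    also have "\<dots> = (4 * k\<^sup>2 * C ^ 4 * h) * norm Xtu" by (simp add: eval_nat_numeral algebra_simps)
    also have "\<dots> \<le> (4 * k\<^sup>2 * C ^ 4 * h) * h\<^sup>2" using X(1) C h by (intro mult_left_mono) auto
    finally show ?thesis by (simp add: power2_eq_square power3_eq_cube mult_ac)
  qed
  have T6: "norm T6 \<le> 2 * k * C\<^sup>2 * h ^ 3"
  proof -
    have "norm T6 \<le> (\<Sum>i\<in>(UNIV::'k set). 2 * (C * C * h * h\<^sup>2))"
      unfolding T6_def
    proof (rule sum_norm_le)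
      fix i :: 'k
      let ?v = "Xtu $ i"
      have v: "norm ?v \<le> h\<^sup>2" using Finite_Cartesian_Product.norm_nth_le[of Xtu i] X(1) by linarith
      have eq: "\<gamma>t i (bt ?v) - \<gamma>s i (bs ?v) = (\<gamma>t i (bt ?v) - \<gamma>s i (bt ?v)) + \<gamma>s i (bt ?v - bs ?v)"
        by (simp add: linear_diff[OF lin(5)])
      have "norm (\<gamma>t i (bt ?v) - \<gamma>s i (bt ?v)) \<le> C * h * (C * h\<^sup>2)"
        using C h v by (intro order_trans[OF \<gamma>_diff] mult_left_mono order_trans[OF bt]) auto
      moreover have "norm (\<gamma>s i (bt ?v - bs ?v)) \<le> C * (C * h * h\<^sup>2)"
        using C h v by (intro order_trans[OF \<gamma>s] mult_left_mono order_trans[OF b_diff]) auto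
      ultimately have "norm (\<gamma>t i (bt ?v) - \<gamma>s i (bs ?v)) \<le> C * h * (C * h\<^sup>2) + C * (C * h * h\<^sup>2)"
        unfolding eq by (rule norm_triangle_le[OF add_mono])
      then show "norm (\<gamma>t i (bt ?v) - \<gamma>s i (bs ?v)) \<le> 2 * (C * C * h * h\<^sup>2)" by (simp add: mult_ac)
    qed
    then show ?thesis by (simp add: k_def power2_eq_square power3_eq_cube mult_ac)
  qed
  have "norm (T1 + T2 - T3 - T4 - T5 - T6) \<le> norm T1 + norm T2 + norm T3 + norm T4 + norm T5 + norm T6"
    by (intro norm_triangle_le_diff norm_triangle_le add_mono order_refl)
  also have "\<dots> \<le> C\<^sup>2 * h ^ 3 + C\<^sup>2 * h ^ 3 + k * C\<^sup>2 * h ^ 3 + C ^ 4 * h ^ 3 + 4 * k\<^sup>2 * C ^ 4 * h ^ 3 + 2 * k * C\<^sup>2 * h ^ 3"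
    by (intro add_mono T1 T2 T3 T4 T5 T6)
  finally show ?thesis unfolding decomp k_def by (simp add: algebra_simps)
qed

text \<open>From \<open>f e = f (g e) - f (g e - e)\<close> follows
  \<open>onorm f \<le> M + onorm f / 2\<close>, and the last term can be absorbed because
  \<open>onorm f\<close> is finite beforehand. This turns bounds on a form composed with the
  parallelism into bounds on the form itself.\<close>

lemma norm_le_near_identity:
  assumes f: "bounded_linear f" and M: "\<And>e. norm (f (g e)) \<le> M * norm e"
    and g: "\<And>e. norm (g e - e) \<le> norm e / 2"
  shows "norm (f e) \<le> 2 * M * norm e"
proof -
  have "norm (f e) \<le> (M + onorm f / 2) * norm e" for e
  proof -
    have "f e = f (g e) - f (g e - e)" by (simp add: linear_diff[OF bounded_linear.linear[OF f]])
    then have "norm (f e) \<le> norm (f (g e)) + norm (f (g e - e))" by (metis norm_triangle_ineq4)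
    also have "norm (f (g e - e)) \<le> onorm f * (norm e / 2)"
      using onorm[OF f, of "g e - e"] mult_left_mono[OF g[of e] onorm_pos_le[OF f]] by linarith
    finally show ?thesis using M[of e] by (simp add: algebra_simps)
  qed
  note bound = this
  show ?thesis
  proof (cases "e = 0")
    case True
    then show ?thesis using linear_0[OF bounded_linear.linear[OF f]] by simp
  next
    case False
    have "M \<ge> 0" using order_trans[OF norm_ge_zero M[of e]] False by (simp add: zero_le_mult_iff)
    then have "onorm f \<le> M + onorm f / 2" using bound onorm_pos_le[OF f] by (intro onorm_bound) auto
    then have "onorm f * norm e \<le> 2 * M * norm e" by (intro mult_right_mono) auto
    then show ?thesis using onorm[OF f, of e] by linarith
  qed
qed

lemma sum_components_bound:
  fixes v :: "real ^ 'k" and G :: "'k \<Rightarrow> 'v::real_normed_vector"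
  assumes "norm v \<le> h" "\<And>i. norm (G i) \<le> M"
  shows "norm (\<Sum>i\<in>UNIV. v $ i *\<^sub>R G i) \<le> real CARD('k) * h * M"
proof -
  have "norm (\<Sum>i\<in>UNIV. v $ i *\<^sub>R G i) \<le> (\<Sum>i\<in>(UNIV::'k set). h * M)"
  proof (rule sum_norm_le)
    fix i
    have "\<bar>v $ i\<bar> \<le> h" using component_le_norm_cart[of v i] assms(1) by linarith
    then show "norm (v $ i *\<^sub>R G i) \<le> h * M" using assms(2)[of i] order_trans[OF abs_ge_zero]
      by (auto intro!: mult_mono)
  qed
  then show ?thesis by simp
qed

text \<open>The one-forms \<open>\<beta>\<close> and \<open>\<gamma>\<close> are not assumed to be continuous; their bounds are propagated from the
  left endpoint \<open>l\<close>, since the parallelism is close to the identity.\<close>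

lemma local_almost_additive:
  fixes a :: "real \<Rightarrow> 'e::real_normed_vector" and b :: "real \<Rightarrow> real ^ 'k \<Rightarrow> 'e"
    and \<beta> :: "real \<Rightarrow> 'e \<Rightarrow> 'v::real_normed_vector" and \<gamma> :: "real \<Rightarrow> 'k \<Rightarrow> 'e \<Rightarrow> 'v"
    and x :: "real \<Rightarrow> real ^ 'k" and X :: "real \<Rightarrow> real \<Rightarrow> real ^ 'k ^ 'k"
    and \<Psi> :: "'e \<Rightarrow> 'e \<Rightarrow> 'e" and u :: "'e \<Rightarrow> 'e \<Rightarrow> 'e \<Rightarrow> 'e" and S :: "'e \<Rightarrow> 'e \<Rightarrow> 'e \<Rightarrow> 'e"
    and h :: "real \<Rightarrow> real \<Rightarrow> real" and C0 H Cb C1 r :: real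
  assumes B: "fin_basis (B :: 'e set)" and lm: "l \<le> m"
    and E5: "\<And>a b c. a \<in> G \<Longrightarrow> b \<in> G \<Longrightarrow> c \<in> G \<Longrightarrow>
      norm (\<Psi> a c - \<Psi> a b - (c - b)) \<le> C0 * (norm (c - b) * (norm (c - b) + norm (b - a)))"
    and E2: "\<And>a b e. a \<in> G \<Longrightarrow> b \<in> G \<Longrightarrow> norm (u b a e - e) \<le> C0 * (norm (b - a) * norm e)"
    and E4: "\<And>a v w. a \<in> G \<Longrightarrow> norm (S a v w) \<le> C0 * (norm v * norm w)"
    and E4': "\<And>a b v w. a \<in> G \<Longrightarrow> b \<in> G \<Longrightarrow> norm (S a v w - S b v w) \<le> C0 * (norm (a - b) * norm v * norm w)"
    and E3: "\<And>a b c. a \<in> G \<Longrightarrow> b \<in> G \<Longrightarrow> c \<in> G \<Longrightarrow>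
      norm (u b a (\<Psi> a c - \<Psi> a b) - \<Psi> b c - S b (a - b) (c - b))
        \<le> C0 * (norm (a - b) * norm (c - b) * (norm (a - b) + norm (c - b)))"
    and \<Psi>0: "\<And>a. a \<in> G \<Longrightarrow> \<Psi> a a = 0"
    and S_lin: "\<And>a v. a \<in> G \<Longrightarrow> linear (S a v)" "\<And>a w. a \<in> G \<Longrightarrow> linear (\<lambda>v. S a v w)"
    and C0: "0 \<le> C0" and G_small: "\<And>a b. a \<in> G \<Longrightarrow> b \<in> G \<Longrightarrow> C0 * norm (a - b) \<le> 1 / 2"
    and aG: "\<And>s. s \<in> {l..m} \<Longrightarrow> a s \<in> G"
    and h: "\<And>s t. l \<le> s \<Longrightarrow> s \<le> t \<Longrightarrow> t \<le> m \<Longrightarrow> 0 \<le> h s t \<and> h s t \<le> H"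
    and h_mono: "\<And>s t t' v. l \<le> s \<Longrightarrow> s \<le> t \<Longrightarrow> t \<le> t' \<Longrightarrow> t' \<le> v \<Longrightarrow> v \<le> m \<Longrightarrow> h t t' \<le> h s v"
    and x: "\<And>s t. l \<le> s \<Longrightarrow> s \<le> t \<Longrightarrow> t \<le> m \<Longrightarrow> norm (x t - x s) \<le> h s t"
    and X: "\<And>s t. l \<le> s \<Longrightarrow> s \<le> t \<Longrightarrow> t \<le> m \<Longrightarrow> norm (X s t) \<le> (h s t)\<^sup>2"
    and chen: "\<And>s t v. l \<le> s \<Longrightarrow> s \<le> t \<Longrightarrow> t \<le> v \<Longrightarrow> v \<le> m \<Longrightarrow> X s v = X s t + X t v + outer (x t - x s) (x v - x t)"
    and b_lin: "\<And>s. s \<in> {l..m} \<Longrightarrow> linear (b s)"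
    and b_bound: "\<And>s w. s \<in> {l..m} \<Longrightarrow> norm (b s w) \<le> Cb * norm w" and Cb: "0 \<le> Cb"
    and \<beta>_lin: "\<And>s. s \<in> {l..m} \<Longrightarrow> linear (\<beta> s)" and \<gamma>_lin: "\<And>s i. s \<in> {l..m} \<Longrightarrow> linear (\<gamma> s i)"
    and C1: "0 \<le> C1"
    and y1: "\<And>s t. l \<le> s \<Longrightarrow> s \<le> t \<Longrightarrow> t \<le> m \<Longrightarrow> norm (\<Psi> (a s) (a t) - b s (x t - x s)) \<le> C1 * (h s t)\<^sup>2"
    and y2: "\<And>s t w. l \<le> s \<Longrightarrow> s \<le> t \<Longrightarrow> t \<le> m \<Longrightarrow> norm (u (a s) (a t) (b t w) - b s w) \<le> C1 * h s t * norm w"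
    and a1: "\<And>s t e. l \<le> s \<Longrightarrow> s \<le> t \<Longrightarrow> t \<le> m \<Longrightarrow>
      norm (\<beta> t (u (a t) (a s) e) - \<beta> s e - (\<Sum>i\<in>UNIV. (x t - x s) $ i *\<^sub>R \<gamma> s i e)) \<le> C1 * (h s t)\<^sup>2 * norm e"
    and a2: "\<And>s t i e. l \<le> s \<Longrightarrow> s \<le> t \<Longrightarrow> t \<le> m \<Longrightarrow> norm (\<gamma> t i (u (a t) (a s) e) - \<gamma> s i e) \<le> C1 * h s t * norm e"
  defines "\<Xi> s t \<equiv> \<beta> s (\<Psi> (a s) (a t) + apply_tensor_square (S (a s)) (b s) (X s t)) + (\<Sum>i\<in>UNIV. \<gamma> s i (b s (X s t $ i)))"
  shows "\<exists>K. (\<forall>s t v. l \<le> s \<longrightarrow> s \<le> t \<longrightarrow> t \<le> v \<longrightarrow> v \<le> m \<longrightarrow> norm (\<Xi> s v - \<Xi> s t - \<Xi> t v) \<le> K * h s v ^ 3) \<and>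
    (\<forall>s t. l \<le> s \<longrightarrow> s \<le> t \<longrightarrow> t \<le> m \<longrightarrow> norm (\<Xi> s t - \<beta> s (b s (x t - x s))) \<le> K * (h s t)\<^sup>2 \<and>
      (\<forall>w. norm (\<beta> t (b t w) - \<beta> s (b s w)) \<le> K * (h s t * norm w)))"
proof -
  define k where "k = real CARD('k)"
  have H: "0 \<le> H" using h[of l l] lm by auto
  have k: "0 \<le> k" by (simp add: k_def)
  have hx: "(h s t)\<^sup>2 \<le> H * h s t" if "l \<le> s" "s \<le> t" "t \<le> m" for s t
    using h[OF that] by (simp add: power2_eq_square mult_right_mono)
  have near: "norm (u (a t) (a s) e - e) \<le> norm e / 2" if "s \<in> {l..m}" "t \<in> {l..m}" for s t e
  proof -
    have "norm (u (a t) (a s) e - e) \<le> (C0 * norm (a t - a s)) * norm e"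
      using E2[OF aG[OF that(1)] aG[OF that(2)], of e] by (simp add: mult_ac)
    also have "\<dots> \<le> 1 / 2 * norm e" by (intro mult_right_mono G_small aG that) auto
    finally show ?thesis by simp
  qed
  \<comment> \<open>Bounds at the single time \<open>l\<close>, where linearity in finite dimension
    suffices; the bounds at all other times are carried over from there.\<close>
  obtain N\<gamma> where N\<gamma>: "N\<gamma> \<ge> 0" "\<And>i e. norm (\<gamma> l i e) \<le> N\<gamma> * norm e"
  proof
    have bl: "bounded_linear (\<gamma> l i)" for i using fin_basis_bounded_linear[OF B \<gamma>_lin] lm by auto
    show "(\<Sum>i\<in>UNIV. onorm (\<gamma> l i)) \<ge> 0" by (intro sum_nonneg onorm_pos_le bl)
    fix i e
    have "onorm (\<gamma> l i) \<le> (\<Sum>i\<in>UNIV. onorm (\<gamma> l i))" by (intro member_le_sum) (auto intro: onorm_pos_le bl)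
    from order_trans[OF onorm[OF bl[of i], of e] mult_right_mono[OF this norm_ge_zero[of e]]]
    show "norm (\<gamma> l i e) \<le> (\<Sum>i\<in>UNIV. onorm (\<gamma> l i)) * norm e" .
  qed
  define N\<beta> where "N\<beta> = onorm (\<beta> l)"
  have bl\<beta>: "bounded_linear (\<beta> s)" if "s \<in> {l..m}" for s by (rule fin_basis_bounded_linear[OF B \<beta>_lin[OF that]])
  have N\<beta>: "N\<beta> \<ge> 0" "\<And>e. norm (\<beta> l e) \<le> N\<beta> * norm e"
    using onorm[OF bl\<beta>[of l]] onorm_pos_le[OF bl\<beta>[of l]] lm by (auto simp: N\<beta>_def)
  \<comment> \<open>The factor 2 is the one of \<open>norm_le_near_identity\<close>; the rest bounds
    the form composed with the parallelism. \<open>C\<beta>\<close> has the same origin.\<close>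
  define C\<gamma> where "C\<gamma> = 2 * (N\<gamma> + C1 * H)"
  have C\<gamma>: "0 \<le> C\<gamma>" using N\<gamma>(1) C1 H by (simp add: C\<gamma>_def)
  have \<gamma>b: "norm (\<gamma> s i e) \<le> C\<gamma> * norm e" if s: "s \<in> {l..m}" for s i e
    unfolding C\<gamma>_def
  proof (rule norm_le_near_identity)
    show "bounded_linear (\<gamma> s i)" by (rule fin_basis_bounded_linear[OF B \<gamma>_lin[OF s]])
    show "norm (u (a s) (a l) e - e) \<le> norm e / 2" for e using near s lm by auto
    fix e
    have "norm (\<gamma> s i (u (a s) (a l) e) - \<gamma> l i e) \<le> C1 * h l s * norm e" using a2[of l s] s by auto
    also have "\<dots> \<le> C1 * H * norm e" using h[of l s] s C1 by (intro mult_right_mono mult_left_mono) auto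
    finally have 1: "norm (\<gamma> s i (u (a s) (a l) e) - \<gamma> l i e) \<le> C1 * H * norm e" .
    have "norm (\<gamma> s i (u (a s) (a l) e)) \<le> C1 * H * norm e + N\<gamma> * norm e"
      using norm_triangle_le[OF add_mono[OF 1 N\<gamma>(2)[of i e]]] by simp
    then show "norm (\<gamma> s i (u (a s) (a l) e)) \<le> (N\<gamma> + C1 * H) * norm e" by (simp add: algebra_simps)
  qed
  define C\<beta> where "C\<beta> = 2 * (N\<beta> + C1 * H\<^sup>2 + k * H * N\<gamma>)"
  have C\<beta>: "0 \<le> C\<beta>" using N\<gamma>(1) N\<beta>(1) C1 H k by (simp add: C\<beta>_def)
  have \<beta>b: "norm (\<beta> s e) \<le> C\<beta> * norm e" if s: "s \<in> {l..m}" for s e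
    unfolding C\<beta>_def
  proof (rule norm_le_near_identity[OF bl\<beta>[OF s]])
    show "norm (u (a s) (a l) e - e) \<le> norm e / 2" for e using near s lm by auto
    fix e
    let ?\<Sigma> = "\<Sum>i\<in>UNIV. (x s - x l) $ i *\<^sub>R \<gamma> l i e"
    have "norm (\<beta> s (u (a s) (a l) e) - \<beta> l e - ?\<Sigma>) \<le> C1 * (h l s)\<^sup>2 * norm e" using a1[of l s] s by auto
    also have "\<dots> \<le> C1 * H\<^sup>2 * norm e" using h[of l s] s C1 by (intro mult_right_mono mult_left_mono power_mono) auto
    finally have 1: "norm (\<beta> s (u (a s) (a l) e) - \<beta> l e - ?\<Sigma>) \<le> C1 * H\<^sup>2 * norm e" .
    have 2: "norm ?\<Sigma> \<le> k * H * (N\<gamma> * norm e)"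
      unfolding k_def using x[of l s] h[of l s] s by (intro sum_components_bound N\<gamma>) auto
    have "norm (\<beta> s (u (a s) (a l) e)) \<le> C1 * H\<^sup>2 * norm e + k * H * (N\<gamma> * norm e) + N\<beta> * norm e"
      using norm_triangle_le[OF add_mono[OF norm_triangle_le[OF add_mono[OF 1 2]] N\<beta>(2)[of e]]] by simp
    then show "norm (\<beta> s (u (a s) (a l) e)) \<le> (N\<beta> + C1 * H\<^sup>2 + k * H * N\<gamma>) * norm e" by (simp add: algebra_simps)
  qed
  define Ca where "Ca = 2 * (Cb + C1 * H)"
  have Ca: "0 \<le> Ca" using Cb C1 H by (simp add: Ca_def)
  have taylor: "norm (\<Psi> (a s) (a t) - (a t - a s)) \<le> C0 * (norm (a t - a s) * norm (a t - a s))"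
    if "l \<le> s" "s \<le> t" "t \<le> m" for s t
    using E5[of "a s" "a s" "a t"] \<Psi>0[of "a s"] aG[of s] aG[of t] that by simp
  \<comment> \<open>Absorption again: on \<open>G\<close> the quadratic remainder of the logarithm
    is at most half of the coordinate increment, which is therefore at most twice the
    logarithm.\<close>
  have ad: "norm (a t - a s) \<le> Ca * h s t" if st: "l \<le> s" "s \<le> t" "t \<le> m" for s t
  proof -
    have "norm (\<Psi> (a s) (a t) - (a t - a s)) \<le> (C0 * norm (a t - a s)) * norm (a t - a s)"
      using taylor[OF st] by (simp add: mult_ac)
    also have "\<dots> \<le> 1 / 2 * norm (a t - a s)" using st by (intro mult_right_mono G_small aG) auto
    finally have 1: "norm (\<Psi> (a s) (a t) - (a t - a s)) \<le> norm (a t - a s) / 2" by simp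
    have "norm (\<Psi> (a s) (a t)) \<le> C1 * (h s t)\<^sup>2 + Cb * norm (x t - x s)"
      using norm_triangle_le[OF add_mono[OF y1[OF st] b_bound[of s "x t - x s"]]] st by simp
    also have "\<dots> \<le> C1 * (H * h s t) + Cb * h s t"
      using hx[OF st] x[OF st] C1 Cb by (intro add_mono mult_left_mono) auto
    finally have 2: "norm (\<Psi> (a s) (a t)) \<le> (Cb + C1 * H) * h s t" by (simp add: algebra_simps)
    have "norm (a t - a s) \<le> norm (\<Psi> (a s) (a t)) + norm (\<Psi> (a s) (a t) - (a t - a s))"
      using norm_triangle_ineq4[of "\<Psi> (a s) (a t)" "\<Psi> (a s) (a t) - (a t - a s)"] by simp
    then have "norm (a t - a s) \<le> 2 * ((Cb + C1 * H) * h s t)" using 1 2 by linarith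
    then show ?thesis unfolding Ca_def mult.assoc .
  qed
  have taylor': "norm (\<Psi> (a s) (a t) - (a t - a s)) \<le> C0 * Ca\<^sup>2 * (h s t)\<^sup>2" if st: "l \<le> s" "s \<le> t" "t \<le> m" for s t
  proof -
    have "C0 * (norm (a t - a s) * norm (a t - a s)) \<le> C0 * ((Ca * h s t) * (Ca * h s t))"
      using ad[OF st] C0 Ca h[OF st] by (intro mult_left_mono mult_mono) auto
    then show ?thesis using taylor[OF st] by (simp add: power2_eq_square mult_ac)
  qed
  have nearid: "norm (u (a t) (a s) e - e) \<le> C0 * Ca * h s t * norm e" "norm (u (a s) (a t) e - e) \<le> C0 * Ca * h s t * norm e"
    if st: "l \<le> s" "s \<le> t" "t \<le> m" for s t e
  proof -
    have *: "C0 * (norm (a t - a s) * norm e) \<le> C0 * (Ca * h s t * norm e)"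
      using ad[OF st] C0 by (intro mult_left_mono mult_right_mono) auto
    show "norm (u (a t) (a s) e - e) \<le> C0 * Ca * h s t * norm e" "norm (u (a s) (a t) e - e) \<le> C0 * Ca * h s t * norm e"
      using * E2[of "a s" "a t" e] E2[of "a t" "a s" e] aG[of s] aG[of t] st
      by (simp_all add: mult_ac norm_minus_commute)
  qed
  \<comment> \<open>Coordinate differences of \<open>b\<close>, and below those of
    \<open>\<beta>\<close> and \<open>\<gamma>\<close>, follow from the covariant ones, since the
    parallelism differs from the identity by order 1 only.\<close>
  define Cbd where "Cbd = C0 * Ca * Cb + C1"
  have Cbd: "0 \<le> Cbd" using C0 Ca Cb C1 by (simp add: Cbd_def)
  have bd: "norm (b t w - b s w) \<le> Cbd * h s t * norm w" if st: "l \<le> s" "s \<le> t" "t \<le> m" for s t w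
  proof -
    have "norm (u (a s) (a t) (b t w) - b t w) \<le> C0 * Ca * h s t * norm (b t w)" by (rule nearid[OF st])
    also have "\<dots> \<le> C0 * Ca * h s t * (Cb * norm w)"
      using b_bound[of t w] st C0 Ca h[OF st] by (intro mult_left_mono) auto
    finally have 1: "norm (u (a s) (a t) (b t w) - b t w) \<le> C0 * Ca * h s t * (Cb * norm w)" .
    have "b t w - b s w = (u (a s) (a t) (b t w) - b s w) - (u (a s) (a t) (b t w) - b t w)" by simp
    then have "norm (b t w - b s w) \<le> C1 * h s t * norm w + C0 * Ca * h s t * (Cb * norm w)"
      using norm_triangle_le_diff[OF add_mono[OF y2[OF st, of w] 1]] by simp
    then show ?thesis by (simp add: Cbd_def algebra_simps)
  qed
  define C\<beta>d where "C\<beta>d = C1 * H + k * C\<gamma> + C\<beta> * C0 * Ca"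
  have C\<beta>d: "0 \<le> C\<beta>d" using C0 Ca C\<beta> C\<gamma> k H C1 by (simp add: C\<beta>d_def)
  have \<beta>d: "norm (\<beta> t e - \<beta> s e) \<le> C\<beta>d * h s t * norm e" if st: "l \<le> s" "s \<le> t" "t \<le> m" for s t e
  proof -
    let ?\<Sigma> = "\<Sum>i\<in>UNIV. (x t - x s) $ i *\<^sub>R \<gamma> s i e"
    have "norm (\<beta> t (u (a t) (a s) e) - \<beta> s e - ?\<Sigma>) \<le> C1 * (h s t)\<^sup>2 * norm e" by (rule a1[OF st])
    also have "\<dots> \<le> C1 * (H * h s t) * norm e" using hx[OF st] C1 by (intro mult_right_mono mult_left_mono) auto
    finally have 1: "norm (\<beta> t (u (a t) (a s) e) - \<beta> s e - ?\<Sigma>) \<le> C1 * (H * h s t) * norm e" .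
    have 2: "norm ?\<Sigma> \<le> k * h s t * (C\<gamma> * norm e)"
      unfolding k_def using x[OF st] st by (intro sum_components_bound \<gamma>b) auto
    have "norm (\<beta> t (u (a t) (a s) e - e)) \<le> C\<beta> * norm (u (a t) (a s) e - e)" using \<beta>b st by auto
    also have "\<dots> \<le> C\<beta> * (C0 * Ca * h s t * norm e)" using nearid[OF st] C\<beta> by (intro mult_left_mono) auto
    finally have 3: "norm (\<beta> t (u (a t) (a s) e - e)) \<le> C\<beta> * (C0 * Ca * h s t * norm e)" .
    have "linear (\<beta> t)" using \<beta>_lin st by auto
    then have eq: "\<beta> t e - \<beta> s e = (\<beta> t (u (a t) (a s) e) - \<beta> s e - ?\<Sigma>) + ?\<Sigma> - \<beta> t (u (a t) (a s) e - e)"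
      by (simp add: linear_diff)
    have "norm (\<beta> t e - \<beta> s e) \<le> C1 * (H * h s t) * norm e + k * h s t * (C\<gamma> * norm e) + C\<beta> * (C0 * Ca * h s t * norm e)"
      unfolding eq by (rule norm_triangle_le_diff[OF add_mono[OF norm_triangle_le[OF add_mono[OF 1 2]] 3]])
    then show ?thesis by (simp add: C\<beta>d_def algebra_simps)
  qed
  define C\<gamma>d where "C\<gamma>d = C1 + C\<gamma> * C0 * Ca"
  have C\<gamma>d: "0 \<le> C\<gamma>d" using C0 Ca C\<gamma> C1 by (simp add: C\<gamma>d_def)
  have \<gamma>d: "norm (\<gamma> t i e - \<gamma> s i e) \<le> C\<gamma>d * h s t * norm e" if st: "l \<le> s" "s \<le> t" "t \<le> m" for s t i e
  proof -
    have "norm (\<gamma> t i (u (a t) (a s) e - e)) \<le> C\<gamma> * norm (u (a t) (a s) e - e)" using \<gamma>b st by auto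
    also have "\<dots> \<le> C\<gamma> * (C0 * Ca * h s t * norm e)" using nearid[OF st] C\<gamma> by (intro mult_left_mono) auto
    finally have 3: "norm (\<gamma> t i (u (a t) (a s) e - e)) \<le> C\<gamma> * (C0 * Ca * h s t * norm e)" .
    have "linear (\<gamma> t i)" using \<gamma>_lin st by auto
    then have eq: "\<gamma> t i e - \<gamma> s i e = (\<gamma> t i (u (a t) (a s) e) - \<gamma> s i e) - \<gamma> t i (u (a t) (a s) e - e)"
      by (simp add: linear_diff)
    have "norm (\<gamma> t i e - \<gamma> s i e) \<le> C1 * h s t * norm e + C\<gamma> * (C0 * Ca * h s t * norm e)"
      unfolding eq by (rule norm_triangle_le_diff[OF add_mono[OF a2[OF st, of i e] 3]])
    then show ?thesis by (simp add: C\<gamma>d_def algebra_simps)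
  qed
  \<comment> \<open>\<open>D1\<close> belongs to the difference of two logarithms against the
    coordinate increment, \<open>D2\<close> to coordinate increments against \<open>b s\<close> of
    the increments of \<open>x\<close>, and \<open>D3\<close> to the gauge remainder after these
    replacements. Their sum with all other constants, \<open>M\<close>, is the common constant that
    \<open>triple_estimate\<close> asks for.\<close>
  define D1 where "D1 = 2 * C0 * Ca\<^sup>2"
  define D2 where "D2 = C0 * Ca\<^sup>2 + C1 + Cbd"
  define D3 where "D3 = 2 * C0 * Ca ^ 3 + C0 * Ca ^ 3 + C0 * D2 * Ca + C0 * Cb * D2"
  have D: "0 \<le> D1" "0 \<le> D2" "0 \<le> D3" using C0 Ca C1 Cbd Cb by (simp_all add: D1_def D2_def D3_def)
  define M where "M = Cb + C\<beta> + C\<gamma> + Cbd + (Ca + D1 * H) + (D1 + D2) + C1 + C\<beta>d + C\<gamma>d + C0 + C0 * Ca + D3"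
  have nn: "0 \<le> D1 * H" "0 \<le> C0 * Ca" using D H C0 Ca by auto
  have M: "Cb \<le> M" "C\<beta> \<le> M" "C\<gamma> \<le> M" "Cbd \<le> M" "Ca + D1 * H \<le> M" "D1 + D2 \<le> M" "C1 \<le> M" "C\<beta>d \<le> M"
      "C\<gamma>d \<le> M" "C0 \<le> M" "C0 * Ca \<le> M" "D3 \<le> M" "0 \<le> M"
    unfolding M_def using nn D Cb C\<beta> C\<gamma> Cbd Ca C1 C\<beta>d C\<gamma>d C0 by linarith+
  have up: "z \<le> M * w" if "z \<le> c * w" "c \<le> M" "0 \<le> w" for z c w :: real
    using that(1) mult_right_mono[OF that(2,3)] by linarith
  have main: "norm (\<Xi> s v - \<Xi> s t - \<Xi> t v)
      \<le> (2 * M\<^sup>2 + 3 * CARD('k) * M\<^sup>2 + M ^ 4 + 4 * (real CARD('k))\<^sup>2 * M ^ 4) * h s v ^ 3"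
    if stv: "l \<le> s" "s \<le> t" "t \<le> v" "v \<le> m" for s t v
  proof -
    have st: "l \<le> s" "s \<le> t" "t \<le> m" and tv: "l \<le> t" "t \<le> v" "v \<le> m" and sv: "l \<le> s" "s \<le> v" "v \<le> m"
      using stv by auto
    have ins: "s \<in> {l..m}" "t \<in> {l..m}" "v \<in> {l..m}" using stv by auto
    have aGs: "a s \<in> G" "a t \<in> G" "a v \<in> G" using aG ins by auto
    define \<eta> where "\<eta> = h s v"
    have \<eta>: "0 \<le> \<eta>" "\<eta> \<le> H" "h s t \<le> \<eta>" "h t v \<le> \<eta>" "0 \<le> h s t" "0 \<le> h t v"
      using h[OF sv] h_mono[of s s t v] h_mono[of s t v v] stv h[OF st] h[OF tv] by (auto simp: \<eta>_def)
    have \<eta>2: "(h s t)\<^sup>2 \<le> \<eta>\<^sup>2" "(h t v)\<^sup>2 \<le> \<eta>\<^sup>2" using \<eta> by (auto intro: power_mono)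
    have ad1: "norm (a t - a s) \<le> Ca * \<eta>" "norm (a v - a t) \<le> Ca * \<eta>"
      using ad[OF st] ad[OF tv] mult_left_mono[OF \<eta>(3) Ca] mult_left_mono[OF \<eta>(4) Ca] by linarith+
    have xx: "norm (x t - x s) \<le> \<eta>" "norm (x v - x t) \<le> \<eta>" using x[OF st] x[OF tv] \<eta> by linarith+
    let ?\<Delta> = "\<Psi> (a s) (a v) - \<Psi> (a s) (a t)"
    have \<Delta>1: "norm (?\<Delta> - (a v - a t)) \<le> D1 * \<eta>\<^sup>2"
    proof -
      have "norm (?\<Delta> - (a v - a t)) \<le> C0 * (norm (a v - a t) * (norm (a v - a t) + norm (a t - a s)))"
        by (rule E5) (use aGs in auto)
      also have "\<dots> \<le> C0 * ((Ca * \<eta>) * (Ca * \<eta> + Ca * \<eta>))"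
        using C0 ad1 Ca \<eta> by (intro mult_left_mono mult_mono add_mono) auto
      finally show ?thesis by (simp add: D1_def power2_eq_square mult_ac)
    qed
    \<comment> \<open>\<open>b\<close> is frozen at \<open>s\<close> although the increment starts
      at \<open>t\<close>, because the tensor term that comes from Chen's relation has
      \<open>b s\<close> in both slots.\<close>
    have inc: "norm (a v - a t - b s (x v - x t)) \<le> D2 * \<eta>\<^sup>2"
    proof -
      have 1: "norm (\<Psi> (a t) (a v) - (a v - a t)) \<le> C0 * Ca\<^sup>2 * \<eta>\<^sup>2"
        using taylor'[OF tv] mult_left_mono[OF \<eta>2(2), of "C0 * Ca\<^sup>2"] C0 by simp
      have 2: "norm (\<Psi> (a t) (a v) - b t (x v - x t)) \<le> C1 * \<eta>\<^sup>2"
        using y1[OF tv] mult_left_mono[OF \<eta>2(2) C1] by linarith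
      have "norm (b t (x v - x t) - b s (x v - x t)) \<le> Cbd * h s t * norm (x v - x t)" by (rule bd[OF st])
      also have "\<dots> \<le> Cbd * \<eta> * \<eta>" using \<eta> xx Cbd by (intro mult_mono mult_left_mono) auto
      finally have 3: "norm (b t (x v - x t) - b s (x v - x t)) \<le> Cbd * \<eta>\<^sup>2" by (simp add: power2_eq_square mult.assoc)
      have eq: "a v - a t - b s (x v - x t) = (\<Psi> (a t) (a v) - b t (x v - x t)) + (b t (x v - x t) - b s (x v - x t)) - (\<Psi> (a t) (a v) - (a v - a t))"
        by simp
      have "norm (a v - a t - b s (x v - x t)) \<le> C1 * \<eta>\<^sup>2 + Cbd * \<eta>\<^sup>2 + C0 * Ca\<^sup>2 * \<eta>\<^sup>2"
        unfolding eq by (rule norm_triangle_le_diff[OF add_mono[OF norm_triangle_le[OF add_mono[OF 2 3]] 1]])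
      then show ?thesis by (simp add: D2_def algebra_simps)
    qed
    have inc': "norm (a t - a s - b s (x t - x s)) \<le> D2 * \<eta>\<^sup>2"
    proof -
      have eq: "a t - a s - b s (x t - x s) = (\<Psi> (a s) (a t) - b s (x t - x s)) - (\<Psi> (a s) (a t) - (a t - a s))" by simp
      have "norm (a t - a s - b s (x t - x s)) \<le> C1 * (h s t)\<^sup>2 + C0 * Ca\<^sup>2 * (h s t)\<^sup>2"
        unfolding eq by (rule norm_triangle_le_diff[OF add_mono[OF y1[OF st] taylor'[OF st]]])
      also have "\<dots> = (C1 + C0 * Ca\<^sup>2) * (h s t)\<^sup>2" by (simp add: algebra_simps)
      also have "\<dots> \<le> D2 * \<eta>\<^sup>2" using \<eta>2(1) D C1 C0 Cbd by (intro mult_mono) (auto simp: D2_def)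
      finally show ?thesis .
    qed
    \<comment> \<open>\<open>E3\<close> provides the tensor at \<open>a t\<close> with first slot
      \<open>a s - a t\<close>. Linearity reverses the sign of this slot; moving the base point to
      \<open>a s\<close> and replacing both increments by values of \<open>b s\<close> each cost
      order 3.\<close>
    have gauge: "norm (u (a t) (a s) ?\<Delta> - \<Psi> (a t) (a v) + S (a s) (b s (x t - x s)) (b s (x v - x t))) \<le> D3 * \<eta> ^ 3"
    proof -
      let ?p = "a t - a s" and ?q = "a v - a t" and ?p' = "b s (x t - x s)" and ?q' = "b s (x v - x t)"
      have 1: "norm (u (a t) (a s) ?\<Delta> - \<Psi> (a t) (a v) - S (a t) (a s - a t) ?q) \<le> 2 * C0 * Ca ^ 3 * \<eta> ^ 3"
      proof -
        have "norm (u (a t) (a s) ?\<Delta> - \<Psi> (a t) (a v) - S (a t) (a s - a t) ?q)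
            \<le> C0 * (norm (a s - a t) * norm ?q * (norm (a s - a t) + norm ?q))" by (rule E3) (use aGs in auto)
        also have "\<dots> \<le> C0 * ((Ca * \<eta>) * (Ca * \<eta>) * (Ca * \<eta> + Ca * \<eta>))"
          using C0 ad1 Ca \<eta> by (intro mult_left_mono mult_mono add_mono) (auto simp: norm_minus_commute)
        finally show ?thesis by (simp add: power3_eq_cube mult_ac)
      qed
      have 2: "norm (S (a t) ?p ?q - S (a s) ?p ?q) \<le> C0 * Ca ^ 3 * \<eta> ^ 3"
      proof -
        have "norm (S (a t) ?p ?q - S (a s) ?p ?q) \<le> C0 * (norm ?p * norm ?p * norm ?q)" by (rule E4') (use aGs in auto)
        also have "\<dots> \<le> C0 * ((Ca * \<eta>) * (Ca * \<eta>) * (Ca * \<eta>))"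
          using C0 ad1 Ca \<eta> by (intro mult_left_mono mult_mono) auto
        finally show ?thesis by (simp add: power3_eq_cube mult_ac)
      qed
      have 3: "norm (S (a s) (?p - ?p') ?q) \<le> C0 * D2 * Ca * \<eta> ^ 3"
      proof -
        have "norm (S (a s) (?p - ?p') ?q) \<le> C0 * (norm (?p - ?p') * norm ?q)" by (rule E4) (use aGs in auto)
        also have "\<dots> \<le> C0 * ((D2 * \<eta>\<^sup>2) * (Ca * \<eta>))"
          using C0 ad1 inc' Ca \<eta> D by (intro mult_left_mono mult_mono) auto
        finally show ?thesis by (simp add: power3_eq_cube power2_eq_square mult_ac)
      qed
      have 4: "norm (S (a s) ?p' (?q - ?q')) \<le> C0 * Cb * D2 * \<eta> ^ 3"
      proof -
        have "norm (S (a s) ?p' (?q - ?q')) \<le> C0 * (norm ?p' * norm (?q - ?q'))" by (rule E4) (use aGs in auto)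
        also have "\<dots> \<le> C0 * ((Cb * \<eta>) * (D2 * \<eta>\<^sup>2))"
          using C0 inc Cb \<eta> D order_trans[OF b_bound[OF ins(1)] mult_left_mono[OF xx(1) Cb]]
          by (intro mult_left_mono mult_mono) auto
        finally show ?thesis by (simp add: power3_eq_cube power2_eq_square mult_ac)
      qed
      have neg: "S (a t) (a s - a t) ?q = - S (a t) ?p ?q"
        using linear_neg[OF S_lin(2)[OF aGs(2)], of ?p ?q] by simp
      have eq: "u (a t) (a s) ?\<Delta> - \<Psi> (a t) (a v) + S (a s) ?p' ?q'
        = (u (a t) (a s) ?\<Delta> - \<Psi> (a t) (a v) - S (a t) (a s - a t) ?q) - (S (a t) ?p ?q - S (a s) ?p ?q)
          - S (a s) (?p - ?p') ?q - S (a s) ?p' (?q - ?q')"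
        unfolding neg linear_diff[OF S_lin(2)[OF aGs(1)], of ?p ?p' ?q] linear_diff[OF S_lin(1)[OF aGs(1)], of ?p' ?q ?q'] by simp
      have "norm (u (a t) (a s) ?\<Delta> - \<Psi> (a t) (a v) + S (a s) ?p' ?q')
        \<le> 2 * C0 * Ca ^ 3 * \<eta> ^ 3 + C0 * Ca ^ 3 * \<eta> ^ 3 + C0 * D2 * Ca * \<eta> ^ 3 + C0 * Cb * D2 * \<eta> ^ 3"
        unfolding eq by (rule norm_triangle_le_diff[OF add_mono[OF norm_triangle_le_diff[OF add_mono[OF norm_triangle_le_diff[OF add_mono[OF 1 2]] 3]] 4]])
      then show ?thesis by (simp add: D3_def algebra_simps)
    qed
    show ?thesis
      unfolding \<Xi>_def \<eta>_def[symmetric]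
    proof (rule triple_estimate[where U = "u (a t) (a s)" and x = "x t - x s" and x' = "x v - x t"])
      show "norm (b s w) \<le> M * norm w" "norm (b t w) \<le> M * norm w" for w
        using up[OF b_bound[OF ins(1)] M(1)] up[OF b_bound[OF ins(2)] M(1)] by auto
      show "norm (\<beta> s e) \<le> M * norm e" "norm (\<beta> t e) \<le> M * norm e" for e
        using up[OF \<beta>b[OF ins(1)] M(2)] up[OF \<beta>b[OF ins(2)] M(2)] by auto
      show "norm (\<gamma> s i e) \<le> M * norm e" "norm (\<gamma> t i e) \<le> M * norm e" for i e
        using up[OF \<gamma>b[OF ins(1)] M(3)] up[OF \<gamma>b[OF ins(2)] M(3)] by auto
      show "norm (X t v) \<le> \<eta>\<^sup>2" using X[OF tv] \<eta>2 by linarith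
      show "X s v = X s t + X t v + outer (x t - x s) (x v - x t)" by (rule chen[OF stv])
      have rel: "c * h s t * z \<le> M * \<eta> * z" if "0 \<le> c" "c \<le> M" "0 \<le> z" for c z
        using that \<eta> M by (intro mult_right_mono mult_mono) auto
      show "norm (b t w - b s w) \<le> M * \<eta> * norm w" for w
        by (rule order_trans[OF bd[OF st] rel]) (use Cbd M in auto)
      show "norm (\<beta> t e - \<beta> s e) \<le> M * \<eta> * norm e" for e
        by (rule order_trans[OF \<beta>d[OF st] rel]) (use C\<beta>d M in auto)
      show "norm (\<gamma> t i e - \<gamma> s i e) \<le> M * \<eta> * norm e" for i e
        by (rule order_trans[OF \<gamma>d[OF st] rel]) (use C\<gamma>d M in auto)
      have "norm ?\<Delta> \<le> D1 * \<eta>\<^sup>2 + Ca * \<eta>" using norm_triangle_le[OF add_mono[OF \<Delta>1 ad1(2)]] by simp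
      also have "\<dots> \<le> D1 * (H * \<eta>) + Ca * \<eta>"
        using \<eta> D Ca by (intro add_mono mult_left_mono) (auto simp: power2_eq_square intro: mult_right_mono)
      finally have "norm ?\<Delta> \<le> (Ca + D1 * H) * \<eta>" by (simp add: algebra_simps)
      then show "norm ?\<Delta> \<le> M * \<eta>" by (rule up[OF _ M(5) \<eta>(1)])
      have "norm (?\<Delta> - b s (x v - x t)) \<le> D1 * \<eta>\<^sup>2 + D2 * \<eta>\<^sup>2"
        using norm_triangle_le[OF add_mono[OF \<Delta>1 inc]] by simp
      then have "norm (?\<Delta> - b s (x v - x t)) \<le> (D1 + D2) * \<eta>\<^sup>2" by (simp add: algebra_simps)
      then show "norm (?\<Delta> - b s (x v - x t)) \<le> M * \<eta>\<^sup>2" by (rule up[OF _ M(6)]) simp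
      show "norm (\<beta> t (u (a t) (a s) e) - \<beta> s e - (\<Sum>i\<in>UNIV. (x t - x s) $ i *\<^sub>R \<gamma> s i e)) \<le> M * \<eta>\<^sup>2 * norm e" for e
        by (rule order_trans[OF a1[OF st]]) (use C1 M \<eta>2 in \<open>intro mult_right_mono mult_mono, auto\<close>)
      show "norm (S (a s) v w) \<le> M * norm v * norm w" "norm (S (a t) v w) \<le> M * norm v * norm w" for v w
        using up[OF E4[OF aGs(1)] M(10), of v w] up[OF E4[OF aGs(2)] M(10), of v w] by (auto simp: mult.assoc)
      show "norm (S (a t) v w - S (a s) v w) \<le> M * \<eta> * norm v * norm w" for v w
      proof -
        have "norm (S (a t) v w - S (a s) v w) \<le> C0 * (norm (a t - a s) * norm v * norm w)" by (rule E4') (use aGs in auto)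
        also have "\<dots> \<le> C0 * ((Ca * \<eta>) * norm v * norm w)" using ad1 C0 by (intro mult_left_mono mult_right_mono) auto
        also have "\<dots> = C0 * Ca * (\<eta> * norm v * norm w)" by (simp add: mult_ac)
        finally show ?thesis using up[OF _ M(11)] \<eta> by (simp add: mult.assoc)
      qed
      show "norm (u (a t) (a s) ?\<Delta> - \<Psi> (a t) (a v) + S (a s) (b s (x t - x s)) (b s (x v - x t))) \<le> M * \<eta> ^ 3"
        by (rule up[OF gauge M(12)]) (use \<eta> in auto)
    qed (use xx \<eta> M aGs ins b_lin \<beta>_lin \<gamma>_lin S_lin in auto)
  qed
  \<comment> \<open>This becomes the Lipschitz bound for the derivative path of the
    integral.\<close>
  have first: "norm (\<beta> t (b t w) - \<beta> s (b s w)) \<le> (C\<beta>d * Cb + C\<beta> * Cbd) * (h s t * norm w)"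
    if st: "l \<le> s" "s \<le> t" "t \<le> m" for s t w
  proof -
    have ins: "s \<in> {l..m}" "t \<in> {l..m}" using st by auto
    have "norm (\<beta> t (b t w) - \<beta> s (b t w)) \<le> C\<beta>d * h s t * norm (b t w)" by (rule \<beta>d[OF st])
    also have "\<dots> \<le> C\<beta>d * h s t * (Cb * norm w)"
      using b_bound[OF ins(2)] C\<beta>d h[OF st] by (intro mult_left_mono) auto
    finally have 1: "norm (\<beta> t (b t w) - \<beta> s (b t w)) \<le> C\<beta>d * h s t * (Cb * norm w)" .
    have "norm (\<beta> s (b t w - b s w)) \<le> C\<beta> * norm (b t w - b s w)" by (rule \<beta>b[OF ins(1)])
    also have "\<dots> \<le> C\<beta> * (Cbd * h s t * norm w)" using bd[OF st] C\<beta> by (intro mult_left_mono) auto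
    finally have 2: "norm (\<beta> s (b t w - b s w)) \<le> C\<beta> * (Cbd * h s t * norm w)" .
    have eq: "\<beta> t (b t w) - \<beta> s (b s w) = (\<beta> t (b t w) - \<beta> s (b t w)) + \<beta> s (b t w - b s w)"
      by (simp add: linear_diff[OF \<beta>_lin[OF ins(1)]])
    have "norm (\<beta> t (b t w) - \<beta> s (b s w)) \<le> C\<beta>d * h s t * (Cb * norm w) + C\<beta> * (Cbd * h s t * norm w)"
      unfolding eq by (rule norm_triangle_le[OF add_mono[OF 1 2]])
    then show ?thesis by (simp add: algebra_simps)
  qed
  \<comment> \<open>The germ agrees with its leading term up to order 2, which later makes the
    integral a controlled path.\<close>
  have second: "norm (\<Xi> s t - \<beta> s (b s (x t - x s))) \<le> (C\<beta> * C1 + C\<beta> * k\<^sup>2 * C0 * Cb\<^sup>2 + k * C\<gamma> * Cb) * (h s t)\<^sup>2"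
    if st: "l \<le> s" "s \<le> t" "t \<le> m" for s t
  proof -
    have s: "s \<in> {l..m}" using st by auto
    let ?sq = "apply_tensor_square (S (a s)) (b s) (X s t)"
    have 1: "norm (\<beta> s (\<Psi> (a s) (a t) - b s (x t - x s))) \<le> C\<beta> * (C1 * (h s t)\<^sup>2)"
      using \<beta>b[OF s] mult_left_mono[OF y1[OF st] C\<beta>] by (rule order_trans)
    have ax: "norm (b s (axis i 1)) \<le> Cb" for i using b_bound[OF s, of "axis i 1"] by simp
    have "norm ?sq \<le> k\<^sup>2 * norm (X s t) * (C0 * (Cb * Cb))"
      unfolding k_def
    proof (rule apply_tensor_square_bound)
      fix i j
      have "norm (S (a s) (b s (axis i 1)) (b s (axis j 1))) \<le> C0 * (norm (b s (axis i 1)) * norm (b s (axis j 1)))"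
        by (rule E4[OF aG[OF s]])
      also have "\<dots> \<le> C0 * (Cb * Cb)" using ax C0 Cb by (intro mult_left_mono mult_mono) auto
      finally show "norm (S (a s) (b s (axis i 1)) (b s (axis j 1))) \<le> C0 * (Cb * Cb)" .
    qed
    also have "\<dots> \<le> k\<^sup>2 * (h s t)\<^sup>2 * (C0 * (Cb * Cb))"
      using X[OF st] C0 Cb by (intro mult_right_mono mult_left_mono) auto
    finally have "norm (\<beta> s ?sq) \<le> C\<beta> * (k\<^sup>2 * (h s t)\<^sup>2 * (C0 * (Cb * Cb)))"
      using \<beta>b[OF s, of ?sq] C\<beta> by (meson mult_left_mono order_trans)
    note 2 = this
    have 3: "norm (\<Sum>i\<in>UNIV. \<gamma> s i (b s (X s t $ i))) \<le> (\<Sum>i\<in>(UNIV::'k set). C\<gamma> * (Cb * (h s t)\<^sup>2))"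
    proof (rule sum_norm_le)
      fix i :: 'k
      have "norm (X s t $ i) \<le> (h s t)\<^sup>2"
        using Finite_Cartesian_Product.norm_nth_le[of "X s t" i] X[OF st] by linarith
      then have "norm (b s (X s t $ i)) \<le> Cb * (h s t)\<^sup>2"
        using b_bound[OF s, of "X s t $ i"] Cb by (meson mult_left_mono order_trans)
      then show "norm (\<gamma> s i (b s (X s t $ i))) \<le> C\<gamma> * (Cb * (h s t)\<^sup>2)"
        using \<gamma>b[OF s, of i] C\<gamma> by (meson mult_left_mono order_trans)
    qed
    have eq: "\<Xi> s t - \<beta> s (b s (x t - x s)) = \<beta> s (\<Psi> (a s) (a t) - b s (x t - x s)) + \<beta> s ?sq + (\<Sum>i\<in>UNIV. \<gamma> s i (b s (X s t $ i)))"
      unfolding \<Xi>_def by (simp add: linear_add[OF \<beta>_lin[OF s]] linear_diff[OF \<beta>_lin[OF s]])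
    have "norm (\<Xi> s t - \<beta> s (b s (x t - x s))) \<le> C\<beta> * (C1 * (h s t)\<^sup>2) + C\<beta> * (k\<^sup>2 * (h s t)\<^sup>2 * (C0 * (Cb * Cb)))
        + (\<Sum>i\<in>(UNIV::'k set). C\<gamma> * (Cb * (h s t)\<^sup>2))"
      unfolding eq by (rule norm_triangle_le[OF add_mono[OF norm_triangle_le[OF add_mono[OF 1 2]] 3]])
    also have "\<dots> = (C\<beta> * C1 + C\<beta> * k\<^sup>2 * C0 * Cb\<^sup>2 + k * C\<gamma> * Cb) * (h s t)\<^sup>2"
      by (simp add: k_def power2_eq_square[of Cb] algebra_simps)
    finally show ?thesis .
  qed
  define K1 where "K1 = 2 * M\<^sup>2 + 3 * CARD('k) * M\<^sup>2 + M ^ 4 + 4 * (real CARD('k))\<^sup>2 * M ^ 4"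
  define K2 where "K2 = C\<beta>d * Cb + C\<beta> * Cbd"
  define K3 where "K3 = C\<beta> * C1 + C\<beta> * k\<^sup>2 * C0 * Cb\<^sup>2 + k * C\<gamma> * Cb"
  define K where "K = max K1 (max K2 K3)"
  have K: "K1 \<le> K" "K2 \<le> K" "K3 \<le> K" by (auto simp: K_def)
  have up': "z \<le> K * w" if "z \<le> c * w" "c \<le> K" "0 \<le> w" for z c w :: real
    using that(1) mult_right_mono[OF that(2,3)] by linarith
  show ?thesis
  proof (intro exI[of _ K] conjI allI impI)
    fix s t v assume stv: "l \<le> s" "s \<le> t" "t \<le> v" "v \<le> m"
    show "norm (\<Xi> s v - \<Xi> s t - \<Xi> t v) \<le> K * h s v ^ 3"
      by (rule up'[OF main[OF stv, folded K1_def] K(1)]) (use h[of s v] stv in auto)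
  next
    fix s t assume st: "l \<le> s" "s \<le> t" "t \<le> m"
    show "norm (\<Xi> s t - \<beta> s (b s (x t - x s))) \<le> K * (h s t)\<^sup>2"
      by (rule up'[OF second[OF st, folded K3_def] K(3)]) simp
    show "norm (\<beta> t (b t w) - \<beta> s (b s w)) \<le> K * (h s t * norm w)" for w
      by (rule up'[OF first[OF st, folded K2_def] K(2)]) (use h[OF st] in auto)
  qed
qed

section \<open>Sewing\<close>

lemma
  assumes "control T \<omega>"
  shows control_nonneg: "0 \<le> s \<Longrightarrow> s \<le> t \<Longrightarrow> t \<le> T \<Longrightarrow> 0 \<le> \<omega> s t"
    and control_diag: "0 \<le> s \<Longrightarrow> s \<le> T \<Longrightarrow> \<omega> s s = 0"
    and control_superadditive: "0 \<le> s \<Longrightarrow> s \<le> t \<Longrightarrow> t \<le> u \<Longrightarrow> u \<le> T \<Longrightarrow> \<omega> s t + \<omega> t u \<le> \<omega> s u"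
  using assms by (auto simp: control_def Delta_def)

lemma control_mono:
  assumes "control T \<omega>" "0 \<le> s'" "s' \<le> s" "s \<le> t" "t \<le> t'" "t' \<le> T"
  shows "\<omega> s t \<le> \<omega> s' t'"
proof -
  have "\<omega> s' s + \<omega> s t \<le> \<omega> s' t" "\<omega> s' t + \<omega> t t' \<le> \<omega> s' t'" "0 \<le> \<omega> s' s" "0 \<le> \<omega> t t'"
    using assms control_nonneg[OF assms(1)] control_superadditive[OF assms(1)] by auto
  then show ?thesis by linarith
qed

lemma control_sum_le:
  assumes "control T \<omega>" and "i \<le> j"
    and "\<And>k. i \<le> k \<Longrightarrow> k < j \<Longrightarrow> \<tau> k \<le> \<tau> (Suc k)" and "0 \<le> \<tau> i" "\<tau> j \<le> T"
  shows "(\<Sum>k=i..<j. \<omega> (\<tau> k) (\<tau> (Suc k))) \<le> \<omega> (\<tau> i) (\<tau> j)"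
proof -
  have "\<tau> i \<le> \<tau> k" if "i \<le> k" "k \<le> j" for k
    using that(1,2)
  proof (induction k rule: dec_induct)
    case (step n)
    then show ?case using assms(3)[of n] by auto
  qed simp
  note lo = this
  have hi: "\<tau> k \<le> \<tau> j" if "i \<le> k" "k \<le> j" for k
    using that(2,1)
  proof (induction k rule: inc_induct)
    case (step n)
    then show ?case using assms(3)[of n] by auto
  qed simp
  have "(\<Sum>k=i..<l. \<omega> (\<tau> k) (\<tau> (Suc k))) \<le> \<omega> (\<tau> i) (\<tau> l)" if "i \<le> l" "l \<le> j" for l
    using that
  proof (induction l rule: dec_induct)
    case base
    have "\<tau> i \<le> T" using hi[of i] assms by auto
    then show ?case using control_diag[OF assms(1), of "\<tau> i"] assms by auto
  next
    case (step n)
    then have "\<omega> (\<tau> i) (\<tau> n) + \<omega> (\<tau> n) (\<tau> (Suc n)) \<le> \<omega> (\<tau> i) (\<tau> (Suc n))"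
      using control_superadditive[OF assms(1), of "\<tau> i" "\<tau> n" "\<tau> (Suc n)"] lo[of n] assms(3)[of n] hi[of "Suc n"] assms(4,5)
      by auto
    then show ?case using step by auto
  qed
  then show ?thesis using assms(2) by auto
qed

text \<open>Uniform continuity on the compact simplex, comparing \<open>(s, t)\<close> with the
  diagonal point \<open>(s, s)\<close>, where the control vanishes.\<close>

lemma control_uniformly_small:
  assumes "control T \<omega>" and "\<epsilon> > 0"
  obtains \<eta> where "\<eta> > 0" "\<And>s t. 0 \<le> s \<Longrightarrow> s \<le> t \<Longrightarrow> t \<le> T \<Longrightarrow> t - s \<le> \<eta> \<Longrightarrow> \<omega> s t < \<epsilon>"
proof -
  have "compact (Delta T)"
  proof -
    have "Delta T = ({0..T} \<times> {0..T}) \<inter> {z. fst z \<le> snd z}" by (auto simp: Delta_def)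
    moreover have "closed {z::real\<times>real. fst z \<le> snd z}"
      by (intro closed_Collect_le continuous_intros)
    ultimately show ?thesis by (auto intro!: compact_Int_closed compact_Times)
  qed
  moreover have "continuous_on (Delta T) (\<lambda>z. \<omega> (fst z) (snd z))"
    using assms(1) by (auto simp: control_def case_prod_unfold)
  ultimately have "uniformly_continuous_on (Delta T) (\<lambda>z. \<omega> (fst z) (snd z))"
    by (rule compact_uniformly_continuous[rotated])
  then obtain d where d: "d > 0" "\<And>z z'. z \<in> Delta T \<Longrightarrow> z' \<in> Delta T \<Longrightarrow> dist z' z < d \<Longrightarrow>
      dist (\<omega> (fst z') (snd z')) (\<omega> (fst z) (snd z)) < \<epsilon>"
    using assms(2) unfolding uniformly_continuous_on_def by meson
  show thesis
  proof
    show "d/2 > 0" using d by simp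
    fix s t assume st: "0 \<le> s" "s \<le> t" "t \<le> T" "t - s \<le> d/2"
    have "dist (s,t) (s,s) < d" using st d by (auto simp: dist_Pair_Pair dist_real_def)
    then have "dist (\<omega> s t) (\<omega> s s) < \<epsilon>" using d(2)[of "(s,s)" "(s,t)"] st by (auto simp: Delta_def)
    then show "\<omega> s t < \<epsilon>" using control_diag[OF assms(1), of s] st by (auto simp: dist_real_def)
  qed
qed

text \<open>Dropping one interval splits the partition into two parts that carry at most half of the control
  each; since \<open>\<theta> > 1\<close>, the factor \<open>1/2\<close> becomes a contraction.\<close>

lemma partition_sum_bound:
  fixes \<Xi> :: "real \<Rightarrow> real \<Rightarrow> 'v::real_normed_vector"
  assumes \<omega>: "control T \<omega>" and "\<theta> > 1" and "C \<ge> 0"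
    and \<Xi>: "\<And>s t u. 0 \<le> s \<Longrightarrow> s \<le> t \<Longrightarrow> t \<le> u \<Longrightarrow> u \<le> T \<Longrightarrow> u - s \<le> \<delta> \<Longrightarrow>
      norm (\<Xi> s u - \<Xi> s t - \<Xi> t u) \<le> C * \<omega> s u powr \<theta>"
    and "\<delta> > 0"
    and mono: "mono \<tau>" and "i \<le> j" "0 \<le> \<tau> i" "\<tau> j \<le> T" "\<tau> j - \<tau> i \<le> \<delta>"
  shows "norm ((\<Sum>k=i..<j. \<Xi> (\<tau> k) (\<tau> (Suc k))) - \<Xi> (\<tau> i) (\<tau> j))
    \<le> 2 * C / (1 - 2 powr (1 - \<theta>)) * \<omega> (\<tau> i) (\<tau> j) powr \<theta>"
proof -
  define K where "K = 2 * C / (1 - 2 powr (1 - \<theta>))"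
  have p1: "2 powr (1 - \<theta>) < 1" using assms by (simp add: powr_less_one)
  have K0: "K \<ge> 0" unfolding K_def using assms p1 by auto
  \<comment> \<open>\<open>K\<close> is defined as the solution of this equation: the two parts
    contribute \<open>K\<close> times \<open>(1/2) powr \<theta>\<close> each, and inserting the two
    points \<open>\<tau> k\<close> and \<open>\<tau> (Suc k)\<close> costs \<open>C\<close>
    each.\<close>
  have K: "2 * K * (1/2) powr \<theta> + 2 * C = K"
  proof -
    have "2 * (1/2) powr \<theta> = 2 powr (1 - \<theta>)"
      by (simp add: powr_diff powr_divide)
    moreover have "K * (1 - 2 powr (1 - \<theta>)) = 2 * C" unfolding K_def using p1 by auto
    ultimately show ?thesis by (simp add: algebra_simps)
  qed
  \<comment> \<open>With all three times equal the defect is \<open>- \<Xi> r r\<close>, while the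
    control vanishes.\<close>
  have diag: "\<Xi> r r = 0" if "0 \<le> r" "r \<le> T" for r
    using \<Xi>[of r r r] control_diag[OF \<omega>, of r] that assms(5) by auto
  have "norm ((\<Sum>k=i..<j. \<Xi> (\<tau> k) (\<tau> (Suc k))) - \<Xi> (\<tau> i) (\<tau> j)) \<le> K * \<omega> (\<tau> i) (\<tau> j) powr \<theta>"
    using assms(7-10)
  proof (induction "j - i" arbitrary: i j rule: less_induct)
    case less
    have m: "a \<le> b \<Longrightarrow> \<tau> a \<le> \<tau> b" for a b using mono by (auto dest: monoD)
    note monoD = control_nonneg[OF \<omega>]
    show ?case
    proof (cases "i = j")
      case True
      then show ?thesis using diag[of "\<tau> j"] less.prems control_diag[OF \<omega>, of "\<tau> j"] by auto
    next
      case False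
      \<comment> \<open>\<open>k\<close> is the last index before \<open>j\<close> up to which at
        most half of the control is used. Up to \<open>Suc k\<close> more than half is used, so that
        superadditivity leaves at most half for the rest; if \<open>Suc k = j\<close>, the right
        part is degenerate. The interval between the two indices is the one that belongs to neither
        part.\<close>
      define P where "P = {k\<in>{i..<j}. \<omega> (\<tau> i) (\<tau> k) \<le> \<omega> (\<tau> i) (\<tau> j) / 2}"
      define k where "k = Max P"
      have ij: "i < j" using less.prems False by auto
      have ran: "0 \<le> \<tau> l" "\<tau> l \<le> T" if "i \<le> l" "l \<le> j" for l
        using m[OF that(1)] m[OF that(2)] less.prems by linarith+
      have nn: "0 \<le> \<omega> (\<tau> a) (\<tau> b)" if "i \<le> a" "a \<le> b" "b \<le> j" for a b
        using control_nonneg[OF \<omega>, of "\<tau> a" "\<tau> b"] m[OF that(2)] ran[of a] ran[of b] that by auto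
      have mon: "\<omega> (\<tau> a) (\<tau> b) \<le> \<omega> (\<tau> i) (\<tau> j)" if "i \<le> a" "a \<le> b" "b \<le> j" for a b
        using control_mono[OF \<omega>, of "\<tau> i" "\<tau> a" "\<tau> b" "\<tau> j"] m ran[of i] ran[of j] that by auto
      have "i \<in> P" unfolding P_def using ij control_diag[OF \<omega>, of "\<tau> i"] ran[of i] nn[of i j] by auto
      then have kP: "k \<in> P" unfolding k_def by (intro Max_in) (auto simp: P_def)
      then have k: "i \<le> k" "k < j" "\<omega> (\<tau> i) (\<tau> k) \<le> \<omega> (\<tau> i) (\<tau> j) / 2" by (auto simp: P_def)
      have right: "\<omega> (\<tau> (Suc k)) (\<tau> j) \<le> \<omega> (\<tau> i) (\<tau> j) / 2"
      proof (cases "Suc k = j")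
        case True
        then show ?thesis using control_diag[OF \<omega>, of "\<tau> j"] ran[of j] nn[of i j] ij by auto
      next
        case False
        have "Suc k \<notin> P"
        proof
          assume "Suc k \<in> P"
          then have "Suc k \<le> k" unfolding k_def by (intro Max_ge) (auto simp: P_def)
          then show False by simp
        qed
        then have "\<omega> (\<tau> i) (\<tau> (Suc k)) > \<omega> (\<tau> i) (\<tau> j) / 2" using False k by (auto simp: P_def)
        moreover have "\<omega> (\<tau> i) (\<tau> (Suc k)) + \<omega> (\<tau> (Suc k)) (\<tau> j) \<le> \<omega> (\<tau> i) (\<tau> j)"
          using k ran[of i] ran[of j] m by (intro control_superadditive[OF \<omega>]) auto
        ultimately show ?thesis by linarith
      qed
      let ?S = "\<lambda>i j. \<Sum>k=i..<j. \<Xi> (\<tau> k) (\<tau> (Suc k))"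
      let ?w = "\<omega> (\<tau> i) (\<tau> j)"
      have half: "x powr \<theta> \<le> (1/2) powr \<theta> * ?w powr \<theta>" if "0 \<le> x" "x \<le> ?w / 2" for x
      proof -
        have "x powr \<theta> \<le> (1/2 * ?w) powr \<theta>" using that assms(2) by (intro powr_mono2) auto
        also have "\<dots> = (1/2) powr \<theta> * ?w powr \<theta>" by (rule powr_mult)
        finally show ?thesis .
      qed
      have "norm (?S i k - \<Xi> (\<tau> i) (\<tau> k)) \<le> K * \<omega> (\<tau> i) (\<tau> k) powr \<theta>"
        using k less.prems ran[of k] m[of k j] by (intro less.hyps) auto
      also have "\<dots> \<le> K * ((1/2) powr \<theta> * ?w powr \<theta>)"
        using half[of "\<omega> (\<tau> i) (\<tau> k)"] k nn[of i k] K0 by (intro mult_left_mono) auto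
      finally have 1: "norm (?S i k - \<Xi> (\<tau> i) (\<tau> k)) \<le> K * ((1/2) powr \<theta> * ?w powr \<theta>)" .
      have "norm (?S (Suc k) j - \<Xi> (\<tau> (Suc k)) (\<tau> j)) \<le> K * \<omega> (\<tau> (Suc k)) (\<tau> j) powr \<theta>"
        using k less.prems ran[of "Suc k"] m[of i "Suc k"] by (intro less.hyps) auto
      also have "\<dots> \<le> K * ((1/2) powr \<theta> * ?w powr \<theta>)"
        using half[of "\<omega> (\<tau> (Suc k)) (\<tau> j)"] right k nn[of "Suc k" j] K0 by (intro mult_left_mono) auto
      finally have 2: "norm (?S (Suc k) j - \<Xi> (\<tau> (Suc k)) (\<tau> j)) \<le> K * ((1/2) powr \<theta> * ?w powr \<theta>)" .
      have 3: "norm (\<Xi> (\<tau> i) (\<tau> j) - \<Xi> (\<tau> i) (\<tau> k) - \<Xi> (\<tau> k) (\<tau> j)) \<le> C * ?w powr \<theta>"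
        using k less.prems m by (intro \<Xi>) auto
      have "norm (\<Xi> (\<tau> k) (\<tau> j) - \<Xi> (\<tau> k) (\<tau> (Suc k)) - \<Xi> (\<tau> (Suc k)) (\<tau> j)) \<le> C * \<omega> (\<tau> k) (\<tau> j) powr \<theta>"
        using k less.prems m[of k "Suc k"] m[of "Suc k" j] m[of i k] ran[of k] by (intro \<Xi>) auto
      also have "\<dots> \<le> C * ?w powr \<theta>"
        using mon[of k j] nn[of k j] k assms(2,3) by (intro mult_left_mono powr_mono2) auto
      finally have 4: "norm (\<Xi> (\<tau> k) (\<tau> j) - \<Xi> (\<tau> k) (\<tau> (Suc k)) - \<Xi> (\<tau> (Suc k)) (\<tau> j)) \<le> C * ?w powr \<theta>" .
      have split: "?S i j = ?S i k + \<Xi> (\<tau> k) (\<tau> (Suc k)) + ?S (Suc k) j"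
      proof -
        have "?S i j = ?S i k + ?S k j" using k by (simp add: sum.atLeastLessThan_concat)
        also have "?S k j = \<Xi> (\<tau> k) (\<tau> (Suc k)) + ?S (Suc k) j" using k by (simp add: sum.atLeast_Suc_lessThan)
        finally show ?thesis by (simp add: add.assoc)
      qed
      have "?S i j - \<Xi> (\<tau> i) (\<tau> j) = (?S i k - \<Xi> (\<tau> i) (\<tau> k)) + (?S (Suc k) j - \<Xi> (\<tau> (Suc k)) (\<tau> j))
         - (\<Xi> (\<tau> i) (\<tau> j) - \<Xi> (\<tau> i) (\<tau> k) - \<Xi> (\<tau> k) (\<tau> j))
         - (\<Xi> (\<tau> k) (\<tau> j) - \<Xi> (\<tau> k) (\<tau> (Suc k)) - \<Xi> (\<tau> (Suc k)) (\<tau> j))"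
        unfolding split by simp
      then have "norm (?S i j - \<Xi> (\<tau> i) (\<tau> j)) \<le> K * ((1/2) powr \<theta> * ?w powr \<theta>) + K * ((1/2) powr \<theta> * ?w powr \<theta>)
          + C * ?w powr \<theta> + C * ?w powr \<theta>"
        using 1 2 3 4 by (smt (verit) norm_triangle_ineq norm_triangle_ineq4)
      also have "\<dots> = (2 * K * (1/2) powr \<theta> + 2 * C) * ?w powr \<theta>" by (simp add: algebra_simps)
      finally show ?thesis using K by simp
    qed
  qed
  then show ?thesis unfolding K_def .
qed

section \<open>Dyadic grids and the sewing of a germ\<close>

definition dyadic_point :: "real \<Rightarrow> nat \<Rightarrow> nat \<Rightarrow> real"
  where "dyadic_point T n k = real k * T / 2 ^ n"

lemma dyadic_point_simps:
  shows "dyadic_point T n 0 = 0" "dyadic_point T n (2 ^ n) = T"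
    "dyadic_point T (n + m) (k * 2 ^ m) = dyadic_point T n k"
    "dyadic_point T n (Suc k) - dyadic_point T n k = T / 2 ^ n"
  by (auto simp: dyadic_point_def power_add field_simps)

lemma mono_dyadic_point: "0 \<le> T \<Longrightarrow> mono (dyadic_point T n)"
  by (auto simp: dyadic_point_def mono_def intro!: divide_right_mono mult_right_mono)

lemma dyadic_mesh_small:
  fixes T :: real
  assumes "\<delta> > 0"
  shows "\<exists>N. \<forall>n\<ge>N. T / 2 ^ n < \<delta>"
proof -
  have "(\<lambda>n. T / 2 ^ n) \<longlonglongrightarrow> 0" by (rule LIMSEQ_divide_realpow_zero) simp
  from order_tendstoD(2)[OF this assms] show ?thesis
    unfolding eventually_sequentially .
qed

text \<open>One power of the control is kept and summed by superadditivity, while the remaining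
  power \<open>\<theta> - 1\<close> is uniformly small on fine grids. Truncating one fixed grid by
  \<open>min t\<close> keeps the choice of \<open>N\<close> uniform in \<open>t\<close>.\<close>

lemma dyadic_powr_sum_small:
  assumes \<omega>: "control T \<omega>" and "\<theta> > 1" "T \<ge> 0" "\<epsilon> > 0"
  shows "\<exists>N. \<forall>n\<ge>N. \<forall>t\<in>{0..T}.
    (\<Sum>k<2^n. \<omega> (min t (dyadic_point T n k)) (min t (dyadic_point T n (Suc k))) powr \<theta>) < \<epsilon>"
proof -
  define \<Omega> where "\<Omega> = \<omega> 0 T"
  have \<Omega>: "\<Omega> \<ge> 0" unfolding \<Omega>_def using control_nonneg[OF \<omega>] assms by auto
  \<comment> \<open>Solves \<open>\<eta> powr (\<theta> - 1) = \<epsilon> / (\<Omega> + 1)\<close>;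
    the summand 1 excludes division by 0 and makes the final inequality strict.\<close>
  define \<eta> where "\<eta> = (\<epsilon> / (\<Omega> + 1)) powr (1 / (\<theta> - 1))"
  have "\<eta> > 0" unfolding \<eta>_def using assms \<Omega> by auto
  have \<eta>p: "\<eta> powr (\<theta> - 1) = \<epsilon> / (\<Omega> + 1)" unfolding \<eta>_def using assms \<Omega> by (simp add: powr_powr)
  obtain d where d: "d > 0" "\<And>s t. 0 \<le> s \<Longrightarrow> s \<le> t \<Longrightarrow> t \<le> T \<Longrightarrow> t - s \<le> d \<Longrightarrow> \<omega> s t < \<eta>"
    using control_uniformly_small[OF \<omega> \<open>\<eta> > 0\<close>] by metis
  obtain N where N: "\<And>n. n \<ge> N \<Longrightarrow> T / 2 ^ n < d"
    using dyadic_mesh_small[OF d(1), of T] by blast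
  have "(\<Sum>k<2^n. \<omega> (min t (dyadic_point T n k)) (min t (dyadic_point T n (Suc k))) powr \<theta>) < \<epsilon>"
    if "n \<ge> N" and t: "t \<in> {0..T}" for n t
  proof -
    let ?\<tau> = "\<lambda>k. min t (dyadic_point T n k)"
    have mono: "?\<tau> k \<le> ?\<tau> (Suc k)" for k
      using monoD[OF mono_dyadic_point[OF \<open>T \<ge> 0\<close>], of k "Suc k" n] by auto
    have r: "0 \<le> ?\<tau> k" "?\<tau> k \<le> T" for k using t assms(3) by (auto simp: dyadic_point_def)
    have "?\<tau> (Suc k) - ?\<tau> k \<le> d" for k
      using dyadic_point_simps(4)[of T n k] N[OF that(1)] assms(3) d(1) by (auto simp: min_def)
    then have sm: "\<omega> (?\<tau> k) (?\<tau> (Suc k)) < \<eta>" and nn: "0 \<le> \<omega> (?\<tau> k) (?\<tau> (Suc k))" for k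
      using d(2)[OF r(1) mono r(2)] control_nonneg[OF \<omega> r(1) mono r(2)] by auto
    have "\<omega> (?\<tau> k) (?\<tau> (Suc k)) powr \<theta> \<le> \<epsilon> / (\<Omega> + 1) * \<omega> (?\<tau> k) (?\<tau> (Suc k))" for k
    proof -
      have "\<omega> (?\<tau> k) (?\<tau> (Suc k)) powr \<theta> = \<omega> (?\<tau> k) (?\<tau> (Suc k)) * \<omega> (?\<tau> k) (?\<tau> (Suc k)) powr (\<theta> - 1)"
        using powr_mult_base[OF nn, of k "\<theta> - 1"] by simp
      also have "\<dots> \<le> \<omega> (?\<tau> k) (?\<tau> (Suc k)) * \<eta> powr (\<theta> - 1)"
        using nn[of k] sm[of k] assms(2) by (intro mult_left_mono powr_mono2) auto
      finally show ?thesis unfolding \<eta>p by (simp add: mult.commute)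
    qed
    then have "(\<Sum>k<2^n. \<omega> (?\<tau> k) (?\<tau> (Suc k)) powr \<theta>) \<le> (\<Sum>k<2^n. \<epsilon> / (\<Omega> + 1) * \<omega> (?\<tau> k) (?\<tau> (Suc k)))"
      by (intro sum_mono) auto
    also have "\<dots> = \<epsilon> / (\<Omega> + 1) * (\<Sum>k=0..<2^n. \<omega> (?\<tau> k) (?\<tau> (Suc k)))"
      by (simp add: sum_distrib_left atLeast0LessThan)
    also have "\<dots> \<le> \<epsilon> / (\<Omega> + 1) * \<Omega>"
    proof (rule mult_left_mono)
      have "(\<Sum>k=0..<2^n. \<omega> (?\<tau> k) (?\<tau> (Suc k))) \<le> \<omega> (?\<tau> 0) (?\<tau> (2^n))"
        using mono r by (intro control_sum_le[OF \<omega>]) auto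
      also have "\<dots> \<le> \<Omega>" unfolding \<Omega>_def
        using t by (intro control_mono[OF \<omega>]) (auto simp: dyadic_point_simps)
      finally show "(\<Sum>k=0..<2^n. \<omega> (?\<tau> k) (?\<tau> (Suc k))) \<le> \<Omega>" .
    qed (use assms \<Omega> in auto)
    also have "\<dots> < \<epsilon>" using assms \<Omega> by (simp add: field_simps)
    finally show ?thesis .
  qed
  then show ?thesis by blast
qed

text \<open>The path is the limit of dyadic Riemann sums of the germ. Grid \<open>n + m\<close>
  refines grid \<open>n\<close>, and \<open>partition_sum_bound\<close> on each cell of grid
  \<open>n\<close> makes the sums Cauchy. No grid is adapted to the pair \<open>s\<close>,
  \<open>t\<close>: at most one cell has \<open>s\<close> in its interior, and its defect vanishes
  in the limit.\<close>

lemma sewing: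
  fixes \<Xi> :: "real \<Rightarrow> real \<Rightarrow> 'v::banach"
  assumes \<omega>: "control T \<omega>" and "\<theta> > 1" "T \<ge> 0" "\<delta> > 0"
    and \<Xi>': "\<And>s t u. 0 \<le> s \<Longrightarrow> s \<le> t \<Longrightarrow> t \<le> u \<Longrightarrow> u \<le> T \<Longrightarrow> u - s \<le> \<delta> \<Longrightarrow>
      norm (\<Xi> s u - \<Xi> s t - \<Xi> t u) \<le> C' * \<omega> s u powr \<theta>"
  shows "\<exists>z K. z 0 = 0 \<and> (\<forall>s t. 0 \<le> s \<longrightarrow> s \<le> t \<longrightarrow> t \<le> T \<longrightarrow> t - s \<le> \<delta> \<longrightarrow>
      norm (z t - z s - \<Xi> s t) \<le> K * \<omega> s t powr \<theta>)"
proof -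
  define C where "C = max 0 C'"
  have C: "C \<ge> 0" by (auto simp: C_def)
  have \<Xi>: "norm (\<Xi> s u - \<Xi> s t - \<Xi> t u) \<le> C * \<omega> s u powr \<theta>"
    if "0 \<le> s" "s \<le> t" "t \<le> u" "u \<le> T" "u - s \<le> \<delta>" for s t u
  proof -
    have "norm (\<Xi> s u - \<Xi> s t - \<Xi> t u) \<le> C' * \<omega> s u powr \<theta>" by (rule \<Xi>'[OF that])
    also have "\<dots> \<le> C * \<omega> s u powr \<theta>" by (intro mult_right_mono) (auto simp: C_def)
    finally show ?thesis .
  qed
  define K where "K = 2 * C / (1 - 2 powr (1 - \<theta>))"
  have "2 powr (1 - \<theta>) < 1" using assms by (simp add: powr_less_one)
  then have K0: "K \<ge> 0" unfolding K_def using C by auto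
  let ?G = "dyadic_point T"
  \<comment> \<open>Truncation at \<open>t\<close> makes the cells beyond \<open>t\<close>
    degenerate, where the germ vanishes, so that one grid serves all times.\<close>
  define Z where "Z n t = (\<Sum>k<2^n. \<Xi> (min t (?G n k)) (min t (?G n (Suc k))))" for n t
  define E where "E n t = (\<Sum>k<2^n. \<omega> (min t (?G n k)) (min t (?G n (Suc k))) powr \<theta>)" for n t
  have diag: "\<Xi> r r = 0" if "0 \<le> r" "r \<le> T" for r
    using \<Xi>[of r r r] control_diag[OF \<omega>, of r] that assms by auto
  obtain N0 where N0: "\<And>n. n \<ge> N0 \<Longrightarrow> T / 2 ^ n < \<delta>"
    using dyadic_mesh_small[OF assms(4), of T] by blast
  have E_small: "\<exists>N. \<forall>n\<ge>N. \<forall>t\<in>{0..T}. E n t < \<epsilon>" if "\<epsilon> > 0" for \<epsilon>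
    unfolding E_def by (rule dyadic_powr_sum_small[OF \<omega> assms(2,3) that])
  have Gnn: "0 \<le> ?G n k" for n k using assms(3) by (auto simp: dyadic_point_def)
  have Gmono: "?G n k \<le> ?G n l" if "k \<le> l" for n k l
    using monoD[OF mono_dyadic_point[OF \<open>T \<ge> 0\<close>] that] .
  have block: "norm (Z (n + m) t - Z n t) \<le> K * E n t" if n: "n \<ge> N0" and t: "t \<in> {0..T}" for n m t
  proof -
    let ?\<tau> = "\<lambda>l. min t (?G (n + m) l)"
    \<comment> \<open>Summation by blocks: cell \<open>k\<close> of grid \<open>n\<close> consists
      of the \<open>2 ^ m\<close> cells of grid \<open>n + m\<close> that start at index
      \<open>k * 2 ^ m\<close>.\<close>
    have 1: "Z (n + m) t = (\<Sum>k<2^n. \<Sum>l=k * 2^m..<k * 2^m + 2^m. \<Xi> (?\<tau> l) (?\<tau> (Suc l)))"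
      unfolding Z_def by (subst sum.nat_group) (simp add: power_add)
    have "norm ((\<Sum>l=k * 2^m..<k * 2^m + 2^m. \<Xi> (?\<tau> l) (?\<tau> (Suc l))) - \<Xi> (min t (?G n k)) (min t (?G n (Suc k))))
        \<le> K * \<omega> (min t (?G n k)) (min t (?G n (Suc k))) powr \<theta>" for k
    proof -
      have a: "?\<tau> (k * 2^m) = min t (?G n k)" "?\<tau> (k * 2^m + 2^m) = min t (?G n (Suc k))"
        using dyadic_point_simps(3)[of T n m k] dyadic_point_simps(3)[of T n m "Suc k"]
        by (auto simp: add.commute)
      have b: "mono ?\<tau>" using Gmono by (auto simp: mono_def min_def intro: order_trans)
      have "norm ((\<Sum>l=k * 2^m..<k * 2^m + 2^m. \<Xi> (?\<tau> l) (?\<tau> (Suc l))) - \<Xi> (?\<tau> (k * 2^m)) (?\<tau> (k * 2^m + 2^m)))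
         \<le> K * \<omega> (?\<tau> (k * 2^m)) (?\<tau> (k * 2^m + 2^m)) powr \<theta>"
        unfolding K_def
      proof (rule partition_sum_bound[OF \<omega> assms(2) C, where \<delta> = \<delta>])
        show "?\<tau> (k * 2^m + 2^m) - ?\<tau> (k * 2^m) \<le> \<delta>"
          unfolding a using dyadic_point_simps(4)[of T n k] N0[OF n] assms by (auto simp: min_def)
      qed (use \<Xi> assms b Gnn t in auto)
      then show ?thesis unfolding a .
    qed
    then have "norm (\<Sum>k<2^n. (\<Sum>l=k * 2^m..<k * 2^m + 2^m. \<Xi> (?\<tau> l) (?\<tau> (Suc l)))
        - \<Xi> (min t (?G n k)) (min t (?G n (Suc k)))) \<le> K * E n t"
      unfolding E_def sum_distrib_left by (intro sum_norm_le) auto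
    then show ?thesis unfolding 1 sum_subtractf by (simp add: Z_def)
  qed
  have "Cauchy (\<lambda>n. Z n t)" if t: "t \<in> {0..T}" for t
  proof (rule metric_CauchyI)
    fix e :: real assume e: "e > 0"
    obtain N where N: "\<forall>n\<ge>N. \<forall>t\<in>{0..T}. E n t < e / (2 * (K + 1))"
      using E_small[of "e / (2 * (K + 1))"] e K0 by auto
    define M where "M = max N N0"
    have NM: "M \<ge> N" "M \<ge> N0" unfolding M_def by auto
    have M: "norm (Z n t - Z M t) < e / 2" if "n \<ge> M" for n
    proof -
      obtain m where m: "n = M + m" using le_Suc_ex[OF \<open>n \<ge> M\<close>] by blast
      have "norm (Z n t - Z M t) \<le> K * E M t"
        unfolding m by (rule block[OF NM(2) t])
      also have "\<dots> \<le> K * (e / (2 * (K + 1)))" using N NM t K0 by (intro mult_left_mono) (auto simp: less_imp_le)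
      also have "\<dots> < e / 2" using e K0 by (simp add: field_simps)
      finally show ?thesis .
    qed
    have "dist (Z m t) (Z n t) < e" if "m \<ge> M" "n \<ge> M" for m n
      using M[OF that(1)] M[OF that(2)] dist_triangle_half_l[of "Z m t" "Z M t" e "Z n t"]
      by (auto simp: dist_norm norm_minus_commute)
    then show "\<exists>M. \<forall>m\<ge>M. \<forall>n\<ge>M. dist (Z m t) (Z n t) < e" by blast
  qed
  then have conv: "(\<lambda>n. Z n t) \<longlonglongrightarrow> lim (\<lambda>n. Z n t)" if "t \<in> {0..T}" for t
    using that Cauchy_convergent convergent_LIMSEQ_iff by blast
  define z where "z t = lim (\<lambda>n. Z n t)" for t
  have "min 0 (?G n k) = 0" for n k using Gnn[of n k] by simp
  then have "Z n 0 = 0" for n unfolding Z_def using diag[of 0] assms by simp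
  then have z0: "z 0 = 0" unfolding z_def by simp
  have main: "norm (z t - z s - \<Xi> s t) \<le> K * \<omega> s t powr \<theta>"
    if st: "0 \<le> s" "s \<le> t" "t \<le> T" "t - s \<le> \<delta>" for s t
  proof -
    have lim: "(\<lambda>n. Z n t - Z n s - \<Xi> s t) \<longlonglongrightarrow> z t - z s - \<Xi> s t"
      unfolding z_def using st by (intro tendsto_intros conv) auto
    have est: "norm (Z n t - Z n s - \<Xi> s t) \<le> K * \<omega> s t powr \<theta> + C * E n t" if n: "n \<ge> N0" for n
    proof -
      \<comment> \<open>The grid clamped to the interval from \<open>s\<close> to \<open>t\<close>:
        its sum \<open>Y\<close> is near \<open>\<Xi> s t\<close> by
        \<open>partition_sum_bound\<close>, and near \<open>Z n t - Z n s\<close> cell by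
        cell.\<close>
      let ?c = "\<lambda>k. max s (min t (?G n k))"
      define Y where "Y = (\<Sum>k<2^n. \<Xi> (?c k) (?c (Suc k)))"
      have "norm ((\<Sum>k=0..<2^n. \<Xi> (?c k) (?c (Suc k))) - \<Xi> (?c 0) (?c (2^n))) \<le> K * \<omega> (?c 0) (?c (2^n)) powr \<theta>"
        unfolding K_def
      proof (rule partition_sum_bound[OF \<omega> assms(2) C, where \<delta> = \<delta>])
        show "mono ?c" using Gmono by (auto simp: mono_def min_def max_def intro: order_trans)
      qed (use \<Xi> assms st in \<open>auto simp: dyadic_point_simps\<close>)
      moreover have "?c 0 = s" "?c (2^n) = t" using st by (simp_all add: dyadic_point_simps)
      ultimately have 1: "norm (Y - \<Xi> s t) \<le> K * \<omega> s t powr \<theta>"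
        unfolding Y_def by (simp only: atLeast0LessThan)
      have "norm (\<Xi> (min t (?G n k)) (min t (?G n (Suc k))) - \<Xi> (min s (?G n k)) (min s (?G n (Suc k))) - \<Xi> (?c k) (?c (Suc k)))
          \<le> C * \<omega> (min t (?G n k)) (min t (?G n (Suc k))) powr \<theta>" for k
      proof -
        let ?a = "?G n k" and ?b = "?G n (Suc k)"
        have ab: "?a \<le> ?b" "0 \<le> ?a" "?b - ?a \<le> \<delta>"
          using Gmono[of k "Suc k" n] Gnn N0[OF n] dyadic_point_simps(4)[of T n k] by auto
        \<comment> \<open>Only a cell with \<open>s\<close> in its interior has a genuine defect; on
          the other cells the terms cancel or are degenerate.\<close>
        consider "?b \<le> s" | "s \<le> ?a" | "?a < s" "s < ?b" by linarith
        then show ?thesis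
        proof cases
          case 1
          then have "min t ?a = ?a" "min t ?b = ?b" "min s ?a = ?a" "min s ?b = ?b" using ab st by auto
          then show ?thesis using 1 ab diag[of s] st C by auto
        next
          case 2
          then have "min s ?a = s" "min s ?b = s" "?c k = min t ?a" "?c (Suc k) = min t ?b" using ab st by auto
          then show ?thesis using diag[of s] st C by auto
        next
          case 3
          then have eq: "min s ?a = ?a" "min s ?b = s" "min t ?a = ?a" "max s ?a = s" "?c (Suc k) = min t ?b"
            using ab st by auto
          have "norm (\<Xi> ?a (min t ?b) - \<Xi> ?a s - \<Xi> s (min t ?b)) \<le> C * \<omega> ?a (min t ?b) powr \<theta>"
            using 3 ab st by (intro \<Xi>) auto
          then show ?thesis unfolding eq .
        qed
      qed
      then have 2: "norm (Z n t - Z n s - Y) \<le> C * E n t"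
        unfolding Z_def Y_def E_def sum_subtractf[symmetric] sum_distrib_left
        by (intro sum_norm_le) auto
      have eq: "Z n t - Z n s - \<Xi> s t = (Y - \<Xi> s t) + (Z n t - Z n s - Y)" by simp
      show ?thesis unfolding eq using 1 2 by (intro norm_triangle_le add_mono)
    qed
    show ?thesis
    proof (rule field_le_epsilon)
      fix e :: real assume e: "e > 0"
      obtain N where N: "\<forall>n\<ge>N. \<forall>t\<in>{0..T}. E n t < e / (C + 1)"
        using E_small[of "e / (C + 1)"] e C by auto
      have "norm (Z n t - Z n s - \<Xi> s t) \<le> K * \<omega> s t powr \<theta> + e" if "n \<ge> max N N0" for n
      proof -
        have "C * E n t \<le> C * (e / (C + 1))" using N that st C by (intro mult_left_mono) (auto simp: less_imp_le)
        also have "\<dots> \<le> e" using e C by (simp add: field_simps)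
        finally show ?thesis using est[of n] that by auto
      qed
      then show "norm (z t - z s - \<Xi> s t) \<le> K * \<omega> s t powr \<theta> + e"
        by (intro LIMSEQ_le_const2[OF tendsto_norm[OF lim]]) blast
    qed
  qed
  show ?thesis using z0 main by blast
qed

text \<open>The uniqueness part of sewing, meant for the difference of two paths with the same germ:
  telescoping over ever finer grids bounds the increment by sums that tend to 0 because
  \<open>\<theta> > 1\<close>.\<close>

lemma additive_small_imp_const:
  fixes f :: "real \<Rightarrow> 'v::real_normed_vector"
  assumes \<omega>: "control T \<omega>" and "\<theta> > 1" "T \<ge> 0" "\<delta> > 0"
    and f: "\<And>s t. 0 \<le> s \<Longrightarrow> s \<le> t \<Longrightarrow> t \<le> T \<Longrightarrow> t - s \<le> \<delta> \<Longrightarrow> norm (f t - f s) \<le> K * \<omega> s t powr \<theta>"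
    and t: "t \<in> {0..T}"
  shows "f t = f 0"
proof -
  let ?G = "dyadic_point T"
  define E where "E n = (\<Sum>k<2^n. \<omega> (min t (?G n k)) (min t (?G n (Suc k))) powr \<theta>)" for n
  obtain N0 where N0: "\<And>n. n \<ge> N0 \<Longrightarrow> T / 2 ^ n < \<delta>"
    using dyadic_mesh_small[OF assms(4), of T] by blast
  have est: "norm (f t - f 0) \<le> \<bar>K\<bar> * E n" if n: "n \<ge> N0" for n
  proof -
    let ?\<tau> = "\<lambda>k. min t (?G n k)"
    have "norm (f (?\<tau> (Suc k)) - f (?\<tau> k)) \<le> \<bar>K\<bar> * \<omega> (?\<tau> k) (?\<tau> (Suc k)) powr \<theta>" for k
    proof -
      have "norm (f (?\<tau> (Suc k)) - f (?\<tau> k)) \<le> K * \<omega> (?\<tau> k) (?\<tau> (Suc k)) powr \<theta>"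
        using monoD[OF mono_dyadic_point[OF \<open>T \<ge> 0\<close>], of k "Suc k" n] N0[OF n]
          dyadic_point_simps(4)[of T n k] t assms(3,4)
        by (intro f) (auto simp: min_def dyadic_point_def)
      also have "\<dots> \<le> \<bar>K\<bar> * \<omega> (?\<tau> k) (?\<tau> (Suc k)) powr \<theta>" by (intro mult_right_mono) auto
      finally show ?thesis .
    qed
    then have "norm (\<Sum>k<2^n. f (?\<tau> (Suc k)) - f (?\<tau> k)) \<le> \<bar>K\<bar> * E n"
      unfolding E_def sum_distrib_left by (intro sum_norm_le) auto
    moreover have "(\<Sum>k<2^n. f (?\<tau> (Suc k)) - f (?\<tau> k)) = f t - f 0"
      using t by (subst sum_lessThan_telescope) (simp add: dyadic_point_simps)
    ultimately show ?thesis by simp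
  qed
  have "norm (f t - f 0) \<le> 0"
  proof (rule field_le_epsilon)
    fix e :: real assume e: "e > 0"
    obtain N where N: "\<forall>n\<ge>N. \<forall>t\<in>{0..T}. (\<Sum>k<2^n. \<omega> (min t (?G n k)) (min t (?G n (Suc k))) powr \<theta>) < e / (\<bar>K\<bar> + 1)"
      using dyadic_powr_sum_small[OF \<omega> assms(2,3), of "e / (\<bar>K\<bar> + 1)"] e by auto
    have "norm (f t - f 0) \<le> \<bar>K\<bar> * E (max N N0)" by (rule est) simp
    also have "\<dots> \<le> \<bar>K\<bar> * (e / (\<bar>K\<bar> + 1))"
      using N t by (intro mult_left_mono) (auto simp: E_def less_imp_le)
    also have "\<dots> \<le> e" using e by (simp add: field_simps)
    finally show "norm (f t - f 0) \<le> 0 + e" by simp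
  qed
  then show ?thesis by simp
qed

section \<open>Manifolds in charts\<close>

lemma has_derivative_transform_nhds:
  assumes "(f has_derivative f') (at x)" and "\<forall>\<^sub>F y in nhds x. f y = g y"
  shows "(g has_derivative f') (at x)"
  using has_derivative_transform_eventually[OF assms(1)] assms(2) by (simp add: eventually_nhds_conv_at)

section \<open>Charts, tangent spaces and directional derivatives\<close>

locale smooth_atlas =
  fixes A :: "('m::{t2_space, second_countable_topology}, 'e::real_normed_vector) chart set"
  assumes manifold: "smooth_manifold A"
begin

lemma model_fin_basis: "\<exists>B::'e set. fin_basis B"
  using manifold fin_basis_exists unfolding smooth_manifold_def by blast

lemma chart_at: "\<exists>c\<in>A. m \<in> fst c"
  using manifold unfolding smooth_manifold_def by blast

lemma chartD:
  assumes "c \<in> A"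
  shows "open (fst c)" "open (cimage c)" "homeomorphism (fst c) (cimage c) (snd c) (cinv c)"
  using manifold assms unfolding smooth_manifold_def is_chart_def by blast+

lemma cinv_chart [simp]: "c \<in> A \<Longrightarrow> m \<in> fst c \<Longrightarrow> cinv c (snd c m) = m"
  by (rule homeomorphism_apply1[OF chartD(3)])

lemma chart_cinv [simp]: "c \<in> A \<Longrightarrow> x \<in> cimage c \<Longrightarrow> snd c (cinv c x) = x"
  by (rule homeomorphism_apply2[OF chartD(3)])

lemma cinv_in [simp]: "c \<in> A \<Longrightarrow> x \<in> cimage c \<Longrightarrow> cinv c x \<in> fst c"
  using homeomorphism_image2[OF chartD(3), of c] by blast

lemma chart_in_cimage [simp]: "m \<in> fst c \<Longrightarrow> snd c m \<in> cimage c"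
  by (simp add: cimage_def)

lemma open_chart_preimage:
  assumes "c \<in> A" "open W"
  shows "open {x \<in> cimage c. cinv c x \<in> W}"
proof -
  have "continuous_on (cimage c) (cinv c)" using chartD(3)[OF assms(1)] by (simp add: homeomorphism_def)
  from continuous_open_preimage[OF this chartD(2)[OF assms(1)] assms(2)]
  show ?thesis by (simp add: vimage_def Int_def)
qed

lemma open_cinv_image:
  assumes "c \<in> A" "open V"
  shows "open {m \<in> fst c. snd c m \<in> V}"
proof -
  have "continuous_on (fst c) (snd c)" using chartD(3)[OF assms(1)] by (simp add: homeomorphism_def)
  from continuous_open_preimage[OF this chartD(1)[OF assms(1)] assms(2)]
  show ?thesis by (simp add: vimage_def Int_def)
qed

lemma eventually_cinv:
  assumes "c \<in> A" "m \<in> fst c" "open W" "m \<in> W"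
  shows "\<forall>\<^sub>F x in nhds (snd c m). x \<in> cimage c \<and> cinv c x \<in> W"
  using eventually_nhds_in_open[OF open_chart_preimage[OF assms(1,3)], of "snd c m"] assms by auto

abbreviation D_trans where
  "D_trans c c' m \<equiv> frechet_derivative (transition c c') (at (snd c m))"

lemma transition_has_derivative:
  assumes "c \<in> A" "c' \<in> A" "m \<in> fst c" "m \<in> fst c'"
  shows "(transition c c' has_derivative D_trans c c' m) (at (snd c m))"
proof -
  have "smooth_on (transition c c') (snd c ` (fst c \<inter> fst c'))"
    using manifold assms unfolding smooth_manifold_def by blast
  then have "Ck_on (Suc 0) (transition c c') (snd c ` (fst c \<inter> fst c'))" unfolding smooth_on_def by blast
  then show ?thesis by (rule Ck_on_has_derivative) (use assms in auto)
qed

lemma transition_apply: "c \<in> A \<Longrightarrow> m \<in> fst c \<Longrightarrow> transition c c' (snd c m) = snd c' m"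
  by (simp add: transition_def)

lemma D_trans_linear:
  assumes "c \<in> A" "c' \<in> A" "m \<in> fst c" "m \<in> fst c'"
  shows "linear (D_trans c c' m)"
  by (rule has_derivative_linear[OF transition_has_derivative[OF assms]])

lemma D_trans_self:
  assumes "c \<in> A" "m \<in> fst c"
  shows "D_trans c c m e = e"
proof -
  have "\<forall>\<^sub>F x in nhds (snd c m). transition c c x = x"
    using eventually_cinv[OF assms open_UNIV UNIV_I] by eventually_elim (use assms in \<open>auto simp: transition_def\<close>)
  then have "((\<lambda>x. x) has_derivative D_trans c c m) (at (snd c m))"
    by (rule has_derivative_transform_nhds[OF transition_has_derivative[OF assms(1,1,2,2)]])
  from has_derivative_unique[OF this has_derivative_ident] show ?thesis by metis
qed

text \<open>The cocycle rule. It makes the families built by \<open>tangent_of\<close> consistent in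
  all charts, hence tangent vectors.\<close>

lemma D_trans_comp:
  assumes "c \<in> A" "c' \<in> A" "c'' \<in> A" "m \<in> fst c" "m \<in> fst c'" "m \<in> fst c''"
  shows "D_trans c c'' m e = D_trans c' c'' m (D_trans c c' m e)"
proof -
  have "((transition c' c'') has_derivative D_trans c' c'' m) (at (transition c c' (snd c m)))"
    using transition_has_derivative[OF assms(2,3,5,6)] transition_apply[OF assms(1,4)] by simp
  from has_derivative_compose[OF transition_has_derivative[OF assms(1,2,4,5)] this]
  have 1: "((\<lambda>x. transition c' c'' (transition c c' x)) has_derivative (\<lambda>e. D_trans c' c'' m (D_trans c c' m e))) (at (snd c m))" .
  have "\<forall>\<^sub>F x in nhds (snd c m). transition c' c'' (transition c c' x) = transition c c'' x"
    using eventually_cinv[OF assms(1,4) chartD(1)[OF assms(2)] assms(5)]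
    by eventually_elim (use assms in \<open>auto simp: transition_def\<close>)
  then have "(transition c c'' has_derivative (\<lambda>e. D_trans c' c'' m (D_trans c c' m e))) (at (snd c m))"
    by (rule has_derivative_transform_nhds[OF 1])
  from has_derivative_unique[OF transition_has_derivative[OF assms(1,3,4,6)] this] show ?thesis by metis
qed

lemma tangent_space_transform:
  "v \<in> tangent_space A m \<Longrightarrow> c \<in> A \<Longrightarrow> c' \<in> A \<Longrightarrow> m \<in> fst c \<Longrightarrow> m \<in> fst c' \<Longrightarrow>
    v c' = D_trans c c' m (v c)"
  unfolding tangent_space_def by blast

lemma tangent_space_outside: "v \<in> tangent_space A m \<Longrightarrow> c \<notin> A \<or> m \<notin> fst c \<Longrightarrow> v c = 0"
  unfolding tangent_space_def by blast

lemma tangent_of_in: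
  assumes "c \<in> A" "m \<in> fst c"
  shows "tangent_of A c m e \<in> tangent_space A m"
  unfolding tangent_space_def mem_Collect_eq
proof (intro conjI ballI allI impI)
  fix c' c'' assume "c' \<in> A" "c'' \<in> A" "m \<in> fst c' \<and> m \<in> fst c''"
  then show "tangent_of A c m e c'' = D_trans c' c'' m (tangent_of A c m e c')"
    using D_trans_comp[OF assms(1), of c' c'' m e] assms by (simp add: tangent_of_def)
next
  fix c' assume "c' \<notin> A \<or> m \<notin> fst c'"
  then show "tangent_of A c m e c' = 0" unfolding tangent_of_def by meson
qed

lemma tangent_of_chart [simp]: "c \<in> A \<Longrightarrow> m \<in> fst c \<Longrightarrow> tangent_of A c m e c = e"
  by (simp add: tangent_of_def D_trans_self)

lemma tangent_of_coords:
  assumes "c \<in> A" "m \<in> fst c" "v \<in> tangent_space A m"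
  shows "tangent_of A c m (v c) = v"
proof
  fix c'
  show "tangent_of A c m (v c) c' = v c'"
    using tangent_space_transform[OF assms(3,1) _ assms(2), of c'] tangent_space_outside[OF assms(3), of c']
    by (simp add: tangent_of_def)
qed

lemma linear_tangent_of: "c \<in> A \<Longrightarrow> m \<in> fst c \<Longrightarrow> linear (tangent_of A c m)"
  by (rule linearI)
    (auto simp: fun_eq_iff tangent_of_def plus_fun_def scaleR_fun_def linear_add[OF D_trans_linear] linear_scale[OF D_trans_linear])

lemma subspace_tangent_space: "subspace (tangent_space A m)"
proof -
  obtain c where c: "c \<in> A" "m \<in> fst c" using chart_at by blast
  have "tangent_space A m = range (tangent_of A c m)"
    using tangent_of_coords[OF c] tangent_of_in[OF c] by (auto intro: rangeI) (metis rangeI)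
  then show ?thesis using linear_subspace_image[OF linear_tangent_of[OF c] subspace_UNIV] by simp
qed

text \<open>\<open>dir_deriv\<close> selects a chart around \<open>m\<close> by \<open>SOME\<close>
  and differentiates every component separately. One derivative, in any chart \<open>c\<close>
  around \<open>m\<close> and for a single component \<open>d\<close>, determines the result: the
  chain rule handles the change of chart at the source, and since the tangent space at
  \<open>k\<close> is fixed, the other components arise from component \<open>d\<close> by a
  constant linear map.\<close>

lemma dir_deriv_eq:
  assumes c: "c \<in> A" "m \<in> fst c" and d: "d \<in> A" "k \<in> fst d" and v: "v \<in> tangent_space A m"
    and W: "open W" "m \<in> W" "\<And>n. n \<in> W \<Longrightarrow> f n \<in> tangent_space A k"
    and f': "((\<lambda>x. f (cinv c x) d) has_derivative f') (at (snd c m))"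
  shows "dir_deriv A m v f = tangent_of A d k (f' (v c))"
proof -
  define c0 where "c0 = (SOME c. c \<in> A \<and> m \<in> fst c)"
  have c0: "c0 \<in> A" "m \<in> fst c0" unfolding c0_def using someI_ex[of "\<lambda>c. c \<in> A \<and> m \<in> fst c"] c by blast+
  have vc: "v c = D_trans c0 c m (v c0)" by (rule tangent_space_transform[OF v c0(1) c(1) c0(2) c(2)])
  have ev: "\<forall>\<^sub>F x in nhds (snd c0 m). x \<in> cimage c0 \<and> cinv c0 x \<in> W \<inter> fst c"
    by (rule eventually_cinv[OF c0 open_Int[OF W(1) chartD(1)[OF c(1)]] IntI[OF W(2) c(2)]])
  have "frechet_derivative (\<lambda>x. f (cinv c0 x) c') (at (snd c0 m)) (v c0) = tangent_of A d k (f' (v c)) c'" for c'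
  proof (cases "c' \<in> A \<and> k \<in> fst c'")
    case True
    then have c': "c' \<in> A" "k \<in> fst c'" by auto
    have "((\<lambda>x. f (cinv c x) d) has_derivative f') (at (transition c0 c (snd c0 m)))"
      using f' by (simp add: transition_apply[OF c0])
    from has_derivative_compose[OF transition_has_derivative[OF c0(1) c(1) c0(2) c(2)] this]
    have 1: "((\<lambda>x. f (cinv c (transition c0 c x)) d) has_derivative (\<lambda>e. f' (D_trans c0 c m e))) (at (snd c0 m))" .
    have "bounded_linear (D_trans d c' k)"
      using transition_has_derivative[OF d(1) c'(1) d(2) c'(2)] by (rule has_derivative_bounded_linear)
    from bounded_linear.has_derivative[OF this 1]
    have 2: "((\<lambda>x. D_trans d c' k (f (cinv c (transition c0 c x)) d)) has_derivative
        (\<lambda>e. D_trans d c' k (f' (D_trans c0 c m e)))) (at (snd c0 m))" .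
    have "\<forall>\<^sub>F x in nhds (snd c0 m). D_trans d c' k (f (cinv c (transition c0 c x)) d) = f (cinv c0 x) c'"
      using ev
    proof eventually_elim
      case (elim x)
      then have "f (cinv c0 x) \<in> tangent_space A k" using W(3) by blast
      then have "f (cinv c0 x) c' = D_trans d c' k (f (cinv c0 x) d)"
        by (rule tangent_space_transform[OF _ d(1) c'(1) d(2) c'(2)])
      moreover have "cinv c (transition c0 c x) = cinv c0 x" using elim c by (auto simp: transition_def)
      ultimately show ?case by simp
    qed
    then have "((\<lambda>x. f (cinv c0 x) c') has_derivative (\<lambda>e. D_trans d c' k (f' (D_trans c0 c m e)))) (at (snd c0 m))"
      by (rule has_derivative_transform_nhds[OF 2])
    from frechet_derivative_at[OF this] show ?thesis using c' by (simp add: tangent_of_def vc fun_eq_iff)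
  next
    \<comment> \<open>Near \<open>m\<close> the values are tangent vectors at \<open>k\<close>, so
      that this component is constantly 0; its derivative agrees with the default 0 of
      \<open>tangent_of\<close>.\<close>
    case False
    have "\<forall>\<^sub>F x in nhds (snd c0 m). 0 = f (cinv c0 x) c'"
      using ev
    proof eventually_elim
      case (elim x)
      then have "f (cinv c0 x) \<in> tangent_space A k" using W(3) by blast
      then show ?case using tangent_space_outside[of "f (cinv c0 x)" k c'] False by simp
    qed
    then have "((\<lambda>x. f (cinv c0 x) c') has_derivative (\<lambda>e. 0)) (at (snd c0 m))"
      by (rule has_derivative_transform_nhds[OF has_derivative_const])
    from frechet_derivative_at[OF this] show ?thesis using False by (auto simp: tangent_of_def fun_eq_iff)
  qed
  then show ?thesis unfolding dir_deriv_def c0_def[symmetric] Let_def by blast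
qed

end

text \<open>A product rule with a merely continuous scalar factor: since \<open>f\<close> vanishes
  at \<open>a\<close>, the product of \<open>g x - g a\<close> with \<open>f x\<close> is of smaller
  order than \<open>x - a\<close>. The scalars will be coordinates of an inverse image whose
  differentiability is the very thing to be shown.\<close>

lemma has_derivative_scaleR_vanishing:
  fixes f :: "'a::real_normed_vector \<Rightarrow> 'b::real_normed_vector" and g :: "'a \<Rightarrow> real"
  assumes g: "isCont g a" and f: "(f has_derivative f') (at a)" "f a = 0"
  shows "((\<lambda>x. g x *\<^sub>R f x) has_derivative (\<lambda>v. g a *\<^sub>R f' v)) (at a)"
proof -
  have bl: "bounded_linear f'" using f(1) by (rule has_derivative_bounded_linear)
  have g0: "((\<lambda>x. g x - g a) \<longlongrightarrow> 0) (at a)"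
    using tendsto_diff[OF isContD[OF g] tendsto_const[of "g a"]] by simp
  have q: "((\<lambda>x. (1 / norm (x - a)) *\<^sub>R (f x - f' (x - a))) \<longlongrightarrow> 0) (at a)"
    using f by (simp add: has_derivative_at_within inverse_eq_divide algebra_simps)
  have "((\<lambda>x. (g x - g a) *\<^sub>R (1 / norm (x - a)) *\<^sub>R (f x - f' (x - a))) \<longlongrightarrow> 0 *\<^sub>R 0) (at a)"
    by (intro tendsto_scaleR g0 q)
  moreover have "((\<lambda>x. (g x - g a) *\<^sub>R (1 / norm (x - a)) *\<^sub>R f' (x - a)) \<longlongrightarrow> 0) (at a)"
  proof (rule Lim_null_comparison)
    show "((\<lambda>x. \<bar>g x - g a\<bar> * onorm f') \<longlongrightarrow> 0) (at a)"
      using tendsto_mult_left_zero[OF tendsto_rabs_zero[OF g0]] by simp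
    have "norm ((g x - g a) *\<^sub>R (1 / norm (x - a)) *\<^sub>R f' (x - a)) \<le> \<bar>g x - g a\<bar> * onorm f'" for x
    proof -
      have "norm ((1 / norm (x - a)) *\<^sub>R f' (x - a)) \<le> onorm f'"
        using onorm[OF bl, of "x - a"] onorm_pos_le[OF bl] by (cases "x = a") (auto simp: field_simps)
      then show ?thesis by (subst norm_scaleR, intro mult_left_mono) auto
    qed
    then show "\<forall>\<^sub>F x in at a. norm ((g x - g a) *\<^sub>R (1 / norm (x - a)) *\<^sub>R f' (x - a)) \<le> \<bar>g x - g a\<bar> * onorm f'"
      by simp
  qed
  ultimately have "((\<lambda>x. (g x - g a) *\<^sub>R (1 / norm (x - a)) *\<^sub>R (f x - f' (x - a))
      + (g x - g a) *\<^sub>R (1 / norm (x - a)) *\<^sub>R f' (x - a)) \<longlongrightarrow> 0 *\<^sub>R 0 + 0) (at a)"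
    by (rule tendsto_add)
  then have "((\<lambda>x. (1 / norm (x - a)) *\<^sub>R (g x - g a) *\<^sub>R f x) \<longlongrightarrow> 0) (at a)"
    by (simp add: scaleR_add_right[symmetric] mult.commute)
  then have 1: "((\<lambda>x. (g x - g a) *\<^sub>R f x) has_derivative (\<lambda>v. 0)) (at a)"
    using f(2) by (simp add: has_derivative_at_within inverse_eq_divide)
  have "((\<lambda>x. g a *\<^sub>R f x) has_derivative (\<lambda>v. g a *\<^sub>R f' v)) (at a)"
    using f(1) by (rule has_derivative_scaleR_right)
  from has_derivative_add[OF 1 this] show ?thesis by (simp add: algebra_simps)
qed

text \<open>A kernel vector would satisfy \<open>norm e \<le> norm e / 2\<close>, and in finite
  dimension an injective endomorphism is onto. Surjectivity is what makes \<open>inv_into\<close> of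
  the parallelism a right inverse.\<close>

lemma linear_near_identity_surj:
  fixes L :: "'a::real_normed_vector \<Rightarrow> 'a"
  assumes B: "fin_basis (B :: 'a set)" and L: "linear L" and near: "\<And>e. norm (L e - e) \<le> norm e / 2"
  shows "surj L"
proof -
  have fin: "finite B" "independent B" "span B = UNIV" using B by (auto simp: fin_basis_def)
  have "inj L" unfolding linear_injective_0[OF L]
  proof (intro allI impI)
    fix e assume "L e = 0"
    then show "e = 0" using near[of e] by simp
  qed
  then have ind: "independent (L ` B)" and card: "card (L ` B) = card B"
    using linear_independent_injective_image[OF L fin(2)] card_image[of L B] by (auto simp: inj_on_def inj_def)
  have "B \<subseteq> span (L ` B)"
  proof (rule ccontr)
    assume "\<not> B \<subseteq> span (L ` B)"
    then obtain b where "b \<notin> span (L ` B)" by blast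
    then have "independent (insert b (L ` B))" "b \<notin> L ` B" using ind span_base[of b "L ` B"]
      by (auto simp: independent_insert)
    moreover have "insert b (L ` B) \<subseteq> span B" using fin by simp
    ultimately have "card (insert b (L ` B)) \<le> card B" using independent_span_bound[OF fin(1)] by blast
    then show False using card fin \<open>b \<notin> L ` B\<close> by simp
  qed
  then have "UNIV \<subseteq> span (L ` B)" using span_mono[of B "span (L ` B)"] fin by (simp add: span_span)
  then show ?thesis using linear_span_image[OF L, of B] fin by auto
qed

text \<open>A real \<open>SUP\<close> says nothing unless the set is bounded above; the a priori
  constant \<open>K\<close> guarantees this and also settles vectors with \<open>n1 v = 0\<close>.
  All other vectors are scaled to the unit ball.\<close>

lemma op_norm_bound:
  fixes n1 :: "'a::real_vector \<Rightarrow> real" and n2 :: "'b::real_vector \<Rightarrow> real"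
  assumes S: "\<And>r v. v \<in> S \<Longrightarrow> r *\<^sub>R v \<in> S" and hom: "\<And>r v. v \<in> S \<Longrightarrow> n1 (r *\<^sub>R v) = \<bar>r\<bar> * n1 v"
      "\<And>r v. v \<in> S \<Longrightarrow> n2 (f (r *\<^sub>R v)) = \<bar>r\<bar> * n2 (f v)"
    and pos: "\<And>v. v \<in> S \<Longrightarrow> 0 \<le> n1 v" and K: "\<And>v. v \<in> S \<Longrightarrow> n2 (f v) \<le> K * n1 v" and v: "v \<in> S"
  shows "n2 (f v) \<le> op_norm S n1 n2 f * n1 v"
proof (cases "n1 v = 0")
  case True
  then show ?thesis using K[OF v] by simp
next
  case False
  then have p: "n1 v > 0" using pos[OF v] by simp
  let ?w = "(1 / n1 v) *\<^sub>R v"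
  have w: "?w \<in> {v \<in> S. n1 v \<le> 1}" using S[OF v] hom(1)[OF v] p by simp
  have "n2 (f v) \<le> \<bar>K\<bar>" if "v \<in> S" "n1 v \<le> 1" for v
  proof -
    have "K * n1 v \<le> \<bar>K\<bar> * 1" using pos[OF that(1)] that(2) by (intro mult_mono) auto
    then show ?thesis using K[OF that(1)] by simp
  qed
  then have "bdd_above ((\<lambda>v. n2 (f v)) ` {v \<in> S. n1 v \<le> 1})" by (intro bdd_aboveI[of _ "\<bar>K\<bar>"]) auto
  then have "n2 (f ?w) \<le> op_norm S n1 n2 f" unfolding op_norm_def by (rule cSUP_upper[OF w])
  then show ?thesis using hom(2)[OF v, of "1 / n1 v"] p by (simp add: field_simps)
qed

section \<open>Coordinate expressions of a gauge\<close>

locale gauge_atlas = smooth_atlas A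
  for A :: "('m::{t2_space, second_countable_topology}, 'e::real_normed_vector) chart set" +
  fixes D :: "('m \<times> 'm) set" and \<psi> :: "'m \<Rightarrow> 'm \<Rightarrow> ('m, 'e) tvec"
    and U :: "'m \<Rightarrow> 'm \<Rightarrow> ('m, 'e) tvec \<Rightarrow> ('m, 'e) tvec"
  assumes gauge: "manifold_gauge A D \<psi> U"
begin

lemma diag_in: "(m, m) \<in> D" and open_D: "open D"
  using gauge by (auto simp: manifold_gauge_def diagonal_domain_def)

lemma \<psi>_tangent: "(m, n) \<in> D \<Longrightarrow> \<psi> m n \<in> tangent_space A m"
  and \<psi>_diag: "\<psi> m m = 0"
  and \<psi>_deriv: "v \<in> tangent_space A m \<Longrightarrow> dir_deriv A m v (\<psi> m) = v"
proof -
  have g: "logarithm A D \<psi>" using gauge by (simp add: manifold_gauge_def)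
  show "(m, n) \<in> D \<Longrightarrow> \<psi> m n \<in> tangent_space A m" "\<psi> m m = 0"
    "v \<in> tangent_space A m \<Longrightarrow> dir_deriv A m v (\<psi> m) = v"
    using g unfolding logarithm_def by auto
qed

lemma U_tangent: "(n, m) \<in> D \<Longrightarrow> v \<in> tangent_space A m \<Longrightarrow> U n m v \<in> tangent_space A n"
  and U_lin: "(n, m) \<in> D \<Longrightarrow> lin_on (tangent_space A m) (U n m)"
  and U_diag: "v \<in> tangent_space A m \<Longrightarrow> U m m v = v"
proof -
  have "parallelism A D U" using gauge by (simp add: manifold_gauge_def)
  then have "\<forall>(n, m)\<in>D. lin_on (tangent_space A m) (U n m) \<and> U n m ` tangent_space A m \<subseteq> tangent_space A n"
    and U: "\<forall>m. \<forall>v\<in>tangent_space A m. U m m v = v"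
    unfolding parallelism_def by simp_all
  then have *: "(n, m) \<in> D \<Longrightarrow> lin_on (tangent_space A m) (U n m) \<and> U n m ` tangent_space A m \<subseteq> tangent_space A n"
    by blast
  show "(n, m) \<in> D \<Longrightarrow> v \<in> tangent_space A m \<Longrightarrow> U n m v \<in> tangent_space A n"
    "(n, m) \<in> D \<Longrightarrow> lin_on (tangent_space A m) (U n m)"
    using * by blast+
  show "v \<in> tangent_space A m \<Longrightarrow> U m m v = v" using U by blast
qed

definition chart_log where "chart_log c a b = \<psi> (cinv c a) (cinv c b) c"

definition chart_par where "chart_par c a b e = U (cinv c a) (cinv c b) (tangent_of A c (cinv c b) e) c"

lemma open_coord_domain: "c \<in> A \<Longrightarrow> open (coord_domain D c c)"
proof -
  assume c: "c \<in> A"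
  have "continuous_on (cimage c) (cinv c)" using chartD(3)[OF c] by (simp add: homeomorphism_def)
  then have "continuous_on (cimage c \<times> cimage c) (\<lambda>p. (cinv c (fst p), cinv c (snd p)))"
    by (intro continuous_on_Pair) (auto intro!: continuous_on_compose2[where f = fst] continuous_on_compose2[where f = snd] continuous_intros)
  from continuous_open_preimage[OF this open_Times[OF chartD(2)[OF c] chartD(2)[OF c]] open_D]
  have "open ((cimage c \<times> cimage c) \<inter> (\<lambda>p. (cinv c (fst p), cinv c (snd p))) -` D)" .
  moreover have "coord_domain D c c = (cimage c \<times> cimage c) \<inter> (\<lambda>p. (cinv c (fst p), cinv c (snd p))) -` D"
    by (auto simp: coord_domain_def)
  ultimately show ?thesis by simp
qed

lemma diag_coord_domain: "a \<in> cimage c \<Longrightarrow> (a, a) \<in> coord_domain D c c"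
  by (simp add: coord_domain_def diag_in)

lemma coord_domain_iff:
  "c \<in> A \<Longrightarrow> m \<in> fst c \<Longrightarrow> n \<in> fst c \<Longrightarrow> (snd c m, snd c n) \<in> coord_domain D c c \<longleftrightarrow> (m, n) \<in> D"
  by (simp add: coord_domain_def)

lemma chart_log_smooth: "c \<in> A \<Longrightarrow> smooth_on (\<lambda>(a, b). chart_log c a b) (coord_domain D c c)"
  using gauge by (simp add: manifold_gauge_def logarithm_def chart_log_def)

lemma chart_par_smooth: "c \<in> A \<Longrightarrow> smooth_on (\<lambda>(a, b). chart_par c a b e) (coord_domain D c c)"
  using gauge by (simp add: manifold_gauge_def parallelism_def chart_par_def)

lemma chart_log_diag: "chart_log c a a = 0"
  by (simp add: chart_log_def \<psi>_diag)

lemma \<psi>_eq: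
  assumes "c \<in> A" "m \<in> fst c" "n \<in> fst c" "(m, n) \<in> D"
  shows "\<psi> m n = tangent_of A c m (chart_log c (snd c m) (snd c n))"
  using tangent_of_coords[OF assms(1,2) \<psi>_tangent[OF assms(4)]] assms by (simp add: chart_log_def)

lemma U_eq:
  assumes "c \<in> A" "m \<in> fst c" "n \<in> fst c" "(n, m) \<in> D"
  shows "U n m (tangent_of A c m e) = tangent_of A c n (chart_par c (snd c n) (snd c m) e)"
  using tangent_of_coords[OF assms(1,3) U_tangent[OF assms(4) tangent_of_in[OF assms(1,2)]], of e] assms
  by (simp add: chart_par_def)

lemma chart_par_diag: "c \<in> A \<Longrightarrow> a \<in> cimage c \<Longrightarrow> chart_par c a a e = e"
  by (simp add: chart_par_def U_diag tangent_of_in)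

lemma chart_par_linear:
  assumes "c \<in> A" "(a, b) \<in> coord_domain D c c"
  shows "linear (chart_par c a b)"
proof -
  have ab: "a \<in> cimage c" "b \<in> cimage c" "(cinv c a, cinv c b) \<in> D" using assms by (auto simp: coord_domain_def)
  have "lin_on (tangent_space A (cinv c b)) (U (cinv c a) (cinv c b))" by (rule U_lin[OF ab(3)])
  moreover have "linear (tangent_of A c (cinv c b))" by (intro linear_tangent_of assms cinv_in ab)
  ultimately show ?thesis
    using tangent_of_in[OF assms(1) cinv_in[OF assms(1) ab(2)]]
    by (intro linearI) (auto simp: chart_par_def lin_on_def linear_add linear_scale plus_fun_def scaleR_fun_def)
qed

lemma chart_log_has_derivative:
  assumes "c \<in> A" "(a, b) \<in> coord_domain D c c"
  shows "((\<lambda>b. chart_log c a b) has_derivative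
    (\<lambda>w. frechet_derivative (\<lambda>(a, b). chart_log c a b) (at (a, b)) (0, w))) (at b)"
proof -
  have "Ck_on (Suc 0) (\<lambda>(a, b). chart_log c a b) (coord_domain D c c)"
    using chart_log_smooth[OF assms(1)] unfolding smooth_on_def by blast
  from Ck_on_has_derivative[OF this assms(2)]
  have "((\<lambda>(a, b). chart_log c a b) has_derivative frechet_derivative (\<lambda>(a, b). chart_log c a b) (at (a, b))) (at (a, b))" .
  moreover have "((\<lambda>b. (a, b)) has_derivative (\<lambda>w. (0, w))) (at b)" by (auto intro!: derivative_eq_intros)
  ultimately have "((\<lambda>b. (\<lambda>(a, b). chart_log c a b) (a, b)) has_derivative
      (\<lambda>w. frechet_derivative (\<lambda>(a, b). chart_log c a b) (at (a, b)) (0, w))) (at b)"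
    using has_derivative_compose[of "\<lambda>b. (a, b)"] by blast
  then show ?thesis by simp
qed

text \<open>With \<open>n\<close> fixed, \<open>\<psi> n\<close> takes values in a single tangent
  space on an open set around \<open>m\<close>, as \<open>dir_deriv_eq\<close> requires; its
  derivative is that of \<open>chart_log\<close> in the second slot.\<close>

lemma log_parallelism_eq:
  assumes c: "c \<in> A" "m \<in> fst c" "n \<in> fst c" "(n, m) \<in> D" and w: "w \<in> tangent_space A m"
  shows "log_parallelism A \<psi> n m w
    = tangent_of A c n (frechet_derivative (\<lambda>(a, b). chart_log c a b) (at (snd c n, snd c m)) (0, w c))"
  unfolding log_parallelism_def
proof (rule dir_deriv_eq[OF c(1,2,1,3) w])
  have "open ((\<lambda>x. (n, x)) -` D)" by (rule open_vimage[OF open_D]) (intro continuous_intros)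
  then show "open {x. (n, x) \<in> D}" by (simp add: vimage_def)
  show "m \<in> {x. (n, x) \<in> D}" using c by simp
  show "\<psi> n x \<in> tangent_space A n" if "x \<in> {x. (n, x) \<in> D}" for x using that \<psi>_tangent by simp
  have "(snd c n, snd c m) \<in> coord_domain D c c" using c by (simp add: coord_domain_iff)
  from chart_log_has_derivative[OF c(1) this]
  show "((\<lambda>x. \<psi> n (cinv c x) c) has_derivative
      (\<lambda>w. frechet_derivative (\<lambda>(a, b). chart_log c a b) (at (snd c n, snd c m)) (0, w))) (at (snd c m))"
    using c by (simp add: chart_log_def[abs_def])
qed

lemma chart_log_deriv_diag:
  assumes "c \<in> A" "a \<in> cimage c"
  shows "frechet_derivative (\<lambda>(a, b). chart_log c a b) (at (a, a)) (0, w) = w"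
proof -
  let ?m = "cinv c a"
  have m: "?m \<in> fst c" "snd c ?m = a" using assms by auto
  have t: "tangent_of A c ?m w \<in> tangent_space A ?m" by (rule tangent_of_in[OF assms(1) m(1)])
  have "tangent_of A c ?m w = log_parallelism A \<psi> ?m ?m (tangent_of A c ?m w)"
    using \<psi>_deriv[OF t] by (simp add: log_parallelism_def)
  also have "\<dots> = tangent_of A c ?m (frechet_derivative (\<lambda>(a, b). chart_log c a b) (at (a, a)) (0, w))"
    using log_parallelism_eq[OF assms(1) m(1,1) diag_in t] m assms by simp
  finally have "tangent_of A c ?m w c = tangent_of A c ?m (frechet_derivative (\<lambda>(a, b). chart_log c a b) (at (a, a)) (0, w)) c"
    by simp
  then show ?thesis using m assms by simp
qed

end

lemma has_derivative_first_arg: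
  assumes "Ck_on (Suc k) f N" "(a, b) \<in> N"
  shows "((\<lambda>x. f (x, b)) has_derivative (\<lambda>v. frechet_derivative f (at (a, b)) (v, 0))) (at a)"
proof -
  have "(f has_derivative frechet_derivative f (at (a, b))) (at (a, b))" by (rule Ck_on_has_derivative[OF assms])
  moreover have "((\<lambda>x. (x, b)) has_derivative (\<lambda>v. (v, 0))) (at a)" by (auto intro!: derivative_eq_intros)
  ultimately show ?thesis using has_derivative_compose[of "\<lambda>x. (x, b)"] by blast
qed

lemma lin_on_sum:
  assumes "lin_on S f" "subspace S" "finite I" "\<And>i. i \<in> I \<Longrightarrow> h i \<in> S"
  shows "f (\<Sum>i\<in>I. h i) = (\<Sum>i\<in>I. f (h i))"
  using assms(3,4)
proof (induction I rule: finite_induct)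
  case empty
  have "0 \<in> S" using assms(2) by (rule subspace_0)
  then have "f (0 *\<^sub>R 0) = 0 *\<^sub>R f 0" using assms(1) unfolding lin_on_def by blast
  then show ?case by simp
next
  case (insert i I)
  then have "(\<Sum>i\<in>I. h i) \<in> S" "h i \<in> S" by (auto intro!: subspace_sum[OF assms(2)])
  then show ?case using insert assms(1) by (auto simp: lin_on_def)
qed

lemma lin_on_add: "lin_on S f \<Longrightarrow> u \<in> S \<Longrightarrow> v \<in> S \<Longrightarrow> f (u + v) = f u + f v"
  and lin_on_scaleR: "lin_on S f \<Longrightarrow> u \<in> S \<Longrightarrow> f (r *\<^sub>R u) = r *\<^sub>R f u"
  by (auto simp: lin_on_def)

lemma linear_coord: "fin_basis B \<Longrightarrow> linear (\<lambda>v. representation B v b)"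
  by (rule linearI) (auto simp: fin_basis_coords)

text \<open>The elementary tensor of the \<open>i\<close>-th basis vector of \<open>W\<close> and \<open>v\<close>.\<close>

definition wsingle :: "'k \<Rightarrow> 'b \<Rightarrow> ('k \<Rightarrow> 'b::zero)"
  where "wsingle i v = (\<lambda>j. if j = i then v else 0)"

lemma wsingle_expand: "\<tau> = (\<Sum>i\<in>UNIV. wsingle i (\<tau> i))" for \<tau> :: "'k::finite \<Rightarrow> 'b::comm_monoid_add"
proof
  fix j
  have "(\<Sum>i\<in>I. wsingle i (\<tau> i)) j = (\<Sum>i\<in>I. wsingle i (\<tau> i) j)" for I :: "'k set"
    by (induction I rule: infinite_finite_induct) auto
  then show "\<tau> j = (\<Sum>i\<in>UNIV. wsingle i (\<tau> i)) j" by (simp add: wsingle_def)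
qed

lemma wsingle_scaleR: "wsingle i (r *\<^sub>R v) = r *\<^sub>R wsingle i v"
  by (auto simp: wsingle_def scaleR_fun_def fun_eq_iff)

lemma wsingle_add: "wsingle i (v + w) = wsingle i v + (wsingle i w :: 'k \<Rightarrow> 'b::real_vector)"
  by (auto simp: wsingle_def fun_eq_iff)

section \<open>The gauge tensor in a chart\<close>

context gauge_atlas
begin

lemma chart_log_Ck: "c \<in> A \<Longrightarrow> Ck_on k (\<lambda>(a, b). chart_log c a b) (coord_domain D c c)"
  using chart_log_smooth unfolding smooth_on_def by blast

lemma chart_par_Ck: "c \<in> A \<Longrightarrow> Ck_on k (\<lambda>(a, b). chart_par c a b e) (coord_domain D c c)"
  using chart_par_smooth unfolding smooth_on_def by blast

lemma chart_estimates:
  assumes "fin_basis B" "c \<in> A" "a0 \<in> cimage c"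
  shows "\<exists>r>0. \<exists>C\<ge>0. ball a0 r \<times> ball a0 r \<subseteq> coord_domain D c c \<and> (\<forall>a\<in>ball a0 r. \<forall>b\<in>ball a0 r. \<forall>c'\<in>ball a0 r.
    norm (chart_log c a c' - chart_log c a b - (c' - b)) \<le> C * (norm (c' - b) * (norm (c' - b) + norm (b - a))) \<and>
    (\<forall>e. norm (chart_par c b a e - e) \<le> C * (norm (b - a) * norm e)) \<and>
    (\<forall>v w. norm (chart_tensor B (chart_log c) (chart_par c) a v w) \<le> C * (norm v * norm w)) \<and>
    (\<forall>v w. norm (chart_tensor B (chart_log c) (chart_par c) a v w - chart_tensor B (chart_log c) (chart_par c) b v w)
      \<le> C * (norm (a - b) * norm v * norm w)) \<and>
    norm (chart_par c b a (chart_log c a c' - chart_log c a b) - chart_log c b c'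
        - chart_tensor B (chart_log c) (chart_par c) b (a - b) (c' - b))
      \<le> C * (norm (a - b) * norm (c' - b) * (norm (a - b) + norm (c' - b))))"
proof (rule gauge_chart_estimates[OF assms(1) open_coord_domain[OF assms(2)] diag_coord_domain[OF assms(3)]
    chart_log_smooth[OF assms(2)] chart_par_smooth[OF assms(2)] chart_log_diag])
  fix a e assume "(a, a) \<in> coord_domain D c c"
  then have a: "a \<in> cimage c" by (simp add: coord_domain_def)
  show "frechet_derivative (\<lambda>(a, b). chart_log c a b) (at (a, a)) (0, e) = e"
    by (rule chart_log_deriv_diag[OF assms(2) a])
  show "chart_par c a a e = e" by (rule chart_par_diag[OF assms(2) a])
next
  fix a b assume "(a, b) \<in> coord_domain D c c"
  then show "linear (chart_par c a b)" by (rule chart_par_linear[OF assms(2)])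
qed

lemma chart_tensor_linear:
  assumes "fin_basis B" "c \<in> A" "a \<in> cimage c"
  shows "linear (chart_tensor B (chart_log c) (chart_par c) a v)"
    and "linear (\<lambda>v. chart_tensor B (chart_log c) (chart_par c) a v w)"
proof -
  show "linear (chart_tensor B (chart_log c) (chart_par c) a v)"
    by (rule linearI) (simp_all add: chart_tensor_def fin_basis_coords[OF assms(1)] scaleR_add_left
      sum.distrib scaleR_sum_right)
  have aa: "(a, a) \<in> coord_domain D c c" using assms(3) by (rule diag_coord_domain)
  have "linear (\<lambda>v. frechet_derivative (\<lambda>p. frechet_derivative (\<lambda>(a, b). chart_log c a b) (at p) (0, b)) (at (a, a)) (v, 0))" for b
    using chart_log_Ck[OF assms(2), of "Suc (Suc 0)"]
    by (intro has_derivative_linear[OF has_derivative_first_arg[OF _ aa]]) (simp only: Ck_on.simps(2), blast)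
  moreover have "linear (\<lambda>v. frechet_derivative (\<lambda>(a, b'). chart_par c a b' b) (at (a, a)) (v, 0))" for b
    by (rule has_derivative_linear[OF has_derivative_first_arg[OF chart_par_Ck[OF assms(2)] aa]])
  ultimately show "linear (\<lambda>v. chart_tensor B (chart_log c) (chart_par c) a v w)"
    unfolding chart_tensor_def by (intro linear_compose_sum ballI linear_compose_scale_right linear_compose_sub)
qed

text \<open>The inverse of the parallelism is differentiated through the fixed point equation
  \<open>Q = F - (u - I) Q\<close>, where \<open>u - I\<close> vanishes at the base point.\<close>

lemma gauge_tensor_eq:
  assumes B: "fin_basis B" and c: "c \<in> A" "m \<in> fst c"
    and v: "v \<in> tangent_space A m" and w: "w \<in> tangent_space A m"
  shows "gauge_tensor A \<psi> U m v w
    = tangent_of A c m (chart_tensor B (chart_log c) (chart_par c) (snd c m) (v c) (w c))"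
proof -
  let ?N = "coord_domain D c c" and ?\<Psi> = "\<lambda>(a, b). chart_log c a b" and ?u = "chart_par c"
  define a where "a = snd c m"
  have a: "a \<in> cimage c" using c by (simp add: a_def)
  then have aa: "(a, a) \<in> ?N" by (rule diag_coord_domain)
  obtain r C where r: "r > 0" "C \<ge> 0" "ball a r \<times> ball a r \<subseteq> ?N"
    and E2: "\<And>x y e. x \<in> ball a r \<Longrightarrow> y \<in> ball a r \<Longrightarrow> norm (?u y x e - e) \<le> C * (norm (y - x) * norm e)"
    using chart_estimates[OF B c(1) a] by blast
  \<comment> \<open>The radius makes \<open>C * norm (x - a)\<close> at most 1/2, which keeps the
    parallelism within half of the identity.\<close>
  define r' where "r' = min r (1 / (2 * (C + 1)))"
  have r': "r' > 0" "r' \<le> r" using r by (auto simp: r'_def)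
  have near: "norm (?u x a e - e) \<le> C * norm (x - a) * norm e" "norm (?u x a e - e) \<le> norm e / 2"
    if x: "x \<in> ball a r'" for x e
  proof -
    have xr: "x \<in> ball a r" "a \<in> ball a r" using x r' r by auto
    show 1: "norm (?u x a e - e) \<le> C * norm (x - a) * norm e" using E2[OF xr(2,1), of e] by (simp add: mult.assoc)
    have "C * norm (x - a) \<le> C * (1 / (2 * (C + 1)))"
      using x r(2) by (intro mult_left_mono) (auto simp: r'_def dist_norm norm_minus_commute)
    also have "\<dots> \<le> 1 / 2" using r(2) by (simp add: field_simps)
    finally have "C * norm (x - a) * norm e \<le> 1 / 2 * norm e" by (intro mult_right_mono) auto
    then show "norm (?u x a e - e) \<le> norm e / 2" using 1 by simp
  qed
  have inN: "(x, a) \<in> ?N" if "x \<in> ball a r'" for x using that r(1,3) r' by auto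
  define F where "F x = frechet_derivative ?\<Psi> (at (x, a)) (0, w c)" for x
  define q where "q n = inv_into (tangent_space A m) (U n m) (log_parallelism A \<psi> n m w)" for n
  define W where "W = {n \<in> fst c. snd c n \<in> ball a r'}"
  have W: "open W" "m \<in> W" unfolding W_def using open_cinv_image[OF c(1) open_ball, of a r'] c(2) r' by (simp_all add: a_def)
  have q: "q n \<in> tangent_space A m \<and> ?u (snd c n) a (q n c) = F (snd c n)" if n: "n \<in> W" for n
  proof -
    have n: "n \<in> fst c" "snd c n \<in> ball a r'" using n by (auto simp: W_def)
    have nD: "(n, m) \<in> D" using inN[OF n(2)] coord_domain_iff[OF c(1) n(1) c(2)] by (simp add: a_def)
    have z: "log_parallelism A \<psi> n m w = tangent_of A c n (F (snd c n))"
      unfolding F_def a_def by (rule log_parallelism_eq[OF c n(1) nD w])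
    \<comment> \<open>Without a preimage \<open>inv_into\<close> would return an unspecified value;
      surjectivity in the chart provides one in the tangent space at \<open>m\<close>.\<close>
    have "surj (?u (snd c n) a)"
      by (rule linear_near_identity_surj[OF B chart_par_linear[OF c(1) inN[OF n(2)]] near(2)[OF n(2)]])
    then obtain e where e: "F (snd c n) = ?u (snd c n) a e" by (rule surjE)
    have "U n m (tangent_of A c m e) = log_parallelism A \<psi> n m w"
      unfolding z e a_def by (rule U_eq[OF c n(1) nD])
    then have img: "log_parallelism A \<psi> n m w \<in> U n m ` tangent_space A m"
      using tangent_of_in[OF c, of e] by (metis imageI)
    have qT: "q n \<in> tangent_space A m" unfolding q_def by (rule inv_into_into[OF img])
    have "U n m (q n) = log_parallelism A \<psi> n m w" unfolding q_def by (rule f_inv_into_f[OF img])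
    then have "tangent_of A c n (?u (snd c n) (snd c m) (q n c)) c = tangent_of A c n (F (snd c n)) c"
      using U_eq[OF c n(1) nD, of "q n c"] tangent_of_coords[OF c qT] z by simp
    then show ?thesis using qT c n by (simp add: a_def)
  qed
  define Q where "Q x = q (cinv c x) c" for x
  have uQ: "?u x a (Q x) = F x" if "x \<in> ball a r'" for x
  proof -
    have "x \<in> cimage c" using inN[OF that] by (auto simp: coord_domain_def)
    then show ?thesis using q[of "cinv c x"] that c by (simp add: W_def Q_def)
  qed
  have fin: "finite B" using B by (simp add: fin_basis_def)
  have DF: "(F has_derivative (\<lambda>v. \<Sum>b\<in>B. representation B (w c) b *\<^sub>R
      frechet_derivative (\<lambda>p. frechet_derivative ?\<Psi> (at p) (0, b)) (at (a, a)) (v, 0))) (at a)"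
  proof (rule has_derivative_transform_nhds)
    show "((\<lambda>x. \<Sum>b\<in>B. representation B (w c) b *\<^sub>R frechet_derivative ?\<Psi> (at (x, a)) (0, b)) has_derivative
      (\<lambda>v. \<Sum>b\<in>B. representation B (w c) b *\<^sub>R
        frechet_derivative (\<lambda>p. frechet_derivative ?\<Psi> (at p) (0, b)) (at (a, a)) (v, 0))) (at a)"
    proof (intro has_derivative_sum has_derivative_scaleR_right)
      fix b
      have "Ck_on (Suc 0) (\<lambda>p. frechet_derivative ?\<Psi> (at p) (0, b)) ?N"
        using chart_log_Ck[OF c(1), of "Suc (Suc 0)"] by (simp only: Ck_on.simps(2), blast)
      from has_derivative_first_arg[OF this aa]
      show "((\<lambda>x. frechet_derivative ?\<Psi> (at (x, a)) (0, b)) has_derivative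
        (\<lambda>v. frechet_derivative (\<lambda>p. frechet_derivative ?\<Psi> (at p) (0, b)) (at (a, a)) (v, 0))) (at a)" .
    qed
    have "\<forall>\<^sub>F x in nhds a. x \<in> ball a r'" using r' by (intro eventually_nhds_in_open) auto
    then show "\<forall>\<^sub>F x in nhds a. (\<Sum>b\<in>B. representation B (w c) b *\<^sub>R frechet_derivative ?\<Psi> (at (x, a)) (0, b)) = F x"
    proof eventually_elim
      case (elim x)
      have "linear (\<lambda>w. frechet_derivative ?\<Psi> (at (x, a)) (0, w))"
        by (rule has_derivative_linear[OF chart_log_has_derivative[OF c(1) inN[OF elim]]])
      then show ?case unfolding F_def by (rule fin_basis_linear_expand[OF B, of _ "w c", symmetric])
    qed
  qed
  have Fcont: "isCont F a" using DF by (rule has_derivative_continuous)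
  have Fa: "F a = w c" unfolding F_def by (rule chart_log_deriv_diag[OF c(1) a])
  \<comment> \<open>By absorption \<open>norm (Q x)\<close> is at most twice
    \<open>norm (F x)\<close>, and \<open>Q x - F x\<close> carries the factor
    \<open>norm (x - a)\<close>. This yields the continuity of \<open>Q\<close> at \<open>a\<close>
    that has to precede its differentiability.\<close>
  have Qb: "norm (Q x - F x) \<le> C * norm (x - a) * (2 * norm (F x))" if x: "x \<in> ball a r'" for x
  proof -
    have 1: "norm (F x - Q x) \<le> C * norm (x - a) * norm (Q x)" "norm (F x - Q x) \<le> norm (Q x) / 2"
      using near[OF x, of "Q x"] uQ[OF x] by auto
    have "norm (Q x) \<le> norm (F x) + norm (F x - Q x)" using norm_triangle_ineq4[of "F x" "F x - Q x"] by simp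
    then have "norm (Q x) \<le> 2 * norm (F x)" using 1(2) by linarith
    then have "C * norm (x - a) * norm (Q x) \<le> C * norm (x - a) * (2 * norm (F x))"
      using r(2) by (intro mult_left_mono) auto
    then show ?thesis using 1(1) by (simp add: norm_minus_commute)
  qed
  have Qa: "Q a = F a" using Qb[of a] r' by simp
  have Qcont: "isCont Q a"
  proof -
    have "((\<lambda>x. Q x - F x) \<longlongrightarrow> 0) (at a)"
    proof (rule Lim_null_comparison)
      have "((\<lambda>x. C * norm (x - a) * (2 * norm (F x))) \<longlongrightarrow> C * norm (a - a) * (2 * norm (F a))) (at a)"
        by (intro tendsto_intros isContD[OF Fcont])
      then show "((\<lambda>x. C * norm (x - a) * (2 * norm (F x))) \<longlongrightarrow> 0) (at a)" by simp
      have "\<forall>\<^sub>F x in at a. x \<in> ball a r'" using r' by (intro eventually_at_in_open') auto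
      then show "\<forall>\<^sub>F x in at a. norm (Q x - F x) \<le> C * norm (x - a) * (2 * norm (F x))"
        by eventually_elim (rule Qb)
    qed
    from tendsto_add[OF this isContD[OF Fcont]] show ?thesis by (simp add: isCont_def Qa)
  qed
  let ?Q' = "\<lambda>v. (\<Sum>b\<in>B. representation B (w c) b *\<^sub>R
      frechet_derivative (\<lambda>p. frechet_derivative ?\<Psi> (at p) (0, b)) (at (a, a)) (v, 0))
    - (\<Sum>b\<in>B. representation B (w c) b *\<^sub>R frechet_derivative (\<lambda>(a, b'). ?u a b' b) (at (a, a)) (v, 0))"
  \<comment> \<open>The fixed point equation is written in the basis: each summand is a continuous
    coordinate of \<open>Q\<close> times a function that vanishes at \<open>a\<close>, as
    \<open>has_derivative_scaleR_vanishing\<close> demands.\<close>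
  have DQ: "(Q has_derivative ?Q') (at a)"
  proof (rule has_derivative_transform_nhds)
    show "((\<lambda>x. F x - (\<Sum>b\<in>B. representation B (Q x) b *\<^sub>R (?u x a b - b))) has_derivative ?Q') (at a)"
    proof (intro has_derivative_diff DF has_derivative_sum)
      fix b
      have "isCont (\<lambda>x. representation B (Q x) b) a"
        by (rule bounded_linear.isCont[OF fin_basis_bounded_linear[OF B linear_coord[OF B]] Qcont])
      moreover have "((\<lambda>x. ?u x a b - b) has_derivative (\<lambda>v. frechet_derivative (\<lambda>(a, b'). ?u a b' b) (at (a, a)) (v, 0) - 0)) (at a)"
        using has_derivative_first_arg[OF chart_par_Ck[OF c(1), of "Suc 0" b] aa]
        by (intro has_derivative_diff has_derivative_const) simp
      moreover have "?u a a b - b = 0" using chart_par_diag[OF c(1) a] by simp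
      ultimately show "((\<lambda>x. representation B (Q x) b *\<^sub>R (?u x a b - b)) has_derivative
          (\<lambda>v. representation B (w c) b *\<^sub>R frechet_derivative (\<lambda>(a, b'). ?u a b' b) (at (a, a)) (v, 0))) (at a)"
        using has_derivative_scaleR_vanishing[of a "\<lambda>x. representation B (Q x) b" "\<lambda>x. ?u x a b - b"] Qa Fa by simp
    qed
    have "\<forall>\<^sub>F x in nhds a. x \<in> ball a r'" using r' by (intro eventually_nhds_in_open) auto
    then show "\<forall>\<^sub>F x in nhds a. F x - (\<Sum>b\<in>B. representation B (Q x) b *\<^sub>R (?u x a b - b)) = Q x"
    proof eventually_elim
      case (elim x)
      have "linear (\<lambda>e. ?u x a e - e)"
        by (intro linear_compose_sub chart_par_linear[OF c(1) inN[OF elim]] linear_ident)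
      from fin_basis_linear_expand[OF B this, of "Q x"]
      have "?u x a (Q x) - Q x = (\<Sum>b\<in>B. representation B (Q x) b *\<^sub>R (?u x a b - b))" .
      then show ?case using uQ[OF elim] by (simp add: algebra_simps)
    qed
  qed
  have "dir_deriv A m v q = tangent_of A c m (?Q' (v c))"
  proof (rule dir_deriv_eq[OF c c v W])
    show "q n \<in> tangent_space A m" if "n \<in> W" for n using q[OF that] by blast
    show "((\<lambda>x. q (cinv c x) c) has_derivative ?Q') (at (snd c m))"
      using DQ by (simp add: Q_def[abs_def] a_def)
  qed
  moreover have "?Q' (v c) = chart_tensor B (chart_log c) (chart_par c) (snd c m) (v c) (w c)"
    by (simp add: chart_tensor_def a_def sum_subtractf scaleR_diff_right)
  ultimately show ?thesis by (simp add: gauge_tensor_def compat_tensor_def q_def[abs_def])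
qed

end

section \<open>Riemannian norms\<close>

locale riemannian_atlas = smooth_atlas A
  for A :: "('m::{t2_space, second_countable_topology}, 'e::real_normed_vector) chart set" +
  fixes g :: "'m \<Rightarrow> ('m, 'e) tvec \<Rightarrow> ('m, 'e) tvec \<Rightarrow> real"
  assumes metric: "riemannian_metric A g"
begin

lemma g_lin: "u \<in> tangent_space A m \<Longrightarrow> lin_on (tangent_space A m) (g m u)"
  and g_sym: "u \<in> tangent_space A m \<Longrightarrow> v \<in> tangent_space A m \<Longrightarrow> g m u v = g m v u"
  and g_pos: "u \<in> tangent_space A m \<Longrightarrow> u \<noteq> 0 \<Longrightarrow> g m u u > 0"
  and g_smooth: "c \<in> A \<Longrightarrow> smooth_on
    (\<lambda>x. g (cinv c x) (tangent_of A c (cinv c x) e) (tangent_of A c (cinv c x) e')) (cimage c)"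
  using metric by (simp_all add: riemannian_metric_def)

lemma g_scaleR:
  assumes "u \<in> tangent_space A m"
  shows "g m (r *\<^sub>R u) (r *\<^sub>R u) = r\<^sup>2 * g m u u"
proof -
  have ru: "r *\<^sub>R u \<in> tangent_space A m" using subspace_scale[OF subspace_tangent_space assms] .
  have "g m (r *\<^sub>R u) (r *\<^sub>R u) = r * g m (r *\<^sub>R u) u" using lin_on_scaleR[OF g_lin[OF ru] assms] by simp
  also have "g m (r *\<^sub>R u) u = r * g m u u"
    using g_sym[OF ru assms] lin_on_scaleR[OF g_lin[OF assms] assms] by simp
  finally show ?thesis by (simp add: power2_eq_square)
qed

lemma g_zero: "g m 0 0 = 0"
  using g_scaleR[OF subspace_0[OF subspace_tangent_space], of m 0] by simp

lemma g_nonneg: "u \<in> tangent_space A m \<Longrightarrow> 0 \<le> g m u u"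
  using g_pos[of u m] g_zero[of m] by (cases "u = 0") auto

lemma gnorm_nonneg: "u \<in> tangent_space A m \<Longrightarrow> 0 \<le> gnorm g m u"
  by (simp add: gnorm_def g_nonneg)

lemma gnorm_scaleR: "u \<in> tangent_space A m \<Longrightarrow> gnorm g m (r *\<^sub>R u) = \<bar>r\<bar> * gnorm g m u"
  by (simp add: gnorm_def g_scaleR real_sqrt_mult)

text \<open>The metric is given as linear in its second slot; symmetry transfers the expansion to
  the first.\<close>

lemma g_expand:
  assumes B: "fin_basis B" and c: "c \<in> A" "m \<in> fst c"
  shows "g m (tangent_of A c m e) (tangent_of A c m e')
    = (\<Sum>i\<in>B. \<Sum>j\<in>B. representation B e i * representation B e' j * g m (tangent_of A c m i) (tangent_of A c m j))"
proof -
  note T = tangent_of_in[OF c]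
  have fin: "finite B" using B by (simp add: fin_basis_def)
  have ex: "tangent_of A c m e = (\<Sum>i\<in>B. representation B e i *\<^sub>R tangent_of A c m i)" for e
    by (rule fin_basis_linear_expand[OF B linear_tangent_of[OF c]])
  have sub: "r *\<^sub>R tangent_of A c m i \<in> tangent_space A m" for r i
    by (rule subspace_scale[OF subspace_tangent_space T])
  have right: "g m u (tangent_of A c m e') = (\<Sum>j\<in>B. representation B e' j * g m u (tangent_of A c m j))"
    if "u \<in> tangent_space A m" for u e'
    unfolding ex[of e'] lin_on_sum[OF g_lin[OF that] subspace_tangent_space fin sub] lin_on_scaleR[OF g_lin[OF that] T]
    by simp
  have "g m (tangent_of A c m e) (tangent_of A c m e')
    = (\<Sum>j\<in>B. representation B e' j * g m (tangent_of A c m e) (tangent_of A c m j))"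
    by (rule right[OF T])
  also have "\<dots> = (\<Sum>j\<in>B. representation B e' j * g m (tangent_of A c m j) (tangent_of A c m e))"
    by (intro sum.cong refl arg_cong2[where f = times] g_sym T)
  also have "\<dots> = (\<Sum>j\<in>B. representation B e' j * (\<Sum>i\<in>B. representation B e i * g m (tangent_of A c m j) (tangent_of A c m i)))"
    by (intro sum.cong refl arg_cong2[where f = times] right T)
  also have "\<dots> = (\<Sum>j\<in>B. \<Sum>i\<in>B. representation B e i * representation B e' j * g m (tangent_of A c m i) (tangent_of A c m j))"
    unfolding sum_distrib_left by (intro sum.cong refl, subst g_sym[OF T T]) simp
  finally show ?thesis by (subst sum.swap)
qed

text \<open>The Gram matrix of the metric in the chart is positive definite at \<open>a0\<close>,
  hence coercive, and its entries are continuous. Near \<open>a0\<close> the quadratic form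
  therefore deviates by at most half of its value at \<open>a0\<close>, which gives both
  inequalities with one constant on a whole ball.\<close>

lemma gnorm_locally_equivalent:
  assumes c: "c \<in> A" "a0 \<in> cimage c"
  shows "\<exists>r>0. \<exists>\<kappa>>0. ball a0 r \<subseteq> cimage c \<and> (\<forall>a\<in>ball a0 r. \<forall>e.
    norm e \<le> \<kappa> * gnorm g (cinv c a) (tangent_of A c (cinv c a) e) \<and>
    gnorm g (cinv c a) (tangent_of A c (cinv c a) e) \<le> \<kappa> * norm e)"
proof -
  obtain B :: "'e set" where B: "fin_basis B" using model_fin_basis by blast
  then have fin: "finite B" by (simp add: fin_basis_def)
  let ?t = "\<lambda>a. tangent_of A c (cinv c a)"
  define G where "G a i j = g (cinv c a) (?t a i) (?t a j)" for a i j
  define P where "P a e = g (cinv c a) (?t a e) (?t a e)" for a e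
  have P: "P a e = (\<Sum>i\<in>B. \<Sum>j\<in>B. representation B e i * representation B e j * G a i j)" if "a \<in> cimage c" for a e
    unfolding P_def G_def by (rule g_expand[OF B c(1) cinv_in[OF c(1) that]])
  obtain K where K: "K > 0" "\<And>v b. \<bar>representation B v b\<bar> \<le> K * norm v" using fin_basis_coord_bound[OF B] by blast
  have rep_sum: "representation B (\<Sum>b\<in>B. f b *\<^sub>R b) i = f i" if "i \<in> B" for f i
  proof -
    have "representation B (\<Sum>b\<in>B. f b *\<^sub>R b) i = (\<Sum>b\<in>B. f b * representation B b i)"
      using linear_sum[OF linear_coord[OF B, of i], of "\<lambda>b. f b *\<^sub>R b" B] by (simp add: fin_basis_coords[OF B])
    also have "\<dots> = (\<Sum>b\<in>B. if b = i then f b else 0)"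
      using B representation_basis[of B] by (intro sum.cong) (auto simp: fin_basis_def)
    finally show ?thesis using fin that by simp
  qed
  have "\<exists>l>0. \<forall>v b. l * (representation B v b)\<^sup>2 \<le> P a0 v"
  proof (rule pos_quadratic_coercive[OF B])
    have "P a0 (\<Sum>b\<in>B. f b *\<^sub>R b) = (\<Sum>i\<in>B. \<Sum>j\<in>B. f i * f j * G a0 i j)" for f
      unfolding P[OF c(2)] by (intro sum.cong) (auto simp: rep_sum)
    then show "continuous_on UNIV (\<lambda>f. P a0 (\<Sum>b\<in>B. f b *\<^sub>R b))"
      by simp (intro continuous_intros continuous_on_product_coordinates)
    show "P a0 v > 0" if "v \<noteq> 0" for v
    proof -
      have "?t a0 v c = v" using c by simp
      then have "?t a0 v \<noteq> 0" using that by auto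
      then show ?thesis unfolding P_def using c by (intro g_pos tangent_of_in) auto
    qed
    show "P a0 (r *\<^sub>R v) = r\<^sup>2 * P a0 v" for r v
      unfolding P_def using c linear_scale[OF linear_tangent_of[OF c(1) cinv_in[OF c]]]
      by (simp add: g_scaleR tangent_of_in)
  qed
  then obtain l where l: "l > 0" "\<And>v b. l * (representation B v b)\<^sup>2 \<le> P a0 v" by blast
  have P0: "0 \<le> P a0 v" for v unfolding P_def using c by (intro g_nonneg tangent_of_in) auto
  have rep: "\<bar>representation B v b\<bar> \<le> sqrt (P a0 v / l)" for v b
    using l(2)[of v b] l(1) by (intro real_le_rsqrt) (simp add: field_simps)
  define n where "n = real (card B)"
  \<comment> \<open>The deviations of all \<open>n * n\<close> entries together then amount to at
    most \<open>P a0 e / 2\<close>; the summand 1 keeps the denominator positive in dimension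
    0.\<close>
  define \<epsilon> where "\<epsilon> = l / (2 * (n\<^sup>2 + 1))"
  have \<epsilon>: "\<epsilon> > 0" unfolding \<epsilon>_def using l(1) by (auto intro!: divide_pos_pos simp: add_pos_nonneg add_nonneg_pos)
  have "\<forall>\<^sub>F a in nhds a0. \<forall>i\<in>B. \<forall>j\<in>B. \<bar>G a i j - G a0 i j\<bar> < \<epsilon>"
  proof -
    have "\<forall>\<^sub>F a in nhds a0. \<bar>G a i j - G a0 i j\<bar> < \<epsilon>" for i j
    proof -
      have "Ck_on 0 (\<lambda>a. G a i j) (cimage c)" using g_smooth[OF c(1), of i j] unfolding smooth_on_def G_def by blast
      then have "isCont (\<lambda>a. G a i j) a0" using c chartD(2)[OF c(1)] by (simp add: continuous_on_eq_continuous_at)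
      then have "((\<lambda>a. G a i j) \<longlongrightarrow> G a0 i j) (nhds a0)"
        using tendsto_at_iff_tendsto_nhds[of "\<lambda>a. G a i j" a0] by (simp add: isCont_def)
      from tendstoD[OF this \<epsilon>] show ?thesis by (simp add: dist_real_def)
    qed
    then show ?thesis using fin by (simp add: eventually_ball_finite_distrib)
  qed
  then have "\<forall>\<^sub>F a in nhds a0. a \<in> cimage c \<and> (\<forall>i\<in>B. \<forall>j\<in>B. \<bar>G a i j - G a0 i j\<bar> < \<epsilon>)"
    using eventually_nhds_in_open[OF chartD(2)[OF c(1)] c(2)] by (rule eventually_conj[rotated])
  then obtain r where r: "r > 0" "\<And>a. dist a a0 < r \<Longrightarrow> a \<in> cimage c \<and> (\<forall>i\<in>B. \<forall>j\<in>B. \<bar>G a i j - G a0 i j\<bar> < \<epsilon>)"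
    unfolding eventually_nhds_metric by blast
  have close: "\<bar>P a e - P a0 e\<bar> \<le> P a0 e / 2" if a: "a \<in> ball a0 r" for a e
  proof -
    have ac: "a \<in> cimage c" "\<And>i j. i \<in> B \<Longrightarrow> j \<in> B \<Longrightarrow> \<bar>G a i j - G a0 i j\<bar> < \<epsilon>"
      using r(2)[of a] a by (auto simp: dist_commute)
    have d1: "P a e - P a0 e = (\<Sum>i\<in>B. \<Sum>j\<in>B. representation B e i * representation B e j * (G a i j - G a0 i j))"
      unfolding P[OF ac(1)] P[OF c(2)] by (simp add: sum_subtractf right_diff_distrib)
    have d2: "norm (\<Sum>i\<in>B. \<Sum>j\<in>B. representation B e i * representation B e j * (G a i j - G a0 i j))
      \<le> (\<Sum>i\<in>B. \<Sum>j\<in>B. P a0 e / l * \<epsilon>)"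
    proof (intro sum_norm_le)
      fix i j assume ij: "i \<in> B" "j \<in> B"
      have "\<bar>representation B e i\<bar> * \<bar>representation B e j\<bar> \<le> sqrt (P a0 e / l) * sqrt (P a0 e / l)"
        using rep P0[of e] l(1) by (intro mult_mono) auto
      also have "\<dots> = P a0 e / l" using P0[of e] l(1) by simp
      finally have "\<bar>representation B e i\<bar> * \<bar>representation B e j\<bar> * \<bar>G a i j - G a0 i j\<bar> \<le> P a0 e / l * \<epsilon>"
        using ac(2)[OF ij] P0[of e] l(1) by (intro mult_mono) auto
      then show "norm (representation B e i * representation B e j * (G a i j - G a0 i j)) \<le> P a0 e / l * \<epsilon>"
        by (simp only: real_norm_def abs_mult)
    qed
    have d3: "(\<Sum>i\<in>B. \<Sum>j\<in>B. P a0 e / l * \<epsilon>) = n\<^sup>2 / (2 * (n\<^sup>2 + 1)) * P a0 e"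
      using l(1) by (simp add: n_def \<epsilon>_def power2_eq_square)
    have d4: "n\<^sup>2 / (2 * (n\<^sup>2 + 1)) * P a0 e \<le> 1 / 2 * P a0 e"
    proof (rule mult_right_mono)
      have "0 < n\<^sup>2 + 1" by (rule add_nonneg_pos[OF zero_le_power2 zero_less_one])
      then have "0 < 2 * (n\<^sup>2 + 1)" by (intro mult_pos_pos) auto
      then show "n\<^sup>2 / (2 * (n\<^sup>2 + 1)) \<le> 1 / 2" by (simp add: pos_divide_le_eq)
    qed (rule P0)
    show ?thesis using d2 d4 unfolding d1 d3 real_norm_def by linarith
  qed
  define \<kappa>1 where "\<kappa>1 = (\<Sum>b\<in>B. norm b) * sqrt (2 / l)"
  define \<kappa>2 where "\<kappa>2 = sqrt (2 * (\<Sum>i\<in>B. \<Sum>j\<in>B. K * K * \<bar>G a0 i j\<bar>))"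
  have k0: "\<kappa>1 \<ge> 0" "\<kappa>2 \<ge> 0" unfolding \<kappa>1_def \<kappa>2_def using l K(1)
    by (auto intro!: mult_nonneg_nonneg sum_nonneg)
  have lower: "norm e \<le> \<kappa>1 * sqrt (P a e)" if a: "a \<in> ball a0 r" for a e
  proof -
    have "P a0 e \<le> 2 * P a e" using close[OF a, of e] by linarith
    then have le: "P a0 e / l \<le> 2 / l * P a e" using l(1) by (simp add: divide_right_mono)
    have "norm e \<le> (\<Sum>b\<in>B. norm (representation B e b *\<^sub>R b))"
      using norm_sum[of "\<lambda>b. representation B e b *\<^sub>R b" B] fin_basis_coords(1)[OF B, of e] by simp
    also have "\<dots> \<le> (\<Sum>b\<in>B. sqrt (2 / l * P a e) * norm b)"
    proof (rule sum_mono)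
      fix b
      have "\<bar>representation B e b\<bar> \<le> sqrt (2 / l * P a e)" using rep[of e b] real_sqrt_le_mono[OF le] by linarith
      then show "norm (representation B e b *\<^sub>R b) \<le> sqrt (2 / l * P a e) * norm b" by (simp add: mult_right_mono)
    qed
    also have "\<dots> = \<kappa>1 * sqrt (P a e)"
      unfolding \<kappa>1_def sum_distrib_left[symmetric] real_sqrt_mult by (simp only: mult_ac)
    finally show ?thesis .
  qed
  have upper: "sqrt (P a e) \<le> \<kappa>2 * norm e" if a: "a \<in> ball a0 r" for a e
  proof -
    have "norm (\<Sum>i\<in>B. \<Sum>j\<in>B. representation B e i * representation B e j * G a0 i j)
      \<le> (\<Sum>i\<in>B. \<Sum>j\<in>B. K * K * \<bar>G a0 i j\<bar> * (norm e)\<^sup>2)"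
    proof (intro sum_norm_le)
      fix i j
      have "\<bar>representation B e i\<bar> * \<bar>representation B e j\<bar> \<le> (K * norm e) * (K * norm e)"
        using K by (intro mult_mono) auto
      then have "\<bar>representation B e i\<bar> * \<bar>representation B e j\<bar> * \<bar>G a0 i j\<bar> \<le> (K * norm e) * (K * norm e) * \<bar>G a0 i j\<bar>"
        by (rule mult_right_mono) simp
      then show "norm (representation B e i * representation B e j * G a0 i j) \<le> K * K * \<bar>G a0 i j\<bar> * (norm e)\<^sup>2"
        by (simp add: abs_mult power2_eq_square mult_ac)
    qed
    then have "P a0 e \<le> (\<Sum>i\<in>B. \<Sum>j\<in>B. K * K * \<bar>G a0 i j\<bar> * (norm e)\<^sup>2)"
      unfolding P[OF c(2)] real_norm_def by linarith
    moreover have "P a e \<le> 2 * P a0 e" using close[OF a, of e] P0[of e] by linarith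
    ultimately have "P a e \<le> 2 * (\<Sum>i\<in>B. \<Sum>j\<in>B. K * K * \<bar>G a0 i j\<bar>) * (norm e)\<^sup>2"
      unfolding sum_distrib_right[symmetric] by linarith
    from real_sqrt_le_mono[OF this] show ?thesis unfolding \<kappa>2_def by (simp add: real_sqrt_mult)
  qed
  define \<kappa> where "\<kappa> = \<kappa>1 + \<kappa>2 + 1"
  have \<kappa>: "\<kappa> > 0" "\<kappa>1 \<le> \<kappa>" "\<kappa>2 \<le> \<kappa>" using k0 by (auto simp: \<kappa>_def)
  have gP: "gnorm g (cinv c a) (?t a e) = sqrt (P a e)" for a e by (simp add: gnorm_def P_def)
  show ?thesis
  proof (intro exI conjI ballI allI)
    show "r > 0" "\<kappa> > 0" by fact+
    show "ball a0 r \<subseteq> cimage c" using r(2) by (auto simp: dist_commute)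
    fix a e assume a: "a \<in> ball a0 r"
    have Pa: "0 \<le> P a e" using close[OF a, of e] P0[of e] by linarith
    show "norm e \<le> \<kappa> * gnorm g (cinv c a) (?t a e)"
      unfolding gP using lower[OF a, of e] mult_right_mono[OF \<kappa>(2), of "sqrt (P a e)"] Pa by simp
    show "gnorm g (cinv c a) (?t a e) \<le> \<kappa> * norm e"
      unfolding gP using upper[OF a, of e] mult_right_mono[OF \<kappa>(3), of "norm e"] by simp
  qed
qed

lemma gnorm_equivalent_at:
  assumes c: "c \<in> A" "m \<in> fst c"
  obtains \<kappa> where "\<kappa> > 0" "\<And>v. v \<in> tangent_space A m \<Longrightarrow> norm (v c) \<le> \<kappa> * gnorm g m v"
    "\<And>v. v \<in> tangent_space A m \<Longrightarrow> gnorm g m v \<le> \<kappa> * norm (v c)"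
proof -
  obtain r \<kappa> where r: "r > 0" "\<kappa> > 0" and *: "\<And>a e. a \<in> ball (snd c m) r \<Longrightarrow>
    norm e \<le> \<kappa> * gnorm g (cinv c a) (tangent_of A c (cinv c a) e) \<and>
    gnorm g (cinv c a) (tangent_of A c (cinv c a) e) \<le> \<kappa> * norm e"
    using gnorm_locally_equivalent[OF c(1) chart_in_cimage[OF c(2)]] by blast
  show thesis
  proof
    show "\<kappa> > 0" by fact
    fix v assume v: "v \<in> tangent_space A m"
    show "norm (v c) \<le> \<kappa> * gnorm g m v" "gnorm g m v \<le> \<kappa> * norm (v c)"
      using *[of "snd c m" "v c"] r c by (simp_all add: tangent_of_coords[OF c v])
  qed
qed

lemma op_norm_into_tangent:
  fixes f :: "real ^ 'k \<Rightarrow> ('m, 'e) tvec"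
  assumes f: "linear f" "range f \<subseteq> tangent_space A m"
  shows "gnorm g m (f w) \<le> op_norm UNIV norm (gnorm g m) f * norm w"
proof -
  obtain c where c: "c \<in> A" "m \<in> fst c" using chart_at by blast
  obtain \<kappa> where \<kappa>: "\<kappa> > 0" "\<And>v. v \<in> tangent_space A m \<Longrightarrow> gnorm g m v \<le> \<kappa> * norm (v c)"
    using gnorm_equivalent_at[OF c] by metis
  have "linear (\<lambda>w. f w c)" using f(1) by (intro linearI) (auto simp: linear_add linear_scale plus_fun_def scaleR_fun_def)
  then have bl: "bounded_linear (\<lambda>w. f w c)" by (simp add: linear_conv_bounded_linear)
  show ?thesis
  proof (rule op_norm_bound[where K = "\<kappa> * onorm (\<lambda>w. f w c)"])
    show "gnorm g m (f (r *\<^sub>R v)) = \<bar>r\<bar> * gnorm g m (f v)" for r v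
      using f by (simp add: linear_scale gnorm_scaleR image_subset_iff)
    show "gnorm g m (f v) \<le> \<kappa> * onorm (\<lambda>w. f w c) * norm v" for v
    proof -
      have "gnorm g m (f v) \<le> \<kappa> * norm (f v c)" using f(2) by (intro \<kappa>(2)) auto
      also have "\<dots> \<le> \<kappa> * (onorm (\<lambda>w. f w c) * norm v)" using \<kappa>(1) onorm[OF bl] by (intro mult_left_mono) auto
      finally show ?thesis by (simp add: mult.assoc)
    qed
  qed auto
qed

text \<open>Supplies the a priori constant for \<open>op_norm_bound\<close>: read in a chart,
  \<open>f\<close> is a linear map on the finite-dimensional model space.\<close>

lemma lin_on_chart_bound:
  assumes c: "c \<in> A" "m \<in> fst c" and f: "lin_on (tangent_space A m) (f :: _ \<Rightarrow> 'v::real_normed_vector)"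
  shows "\<exists>K\<ge>0. \<forall>v\<in>tangent_space A m. norm (f v) \<le> K * gnorm g m v"
proof -
  obtain B :: "'e set" where B: "fin_basis B" using model_fin_basis by blast
  obtain \<kappa> where \<kappa>: "\<kappa> > 0" "\<And>v. v \<in> tangent_space A m \<Longrightarrow> norm (v c) \<le> \<kappa> * gnorm g m v"
    using gnorm_equivalent_at[OF c] by metis
  have lt: "linear (tangent_of A c m)" by (rule linear_tangent_of[OF c])
  have "linear (\<lambda>e. f (tangent_of A c m e))"
    by (rule linearI)
      (simp_all add: linear_add[OF lt] linear_scale[OF lt] lin_on_add[OF f tangent_of_in[OF c] tangent_of_in[OF c]]
        lin_on_scaleR[OF f tangent_of_in[OF c]])
  then have bl: "bounded_linear (\<lambda>e. f (tangent_of A c m e))" by (rule fin_basis_bounded_linear[OF B])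
  let ?K = "onorm (\<lambda>e. f (tangent_of A c m e))"
  have "norm (f v) \<le> ?K * \<kappa> * gnorm g m v" if v: "v \<in> tangent_space A m" for v
  proof -
    have "norm (f v) \<le> ?K * norm (v c)" using onorm[OF bl, of "v c"] tangent_of_coords[OF c v] by simp
    also have "\<dots> \<le> ?K * (\<kappa> * gnorm g m v)" by (intro mult_left_mono \<kappa>(2)[OF v] onorm_pos_le[OF bl])
    finally show ?thesis by (simp add: mult.assoc)
  qed
  moreover have "?K * \<kappa> \<ge> 0" using onorm_pos_le[OF bl] \<kappa>(1) by simp
  ultimately show ?thesis by blast
qed

lemma op_norm_on_tangent:
  assumes f: "lin_on (tangent_space A m) (f :: _ \<Rightarrow> 'v::real_normed_vector)" and v: "v \<in> tangent_space A m"
  shows "norm (f v) \<le> op_norm (tangent_space A m) (gnorm g m) norm f * gnorm g m v"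
proof -
  obtain c where c: "c \<in> A" "m \<in> fst c" using chart_at by blast
  obtain K where "\<And>v. v \<in> tangent_space A m \<Longrightarrow> norm (f v) \<le> K * gnorm g m v"
    using lin_on_chart_bound[OF c f] by blast
  then show ?thesis
    using v lin_on_scaleR[OF f]
    by (intro op_norm_bound[where K = K]) (auto simp: gnorm_scaleR gnorm_nonneg subspace_scale[OF subspace_tangent_space])
qed

lemma subspace_wtangent_space: "subspace (wtangent_space A m)"
  using subspace_tangent_space[of m]
  by (auto simp: wtangent_space_def subspace_def plus_fun_def scaleR_fun_def zero_fun_def)

lemma wsingle_in_wtangent: "v \<in> tangent_space A m \<Longrightarrow> wsingle i v \<in> wtangent_space A m"
  using subspace_0[OF subspace_tangent_space] by (auto simp: wsingle_def wtangent_space_def)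

lemma wgnorm_wsingle: "wgnorm g m (wsingle (i::'k::finite) v) = gnorm g m v"
proof -
  have "(\<Sum>j\<in>UNIV. g m (wsingle i v j) (wsingle i v j)) = (\<Sum>j\<in>UNIV. if j = i then g m v v else 0)"
    by (intro sum.cong) (auto simp: wsingle_def g_zero)
  then show ?thesis by (simp add: wgnorm_def gnorm_def)
qed

text \<open>The a priori constant comes from splitting \<open>\<tau>\<close> into the elementary
  tensors \<open>wsingle i (\<tau> i)\<close>; each of them is covered by the case of the tangent
  space, and the norm of a component never exceeds the Hilbert norm.\<close>

lemma op_norm_on_wtangent:
  fixes f :: "('k::finite \<Rightarrow> ('m, 'e) tvec) \<Rightarrow> 'v::real_normed_vector"
  assumes f: "lin_on (wtangent_space A m) f" and v: "\<tau> \<in> wtangent_space A m"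
  shows "norm (f \<tau>) \<le> op_norm (wtangent_space A m) (wgnorm g m) norm f * wgnorm g m \<tau>"
proof -
  obtain c where c: "c \<in> A" "m \<in> fst c" using chart_at by blast
  have "lin_on (tangent_space A m) (\<lambda>v. f (wsingle i v))" for i
    using lin_on_add[OF f wsingle_in_wtangent wsingle_in_wtangent] lin_on_scaleR[OF f wsingle_in_wtangent]
    by (auto simp: lin_on_def wsingle_add wsingle_scaleR)
  then have "\<forall>i. \<exists>K\<ge>0. \<forall>v\<in>tangent_space A m. norm (f (wsingle i v)) \<le> K * gnorm g m v"
    using lin_on_chart_bound[OF c] by blast
  then obtain K where K: "\<And>i. K i \<ge> 0" "\<And>i v. v \<in> tangent_space A m \<Longrightarrow> norm (f (wsingle i v)) \<le> K i * gnorm g m v"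
    by metis
  have bound: "norm (f \<tau>) \<le> (\<Sum>i\<in>UNIV. K i) * wgnorm g m \<tau>" if \<tau>: "\<tau> \<in> wtangent_space A m" for \<tau>
  proof -
    have \<tau>i: "\<tau> i \<in> tangent_space A m" for i using \<tau> by (simp add: wtangent_space_def)
    have "f \<tau> = f (\<Sum>i\<in>UNIV. wsingle i (\<tau> i))" by (rule arg_cong[OF wsingle_expand, of f])
    also have "\<dots> = (\<Sum>i\<in>UNIV. f (wsingle i (\<tau> i)))"
      by (rule lin_on_sum[OF f subspace_wtangent_space finite wsingle_in_wtangent[OF \<tau>i]])
    finally have "f \<tau> = (\<Sum>i\<in>UNIV. f (wsingle i (\<tau> i)))" .
    moreover have "norm (\<Sum>i\<in>UNIV. f (wsingle i (\<tau> i))) \<le> (\<Sum>i\<in>UNIV. K i * wgnorm g m \<tau>)"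
    proof (rule sum_norm_le)
      fix i
      have "g m (\<tau> i) (\<tau> i) \<le> (\<Sum>i\<in>UNIV. g m (\<tau> i) (\<tau> i))" by (intro member_le_sum) (auto intro: g_nonneg \<tau>i)
      then have "gnorm g m (\<tau> i) \<le> wgnorm g m \<tau>" by (simp add: gnorm_def wgnorm_def)
      from mult_left_mono[OF this K(1)[of i]] K(2)[OF \<tau>i[of i], of i]
      show "norm (f (wsingle i (\<tau> i))) \<le> K i * wgnorm g m \<tau>" by linarith
    qed
    ultimately show ?thesis by (simp add: sum_distrib_right)
  qed
  show ?thesis
  proof (rule op_norm_bound[where K = "\<Sum>i\<in>UNIV. K i"])
    fix r and \<tau> :: "'k \<Rightarrow> ('m, 'e) tvec" assume \<tau>: "\<tau> \<in> wtangent_space A m"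
    then have \<tau>i: "\<tau> i \<in> tangent_space A m" for i by (simp add: wtangent_space_def)
    show "r *\<^sub>R \<tau> \<in> wtangent_space A m" by (rule subspace_scale[OF subspace_wtangent_space \<tau>])
    have "(\<Sum>i\<in>UNIV. g m ((r *\<^sub>R \<tau>) i) ((r *\<^sub>R \<tau>) i)) = r\<^sup>2 * (\<Sum>i\<in>UNIV. g m (\<tau> i) (\<tau> i))"
      using g_scaleR[OF \<tau>i] by (simp add: scaleR_fun_def[of r \<tau>] sum_distrib_left)
    then show "wgnorm g m (r *\<^sub>R \<tau>) = \<bar>r\<bar> * wgnorm g m \<tau>" by (simp add: wgnorm_def real_sqrt_mult)
    show "norm (f (r *\<^sub>R \<tau>)) = \<bar>r\<bar> * norm (f \<tau>)" using lin_on_scaleR[OF f \<tau>] by simp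
    show "0 \<le> wgnorm g m \<tau>" by (simp add: wgnorm_def sum_nonneg g_nonneg \<tau>i)
  qed (use bound v in auto)
qed

end

section \<open>Controlled data on a manifold\<close>

text \<open>\<open>n > 0\<close> matters at \<open>w = 0\<close>: there \<open>0 powr 0\<close> is
  0, whereas a zeroth power is 1.\<close>

lemma powr_root_power:
  assumes "0 \<le> (w::real)" "n > 0"
  shows "(w powr (1 / p)) ^ n = w powr (real n / p)"
proof (cases "w = 0")
  case False
  then have "w powr (1 / p) > 0" using assms by simp
  then have "(w powr (1 / p)) ^ n = (w powr (1 / p)) powr real n" by (simp add: powr_realpow)
  then show ?thesis by (simp add: powr_powr)
qed (use assms in auto)

lemma approxD:
  assumes "approx T p \<omega> i dfd nrm F G"
  obtains C \<delta> where "C \<ge> 0" "\<delta> > 0"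
    "\<And>s t. 0 \<le> s \<Longrightarrow> s \<le> t \<Longrightarrow> t \<le> T \<Longrightarrow> t - s \<le> \<delta> \<Longrightarrow>
      dfd s t \<and> nrm s (F s t - G s t) \<le> C * \<omega> s t powr (real i / p)"
proof -
  obtain C \<delta> where \<delta>: "\<delta> > 0" and *: "\<forall>(s, t)\<in>Delta T. t - s \<le> \<delta> \<longrightarrow>
      dfd s t \<and> nrm s (F s t - G s t) \<le> C * \<omega> s t powr (real i / p)"
    using assms unfolding approx_def by blast
  show thesis
  proof
    show "max C 0 \<ge> 0" "\<delta> > 0" using \<delta> by auto
    fix s t assume st: "0 \<le> s" "s \<le> t" "t \<le> T" "t - s \<le> \<delta>"
    then have "dfd s t \<and> nrm s (F s t - G s t) \<le> C * \<omega> s t powr (real i / p)"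
      using * by (auto simp: Delta_def)
    moreover have "C * \<omega> s t powr (real i / p) \<le> max C 0 * \<omega> s t powr (real i / p)"
      by (intro mult_right_mono) auto
    ultimately show "dfd s t \<and> nrm s (F s t - G s t) \<le> max C 0 * \<omega> s t powr (real i / p)" by linarith
  qed
qed

section \<open>The controlled hypotheses as inequalities for single vectors\<close>

locale rough_setting = gauge_atlas A D \<psi> U + riemannian_atlas A g
  for A :: "('m::{t2_space, second_countable_topology}, 'e::real_normed_vector) chart set"
    and g D \<psi> U +
  fixes T p :: real and \<omega> :: "real \<Rightarrow> real \<Rightarrow> real"
    and x :: "real \<Rightarrow> real ^ 'k" and X :: "real \<Rightarrow> real \<Rightarrow> real ^ 'k ^ 'k"
    and y :: "real \<Rightarrow> 'm" and yd :: "real \<Rightarrow> real ^ 'k \<Rightarrow> ('m, 'e) tvec"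
    and \<alpha> :: "real \<Rightarrow> ('m, 'e) tvec \<Rightarrow> 'v::banach" and \<alpha>d :: "real \<Rightarrow> ('k \<Rightarrow> ('m, 'e) tvec) \<Rightarrow> 'v"
  assumes T: "0 < T" and p: "1 \<le> p" "p < 3"
    and \<omega>: "control T \<omega>"
    and rough: "weak_geometric_rough_path T p \<omega> x X"
    and y_crp: "(y, yd) \<in> CRP_manifold A g D \<psi> U T p \<omega> x"
    and \<alpha>_crp: "(\<alpha>, \<alpha>d) \<in> CRP_forms A g D U T p \<omega> x y"
begin

abbreviation h where "h s t \<equiv> \<omega> s t powr (1 / p)"

lemma h_power: "0 \<le> s \<Longrightarrow> s \<le> t \<Longrightarrow> t \<le> T \<Longrightarrow> n > 0 \<Longrightarrow> h s t ^ n = \<omega> s t powr (real n / p)"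
  by (rule powr_root_power) (auto intro: control_nonneg[OF \<omega>])

lemma h_mono: "0 \<le> s' \<Longrightarrow> s' \<le> s \<Longrightarrow> s \<le> t \<Longrightarrow> t \<le> t' \<Longrightarrow> t' \<le> T \<Longrightarrow> h s t \<le> h s' t'"
  using control_mono[OF \<omega>, of s' s t t'] control_nonneg[OF \<omega>, of s t] p by (intro powr_mono2) auto

lemma x_increment: "0 \<le> s \<Longrightarrow> s \<le> t \<Longrightarrow> t \<le> T \<Longrightarrow> norm (x t - x s) \<le> h s t"
  and X_bound: "0 \<le> s \<Longrightarrow> s \<le> t \<Longrightarrow> t \<le> T \<Longrightarrow> norm (X s t) \<le> (h s t)\<^sup>2"
  and chen: "0 \<le> s \<Longrightarrow> s \<le> t \<Longrightarrow> t \<le> v \<Longrightarrow> v \<le> T \<Longrightarrow> X s v = X s t + X t v + outer (x t - x s) (x v - x t)"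
  using rough h_power[of s t 2] by (auto simp: weak_geometric_rough_path_def Delta_def)

lemma y_cont: "continuous_on {0..T} y"
  and yd_lin: "s \<in> {0..T} \<Longrightarrow> linear (yd s)"
  and yd_tangent: "s \<in> {0..T} \<Longrightarrow> yd s w \<in> tangent_space A (y s)"
  and yd_cont: "c \<in> A \<Longrightarrow> continuous_on {s \<in> {0..T}. y s \<in> fst c} (\<lambda>s. yd s w c)"
  and \<alpha>_lin: "s \<in> {0..T} \<Longrightarrow> lin_on (tangent_space A (y s)) (\<alpha> s)"
  and \<alpha>d_lin: "s \<in> {0..T} \<Longrightarrow> lin_on (wtangent_space A (y s)) (\<alpha>d s)"
  using y_crp \<alpha>_crp by (auto simp: CRP_manifold_def CRP_forms_def image_subset_iff)

lemma wtensor_eq: "wtensor w v = (\<Sum>i\<in>UNIV. w $ i *\<^sub>R wsingle i (v :: ('m, 'e) tvec))"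
proof -
  have "wtensor w v = (\<Sum>i\<in>UNIV. wsingle i (wtensor w v i))" by (rule wsingle_expand)
  then show ?thesis by (simp add: wtensor_def wsingle_scaleR)
qed

lemma \<alpha>d_wtensor:
  assumes "s \<in> {0..T}" "v \<in> tangent_space A (y s)"
  shows "\<alpha>d s (wtensor w v) = (\<Sum>i\<in>UNIV. w $ i *\<^sub>R \<alpha>d s (wsingle i v))"
proof -
  have "\<alpha>d s (wtensor w v) = (\<Sum>i\<in>UNIV. \<alpha>d s (w $ i *\<^sub>R wsingle i v))"
    unfolding wtensor_eq
    by (rule lin_on_sum[OF \<alpha>d_lin[OF assms(1)] subspace_wtangent_space finite
      subspace_scale[OF subspace_wtangent_space wsingle_in_wtangent[OF assms(2)]]])
  also have "\<dots> = (\<Sum>i\<in>UNIV. w $ i *\<^sub>R \<alpha>d s (wsingle i v))"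
    by (intro sum.cong refl lin_on_scaleR[OF \<alpha>d_lin[OF assms(1)] wsingle_in_wtangent[OF assms(2)]])
  finally show ?thesis .
qed

lemma \<alpha>d_expand:
  assumes "s \<in> {0..T}" "\<tau> \<in> wtangent_space A (y s)"
  shows "\<alpha>d s \<tau> = (\<Sum>i\<in>UNIV. \<alpha>d s (wsingle i (\<tau> i)))"
proof -
  have "\<alpha>d s \<tau> = \<alpha>d s (\<Sum>i\<in>UNIV. wsingle i (\<tau> i))" by (rule arg_cong[OF wsingle_expand, of "\<alpha>d s"])
  also have "\<dots> = (\<Sum>i\<in>UNIV. \<alpha>d s (wsingle i (\<tau> i)))"
    by (rule lin_on_sum[OF \<alpha>d_lin[OF assms(1)] subspace_wtangent_space finite wsingle_in_wtangent])
      (use assms(2) in \<open>simp add: wtangent_space_def\<close>)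
  finally show ?thesis .
qed

text \<open>The four approximations of the hypotheses receive one constant and one mesh. For the
  three in operator norm, the difference has to be shown linear on its space, since the supremum is
  known to bound the values for linear maps. The last family is restricted to elementary tensors,
  which give the coefficients \<open>\<gamma>\<close> in a chart.\<close>

lemma controlled_estimates:
  obtains C \<delta> where "C \<ge> 0" "\<delta> > 0"
    "\<And>s t. 0 \<le> s \<Longrightarrow> s \<le> t \<Longrightarrow> t \<le> T \<Longrightarrow> t - s \<le> \<delta> \<Longrightarrow> (y s, y t) \<in> D \<and> (y t, y s) \<in> D \<and>
      gnorm g (y s) (\<psi> (y s) (y t) - yd s (x t - x s)) \<le> C * (h s t)\<^sup>2 \<and>
      (\<forall>w. gnorm g (y s) (U (y s) (y t) (yd t w) - yd s w) \<le> C * h s t * norm w) \<and>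
      (\<forall>v\<in>tangent_space A (y s). norm (\<alpha> t (U (y t) (y s) v) - \<alpha> s v - \<alpha>d s (wtensor (x t - x s) v))
        \<le> C * (h s t)\<^sup>2 * gnorm g (y s) v) \<and>
      (\<forall>v\<in>tangent_space A (y s). \<forall>i. norm (\<alpha>d t (wsingle i (U (y t) (y s) v)) - \<alpha>d s (wsingle i v))
        \<le> C * h s t * gnorm g (y s) v)"
proof -
  note ydef = y_crp[unfolded CRP_manifold_def mem_Collect_eq case_prod_conv]
  note \<alpha>def = \<alpha>_crp[unfolded CRP_forms_def mem_Collect_eq case_prod_conv]
  obtain C1 \<delta>1 where 1: "C1 \<ge> 0" "\<delta>1 > 0" "\<And>s t. 0 \<le> s \<Longrightarrow> s \<le> t \<Longrightarrow> t \<le> T \<Longrightarrow> t - s \<le> \<delta>1 \<Longrightarrow>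
      (y s, y t) \<in> D \<and> gnorm g (y s) (\<psi> (y s) (y t) - yd s (x t - x s)) \<le> C1 * \<omega> s t powr (real 2 / p)"
    using approxD[of T p \<omega> 2] ydef by blast
  obtain C2 \<delta>2 where 2: "C2 \<ge> 0" "\<delta>2 > 0" "\<And>s t. 0 \<le> s \<Longrightarrow> s \<le> t \<Longrightarrow> t \<le> T \<Longrightarrow> t - s \<le> \<delta>2 \<Longrightarrow>
      (y s, y t) \<in> D \<and> op_norm UNIV norm (gnorm g (y s)) ((U (y s) (y t) \<circ> yd t) - yd s) \<le> C2 * \<omega> s t powr (real 1 / p)"
    using approxD[of T p \<omega> 1] ydef by blast
  obtain C3 \<delta>3 where 3: "C3 \<ge> 0" "\<delta>3 > 0" "\<And>s t. 0 \<le> s \<Longrightarrow> s \<le> t \<Longrightarrow> t \<le> T \<Longrightarrow> t - s \<le> \<delta>3 \<Longrightarrow>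
      (y t, y s) \<in> D \<and> op_norm (tangent_space A (y s)) (gnorm g (y s)) norm
        ((\<alpha> t \<circ> U (y t) (y s)) - \<alpha> s - (\<lambda>v. \<alpha>d s (wtensor (x t - x s) v)) - 0) \<le> C3 * \<omega> s t powr (real 2 / p)"
    using approxD[of T p \<omega> 2] \<alpha>def by blast
  obtain C4 \<delta>4 where 4: "C4 \<ge> 0" "\<delta>4 > 0" "\<And>s t. 0 \<le> s \<Longrightarrow> s \<le> t \<Longrightarrow> t \<le> T \<Longrightarrow> t - s \<le> \<delta>4 \<Longrightarrow>
      (y t, y s) \<in> D \<and> op_norm (wtangent_space A (y s)) (wgnorm g (y s)) norm
        ((\<alpha>d t \<circ> id_tensor (U (y t) (y s))) - \<alpha>d s - 0) \<le> C4 * \<omega> s t powr (real 1 / p)"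
    using approxD[of T p \<omega> 1] \<alpha>def by blast
  define C where "C = max (max C1 C2) (max C3 C4)"
  have C: "C1 \<le> C" "C2 \<le> C" "C3 \<le> C" "C4 \<le> C" by (auto simp: C_def)
  show thesis
  proof
    show "C \<ge> 0" using 1(1) C by linarith
    show "min (min \<delta>1 \<delta>2) (min \<delta>3 \<delta>4) > 0" using 1 2 3 4 by auto
    fix s t assume st: "0 \<le> s" "s \<le> t" "t \<le> T" "t - s \<le> min (min \<delta>1 \<delta>2) (min \<delta>3 \<delta>4)"
    then have d: "t - s \<le> \<delta>1" "t - s \<le> \<delta>2" "t - s \<le> \<delta>3" "t - s \<le> \<delta>4" by auto
    have sT: "s \<in> {0..T}" and tT: "t \<in> {0..T}" using st by auto
    have h2: "\<omega> s t powr (real 2 / p) = (h s t)\<^sup>2" and h1: "\<omega> s t powr (real 1 / p) = h s t"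
      using h_power[OF st(1-3), of 2] by simp_all
    note D1 = conjunct1[OF 1(3)[OF st(1-3) d(1)]] and D2 = conjunct1[OF 3(3)[OF st(1-3) d(3)]]
    have le: "a \<le> C * b" if "a \<le> c * b" "c \<le> C" "0 \<le> b" for a b c
      using that(1) mult_right_mono[OF that(2,3)] by linarith
    have r1: "gnorm g (y s) (\<psi> (y s) (y t) - yd s (x t - x s)) \<le> C * (h s t)\<^sup>2"
      using conjunct2[OF 1(3)[OF st(1-3) d(1)]] unfolding h2 by (rule le[OF _ C(1)]) simp
    have r2: "gnorm g (y s) (U (y s) (y t) (yd t w) - yd s w) \<le> C * h s t * norm w" for w
    proof -
      let ?f = "(U (y s) (y t) \<circ> yd t) - yd s"
      have ran: "U (y s) (y t) (yd t w) \<in> tangent_space A (y s)" for w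
        by (rule U_tangent[OF D1 yd_tangent[OF tT]])
      have "linear ?f"
        using yd_lin[OF sT] yd_lin[OF tT] lin_on_add[OF U_lin[OF D1] yd_tangent[OF tT] yd_tangent[OF tT]]
          lin_on_scaleR[OF U_lin[OF D1] yd_tangent[OF tT]]
        by (intro linearI) (auto simp: linear_add linear_scale scaleR_diff_right)
      moreover have "range ?f \<subseteq> tangent_space A (y s)"
        using subspace_diff[OF subspace_tangent_space ran yd_tangent[OF sT]] by auto
      ultimately have "gnorm g (y s) (?f w) \<le> op_norm UNIV norm (gnorm g (y s)) ?f * norm w"
        by (rule op_norm_into_tangent)
      also have "\<dots> \<le> (C * h s t) * norm w"
        using conjunct2[OF 2(3)[OF st(1-3) d(2)]] unfolding h1 by (intro mult_right_mono le[OF _ C(2)]) auto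
      finally show ?thesis by simp
    qed
    have r3: "norm (\<alpha> t (U (y t) (y s) v) - \<alpha> s v - \<alpha>d s (wtensor (x t - x s) v)) \<le> C * (h s t)\<^sup>2 * gnorm g (y s) v"
      if v: "v \<in> tangent_space A (y s)" for v
    proof -
      let ?f = "(\<alpha> t \<circ> U (y t) (y s)) - \<alpha> s - (\<lambda>v. \<alpha>d s (wtensor (x t - x s) v))"
      have ran: "u \<in> tangent_space A (y s) \<Longrightarrow> U (y t) (y s) u \<in> tangent_space A (y t)" for u by (rule U_tangent[OF D2])
      have wt: "u \<in> tangent_space A (y s) \<Longrightarrow> wtensor (x t - x s) u \<in> wtangent_space A (y s)" for u
        using subspace_scale[OF subspace_tangent_space] by (auto simp: wtensor_def wtangent_space_def)
      have wa: "wtensor w (u + u') = wtensor w u + wtensor w u'" "wtensor w (r *\<^sub>R u) = r *\<^sub>R wtensor w u"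
        for w :: "real ^ 'k" and u u' :: "('m, 'e) tvec" and r
        by (simp_all add: wtensor_def fun_eq_iff scaleR_add_right scaleR_fun_def[of r "\<lambda>i. w $ i *\<^sub>R u"] mult.commute)
      have "lin_on (tangent_space A (y s)) ?f"
        unfolding lin_on_def
        using lin_on_add[OF \<alpha>_lin[OF sT]] lin_on_add[OF \<alpha>_lin[OF tT] ran ran] lin_on_add[OF \<alpha>d_lin[OF sT] wt wt]
          lin_on_scaleR[OF \<alpha>_lin[OF sT]] lin_on_scaleR[OF \<alpha>_lin[OF tT] ran] lin_on_scaleR[OF \<alpha>d_lin[OF sT] wt]
          lin_on_add[OF U_lin[OF D2]] lin_on_scaleR[OF U_lin[OF D2]]
        by (auto simp: wa scaleR_diff_right)
      from op_norm_on_tangent[OF this v]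
      have "norm (?f v) \<le> op_norm (tangent_space A (y s)) (gnorm g (y s)) norm ?f * gnorm g (y s) v" .
      also have "\<dots> \<le> (C * (h s t)\<^sup>2) * gnorm g (y s) v"
        using conjunct2[OF 3(3)[OF st(1-3) d(3)]] gnorm_nonneg[OF v] unfolding h2 diff_zero
        by (intro mult_right_mono le[OF _ C(3)]) auto
      finally show ?thesis by simp
    qed
    have r4: "norm (\<alpha>d t (wsingle i (U (y t) (y s) v)) - \<alpha>d s (wsingle i v)) \<le> C * h s t * gnorm g (y s) v"
      if v: "v \<in> tangent_space A (y s)" for v i
    proof -
      let ?I = "id_tensor (U (y t) (y s)) :: ('k \<Rightarrow> ('m, 'e) tvec) \<Rightarrow> _"
      let ?f = "(\<alpha>d t \<circ> ?I) - \<alpha>d s"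
      have ran: "\<tau> \<in> wtangent_space A (y s) \<Longrightarrow> ?I \<tau> \<in> wtangent_space A (y t)" for \<tau>
        using U_tangent[OF D2] by (simp add: wtangent_space_def id_tensor_def)
      have Ia: "?I (\<sigma> + \<tau>) = ?I \<sigma> + ?I \<tau>" "?I (r *\<^sub>R \<sigma>) = r *\<^sub>R ?I \<sigma>"
        if "\<sigma> \<in> wtangent_space A (y s)" "\<tau> \<in> wtangent_space A (y s)" for \<sigma> \<tau> r
        using that lin_on_add[OF U_lin[OF D2]] lin_on_scaleR[OF U_lin[OF D2]]
        by (simp_all add: wtangent_space_def id_tensor_def fun_eq_iff[where 'a = 'k] scaleR_fun_def[of r "_ :: 'k \<Rightarrow> _"])
      have "lin_on (wtangent_space A (y s)) ?f"
        unfolding lin_on_def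
        using lin_on_add[OF \<alpha>d_lin[OF sT]] lin_on_add[OF \<alpha>d_lin[OF tT] ran ran]
          lin_on_scaleR[OF \<alpha>d_lin[OF sT]] lin_on_scaleR[OF \<alpha>d_lin[OF tT] ran]
        by (auto simp: Ia scaleR_diff_right)
      from op_norm_on_wtangent[OF this wsingle_in_wtangent[OF v]]
      have "norm (?f (wsingle i v)) \<le> op_norm (wtangent_space A (y s)) (wgnorm g (y s)) norm ?f * gnorm g (y s) v"
        by (simp only: wgnorm_wsingle)
      also have "\<dots> \<le> (C * h s t) * gnorm g (y s) v"
        using conjunct2[OF 4(3)[OF st(1-3) d(4)]] gnorm_nonneg[OF v] unfolding h1 diff_zero
        by (intro mult_right_mono le[OF _ C(4)]) auto
      also have "?f (wsingle i v) = \<alpha>d t (wsingle i (U (y t) (y s) v)) - \<alpha>d s (wsingle i v)"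
      proof -
        \<comment> \<open>\<open>id_tensor\<close> also acts on the zero components off the index
          \<open>i\<close>; linearity shows that they stay 0.\<close>
        have "U (y t) (y s) (0 *\<^sub>R v) = 0 *\<^sub>R U (y t) (y s) v" by (rule lin_on_scaleR[OF U_lin[OF D2] v])
        then have "?I (wsingle i v) = wsingle i (U (y t) (y s) v)" by (auto simp: id_tensor_def wsingle_def)
        then show ?thesis by simp
      qed
      finally show ?thesis .
    qed
    show "(y s, y t) \<in> D \<and> (y t, y s) \<in> D \<and>
      gnorm g (y s) (\<psi> (y s) (y t) - yd s (x t - x s)) \<le> C * (h s t)\<^sup>2 \<and>
      (\<forall>w. gnorm g (y s) (U (y s) (y t) (yd t w) - yd s w) \<le> C * h s t * norm w) \<and>
      (\<forall>v\<in>tangent_space A (y s). norm (\<alpha> t (U (y t) (y s) v) - \<alpha> s v - \<alpha>d s (wtensor (x t - x s) v))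
        \<le> C * (h s t)\<^sup>2 * gnorm g (y s) v) \<and>
      (\<forall>v\<in>tangent_space A (y s). \<forall>i. norm (\<alpha>d t (wsingle i (U (y t) (y s) v)) - \<alpha>d s (wsingle i v))
        \<le> C * h s t * gnorm g (y s) v)"
      using D1 D2 r1 r2 r3 r4 by blast
  qed
qed

end

text \<open>Finitely many neighbourhoods cover the time interval, and by the Lebesgue number every
  short subinterval lies inside one of them. Monotonicity in \<open>K\<close> allows a single
  constant, for which the sum of the moduli serves.\<close>

lemma uniform_from_local:
  fixes Q :: "real \<Rightarrow> real \<Rightarrow> real \<Rightarrow> bool"
  assumes mono: "\<And>K K' s t. K \<le> K' \<Longrightarrow> 0 \<le> s \<Longrightarrow> s \<le> t \<Longrightarrow> t \<le> T \<Longrightarrow> Q K s t \<Longrightarrow> Q K' s t"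
    and loc: "\<And>s0. s0 \<in> {0..T} \<Longrightarrow> \<exists>\<epsilon>>0. \<exists>K. \<forall>s t. 0 \<le> s \<longrightarrow> s \<le> t \<longrightarrow> t \<le> T \<longrightarrow>
      \<bar>s - s0\<bar> \<le> \<epsilon> \<longrightarrow> \<bar>t - s0\<bar> \<le> \<epsilon> \<longrightarrow> Q K s t"
  shows "\<exists>\<delta>>0. \<exists>K. \<forall>s t. 0 \<le> s \<longrightarrow> s \<le> t \<longrightarrow> t \<le> T \<longrightarrow> t - s \<le> \<delta> \<longrightarrow> Q K s t"
proof -
  have "\<forall>s0\<in>{0..T}. \<exists>\<epsilon> K. \<epsilon> > 0 \<and> (\<forall>s t. 0 \<le> s \<longrightarrow> s \<le> t \<longrightarrow> t \<le> T \<longrightarrow>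
      \<bar>s - s0\<bar> \<le> \<epsilon> \<longrightarrow> \<bar>t - s0\<bar> \<le> \<epsilon> \<longrightarrow> Q K s t)"
    using loc by meson
  then obtain \<epsilon> K where e: "\<And>s0. s0 \<in> {0..T} \<Longrightarrow> \<epsilon> s0 > 0"
    and Q: "\<And>s0 s t. s0 \<in> {0..T} \<Longrightarrow> 0 \<le> s \<Longrightarrow> s \<le> t \<Longrightarrow> t \<le> T \<Longrightarrow> \<bar>s - s0\<bar> \<le> \<epsilon> s0 \<Longrightarrow> \<bar>t - s0\<bar> \<le> \<epsilon> s0 \<Longrightarrow> Q (K s0) s t"
    by metis
  have cover: "{0..T} \<subseteq> (\<Union>s0\<in>{0..T}. ball s0 (\<epsilon> s0))" using e by force
  obtain F where F: "F \<subseteq> {0..T}" "finite F" "{0..T} \<subseteq> (\<Union>s0\<in>F. ball s0 (\<epsilon> s0))"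
    by (rule compactE_image[OF compact_Icc _ cover]) auto
  obtain d where d: "d > 0" "\<And>s. s \<in> {0..T} \<Longrightarrow> \<exists>G\<in>(\<lambda>s0. ball s0 (\<epsilon> s0)) ` F. ball s d \<subseteq> G"
    using Heine_Borel_lemma[OF compact_Icc, of 0 T "(\<lambda>s0. ball s0 (\<epsilon> s0)) ` F"] F(3) by auto
  have "Q (\<Sum>s0\<in>F. \<bar>K s0\<bar>) s t" if st: "0 \<le> s" "s \<le> t" "t \<le> T" "t - s \<le> d / 2" for s t
  proof -
    obtain s0 where s0: "s0 \<in> F" "ball s d \<subseteq> ball s0 (\<epsilon> s0)" using d(2)[of s] st by auto
    have "s \<in> ball s d" "t \<in> ball s d" using st d(1) by (auto simp: dist_real_def)
    then have "s \<in> ball s0 (\<epsilon> s0)" "t \<in> ball s0 (\<epsilon> s0)" using s0(2) by blast+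
    then have "Q (K s0) s t" using s0(1) F(1) st by (intro Q) (auto simp: dist_real_def)
    moreover have "K s0 \<le> (\<Sum>s0\<in>F. \<bar>K s0\<bar>)"
      using member_le_sum[of s0 F "\<lambda>s. \<bar>K s\<bar>"] s0(1) F(2) by auto
    ultimately show ?thesis using mono st by blast
  qed
  then show ?thesis using d(1) by (intro exI[of _ "d / 2"] conjI exI[of _ "\<Sum>s0\<in>F. \<bar>K s0\<bar>"]) auto
qed

context rough_setting
begin

abbreviation zt where "zt \<equiv> ztilde A \<psi> U X y yd \<alpha> \<alpha>d"

text \<open>Everything is transported to one chart around \<open>y s0\<close> on a closed time
  interval around \<open>s0\<close>, where \<open>local_almost_additive\<close> applies. Continuity
  of \<open>y\<close> confines the path to a small ball, continuity of \<open>yd\<close> bounds it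
  there, and the Riemannian norm is comparable with that of the chart.\<close>

lemma ztilde_local:
  assumes s0: "s0 \<in> {0..T}"
  shows "\<exists>\<epsilon>>0. \<exists>K. \<forall>s v. 0 \<le> s \<longrightarrow> s \<le> v \<longrightarrow> v \<le> T \<longrightarrow> \<bar>s - s0\<bar> \<le> \<epsilon> \<longrightarrow> \<bar>v - s0\<bar> \<le> \<epsilon> \<longrightarrow>
    (\<forall>t. s \<le> t \<longrightarrow> t \<le> v \<longrightarrow> norm (zt s v - zt s t - zt t v) \<le> K * h s v ^ 3) \<and>
    norm (zt s v - \<alpha> s (yd s (x v - x s))) \<le> K * (h s v)\<^sup>2 \<and>
    (\<forall>w. norm (\<alpha> v (yd v w) - \<alpha> s (yd s w)) \<le> K * (h s v * norm w))"
proof -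
  obtain B :: "'e set" where B: "fin_basis B" using model_fin_basis by blast
  obtain c where c: "c \<in> A" "y s0 \<in> fst c" using chart_at by blast
  let ?\<Psi> = "chart_log c" and ?u = "chart_par c" and ?S = "chart_tensor B (chart_log c) (chart_par c)"
  define a0 where "a0 = snd c (y s0)"
  have a0: "a0 \<in> cimage c" using c by (simp add: a0_def)
  obtain r C0 where r: "r > 0" "C0 \<ge> 0" "ball a0 r \<times> ball a0 r \<subseteq> coord_domain D c c"
    and E: "\<forall>a\<in>ball a0 r. \<forall>b\<in>ball a0 r. \<forall>c'\<in>ball a0 r.
      norm (?\<Psi> a c' - ?\<Psi> a b - (c' - b)) \<le> C0 * (norm (c' - b) * (norm (c' - b) + norm (b - a))) \<and>
      (\<forall>e. norm (?u b a e - e) \<le> C0 * (norm (b - a) * norm e)) \<and>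
      (\<forall>v w. norm (?S a v w) \<le> C0 * (norm v * norm w)) \<and>
      (\<forall>v w. norm (?S a v w - ?S b v w) \<le> C0 * (norm (a - b) * norm v * norm w)) \<and>
      norm (?u b a (?\<Psi> a c' - ?\<Psi> a b) - ?\<Psi> b c' - ?S b (a - b) (c' - b))
        \<le> C0 * (norm (a - b) * norm (c' - b) * (norm (a - b) + norm (c' - b)))"
    using chart_estimates[OF B c(1) a0] by blast
  obtain r2 \<kappa> where r2: "r2 > 0" "\<kappa> > 0" "ball a0 r2 \<subseteq> cimage c"
    and \<kappa>: "\<And>a e. a \<in> ball a0 r2 \<Longrightarrow> norm e \<le> \<kappa> * gnorm g (cinv c a) (tangent_of A c (cinv c a) e) \<and>
      gnorm g (cinv c a) (tangent_of A c (cinv c a) e) \<le> \<kappa> * norm e"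
    using gnorm_locally_equivalent[OF c(1) a0] by blast
  obtain C \<delta> where C: "C \<ge> 0" "\<delta> > 0" and est: "\<And>s t. 0 \<le> s \<Longrightarrow> s \<le> t \<Longrightarrow> t \<le> T \<Longrightarrow> t - s \<le> \<delta> \<Longrightarrow>
      (y s, y t) \<in> D \<and> (y t, y s) \<in> D \<and>
      gnorm g (y s) (\<psi> (y s) (y t) - yd s (x t - x s)) \<le> C * (h s t)\<^sup>2 \<and>
      (\<forall>w. gnorm g (y s) (U (y s) (y t) (yd t w) - yd s w) \<le> C * h s t * norm w) \<and>
      (\<forall>v\<in>tangent_space A (y s). norm (\<alpha> t (U (y t) (y s) v) - \<alpha> s v - \<alpha>d s (wtensor (x t - x s) v))
        \<le> C * (h s t)\<^sup>2 * gnorm g (y s) v) \<and>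
      (\<forall>v\<in>tangent_space A (y s). \<forall>i. norm (\<alpha>d t (wsingle i (U (y t) (y s) v)) - \<alpha>d s (wsingle i v))
        \<le> C * h s t * gnorm g (y s) v)"
    using controlled_estimates by blast
  \<comment> \<open>Two points of the ball of this radius are less than
    \<open>1 / (2 * (C0 + 1))\<close> apart, which gives \<open>G_small\<close>.\<close>
  define r' where "r' = min (min r r2) (1 / (4 * (C0 + 1)))"
  have r': "r' > 0" "r' \<le> r" "r' \<le> r2" using r r2 by (auto simp: r'_def)
  define G where "G = ball a0 r'"
  have G: "a \<in> ball a0 r" "a \<in> ball a0 r2" "a \<in> cimage c" if "a \<in> G" for a
    using that r' r2(3) by (auto simp: G_def)
  have G_small: "C0 * norm (a - b) \<le> 1 / 2" if "a \<in> G" "b \<in> G" for a b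
  proof -
    have "dist a b < r' + r'" using that dist_triangle_less_add[of a a0 r' b r'] by (simp add: G_def dist_commute)
    moreover define q where "q = 1 / (4 * (C0 + 1))"
    moreover have "r' \<le> q" unfolding r'_def q_def by (rule min.cobounded2)
    ultimately have "norm (a - b) \<le> 2 * q" unfolding dist_norm by linarith
    then have "C0 * norm (a - b) \<le> C0 * (2 * q)" using r(2) by (rule mult_left_mono)
    also have "\<dots> \<le> 1 / 2" using r(2) by (simp add: q_def field_simps)
    finally show ?thesis .
  qed
  define V where "V = {m \<in> fst c. snd c m \<in> G}"
  have V: "open V" "y s0 \<in> V" unfolding V_def G_def using open_cinv_image[OF c(1) open_ball] c(2) r'(1) by (auto simp: a0_def)
  have "\<forall>\<^sub>F s in at s0 within {0..T}. y s \<in> V"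
    using y_cont s0 V by (intro topological_tendstoD) (auto simp: continuous_on_def)
  then obtain \<epsilon>1 where \<epsilon>1: "\<epsilon>1 > 0" "\<And>s. s \<in> {0..T} \<Longrightarrow> \<bar>s - s0\<bar> < \<epsilon>1 \<Longrightarrow> y s \<in> V"
    using V(2) unfolding eventually_at dist_real_def by metis
  \<comment> \<open>Continuity of \<open>yd\<close> is given for each fixed vector; the finitely
    many axis vectors suffice for the operator bound \<open>Cb\<close>.\<close>
  have "\<forall>i. \<exists>\<epsilon>>0. \<forall>s\<in>{0..T}. y s \<in> fst c \<longrightarrow> \<bar>s - s0\<bar> < \<epsilon> \<longrightarrow>
      norm (yd s (axis i 1) c) \<le> norm (yd s0 (axis i 1) c) + 1"
  proof
    fix i :: 'k
    have "\<forall>e>0. \<exists>d>0. \<forall>s\<in>{s \<in> {0..T}. y s \<in> fst c}. dist s s0 < d \<longrightarrow> dist (yd s (axis i 1) c) (yd s0 (axis i 1) c) < e"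
      using yd_cont[OF c(1), of "axis i 1"] s0 c(2) unfolding continuous_on_iff by blast
    then obtain d where d: "d > 0" "\<And>s. s \<in> {0..T} \<Longrightarrow> y s \<in> fst c \<Longrightarrow> dist s s0 < d \<Longrightarrow>
        dist (yd s (axis i 1) c) (yd s0 (axis i 1) c) < 1"
      using zero_less_one by blast
    have "norm (yd s (axis i 1) c) \<le> norm (yd s0 (axis i 1) c) + 1"
      if "s \<in> {0..T}" "y s \<in> fst c" "\<bar>s - s0\<bar> < d" for s
      using d(2)[of s] that norm_triangle_ineq2[of "yd s (axis i 1) c" "yd s0 (axis i 1) c"]
      by (simp add: dist_norm)
    then show "\<exists>\<epsilon>>0. \<forall>s\<in>{0..T}. y s \<in> fst c \<longrightarrow> \<bar>s - s0\<bar> < \<epsilon> \<longrightarrow>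
      norm (yd s (axis i 1) c) \<le> norm (yd s0 (axis i 1) c) + 1" using d(1) by blast
  qed
  then obtain \<epsilon>2 where \<epsilon>2: "\<And>i. \<epsilon>2 i > 0" "\<And>i s. s \<in> {0..T} \<Longrightarrow> y s \<in> fst c \<Longrightarrow> \<bar>s - s0\<bar> < \<epsilon>2 i \<Longrightarrow>
      norm (yd s (axis i 1) c) \<le> norm (yd s0 (axis i 1) c) + 1"
    by metis
  \<comment> \<open>Halved so that two times within \<epsilon> of \<open>s0\<close> are at most
    \<delta> apart, as the controlled estimates require.\<close>
  define \<epsilon> where "\<epsilon> = min (min \<epsilon>1 (Min (range \<epsilon>2))) \<delta> / 2"
  have \<epsilon>: "\<epsilon> > 0" "\<epsilon> < \<epsilon>1" "2 * \<epsilon> \<le> \<delta>" "\<And>i. \<epsilon> < \<epsilon>2 i"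
  proof -
    let ?m = "Min (range \<epsilon>2)"
    have m: "?m > 0" "\<And>i. ?m \<le> \<epsilon>2 i" using \<epsilon>2(1) by auto
    show "\<epsilon> > 0" "\<epsilon> < \<epsilon>1" "2 * \<epsilon> \<le> \<delta>" using m(1) \<epsilon>1(1) C(2) unfolding \<epsilon>_def by linarith+
    show "\<epsilon> < \<epsilon>2 i" for i using m(2)[of i] m(1) \<epsilon>1(1) C(2) unfolding \<epsilon>_def by linarith
  qed
  define l where "l = max 0 (s0 - \<epsilon>)"
  define m where "m = min T (s0 + \<epsilon>)"
  have lm: "l \<le> m" using s0 \<epsilon>(1) T by (auto simp: l_def m_def)
  have J: "s \<in> {0..T}" "\<bar>s - s0\<bar> \<le> \<epsilon>" if "s \<in> {l..m}" for s using that by (auto simp: l_def m_def)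
  have st_J: "0 \<le> s" "t \<le> T" "t - s \<le> \<delta>" "s \<in> {l..m}" "t \<in> {l..m}" if "l \<le> s" "s \<le> t" "t \<le> m" for s t
    using that \<epsilon>(3) by (auto simp: l_def m_def)
  have yV: "y s \<in> fst c" "snd c (y s) \<in> G" if "s \<in> {l..m}" for s
    using \<epsilon>1(2)[of s] J[OF that] \<epsilon>(2) by (auto simp: V_def)
  define a where "a s = snd c (y s)" for s
  define b where "b s w = yd s w c" for s w
  define \<beta> where "\<beta> s e = \<alpha> s (tangent_of A c (y s) e)" for s e
  define \<gamma> where "\<gamma> s i e = \<alpha>d s (wsingle i (tangent_of A c (y s) e))" for s i e
  have tan: "tangent_of A c (y s) e \<in> tangent_space A (y s)" if "s \<in> {l..m}" for s e
    by (rule tangent_of_in[OF c(1) yV(1)[OF that]])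
  have lt: "linear (tangent_of A c (y s))" if "s \<in> {l..m}" for s by (rule linear_tangent_of[OF c(1) yV(1)[OF that]])
  have yd_eq: "yd s w = tangent_of A c (y s) (b s w)" if "s \<in> {l..m}" for s w
    using tangent_of_coords[OF c(1) yV(1)[OF that] yd_tangent[OF J(1)[OF that]]] by (simp add: b_def)
  have lower: "norm (v c) \<le> \<kappa> * gnorm g (y s) v" if "s \<in> {l..m}" "v \<in> tangent_space A (y s)" for s v
    using \<kappa>[OF G(2)[OF yV(2)[OF that(1)]], of "v c"] c yV(1)[OF that(1)]
      tangent_of_coords[OF c(1) yV(1)[OF that(1)] that(2)] by simp
  have upper: "gnorm g (y s) (tangent_of A c (y s) e) \<le> \<kappa> * norm e" if "s \<in> {l..m}" for s e
    using \<kappa>[OF G(2)[OF yV(2)[OF that]], of e] c yV(1)[OF that] by simp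
  have U_chart: "U (y t) (y s) (tangent_of A c (y s) e) = tangent_of A c (y t) (?u (a t) (a s) e)"
    if "(y t, y s) \<in> D" "s \<in> {l..m}" "t \<in> {l..m}" for s t e
    unfolding a_def by (rule U_eq[OF c(1) yV(1)[OF that(2)] yV(1)[OF that(3)] that(1)])
  have \<psi>_chart: "\<psi> (y s) (y t) = tangent_of A c (y s) (?\<Psi> (a s) (a t))"
    if "(y s, y t) \<in> D" "s \<in> {l..m}" "t \<in> {l..m}" for s t
    unfolding a_def by (rule \<psi>_eq[OF c(1) yV(1)[OF that(2)] yV(1)[OF that(3)] that(1)])
  define Cb where "Cb = (\<Sum>i\<in>UNIV. norm (yd s0 (axis i 1) c) + 1)"
  have blin: "linear (b s)" if "s \<in> {l..m}" for s
    using yd_lin[OF J(1)[OF that]] unfolding b_def by (intro linearI) (auto simp: linear_add linear_scale scaleR_fun_def)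
  have bb: "norm (b s w) \<le> Cb * norm w" if s: "s \<in> {l..m}" for s w
  proof -
    have "norm (b s w) \<le> (\<Sum>i\<in>UNIV. norm w * (norm (yd s0 (axis i 1) c) + 1))"
      unfolding linear_axis_expand[OF blin[OF s], of w]
    proof (rule sum_norm_le)
      fix i
      have "norm (b s (axis i 1)) \<le> norm (yd s0 (axis i 1) c) + 1"
        unfolding b_def using \<epsilon>2(2)[OF J(1)[OF s] yV(1)[OF s], of i] J(2)[OF s] \<epsilon>(4)[of i] by simp
      then show "norm (w $ i *\<^sub>R b s (axis i 1)) \<le> norm w * (norm (yd s0 (axis i 1) c) + 1)"
        using component_le_norm_cart[of w i] by (auto intro!: mult_mono)
    qed
    then show ?thesis by (simp add: Cb_def sum_distrib_left mult.commute)
  qed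
  have \<beta>lin: "linear (\<beta> s)" if s: "s \<in> {l..m}" for s
    unfolding \<beta>_def
    using lin_on_add[OF \<alpha>_lin[OF J(1)[OF s]] tan[OF s] tan[OF s]] lin_on_scaleR[OF \<alpha>_lin[OF J(1)[OF s]] tan[OF s]]
    by (intro linearI) (simp_all add: linear_add[OF lt[OF s]] linear_scale[OF lt[OF s]])
  have \<gamma>lin: "linear (\<gamma> s i)" if s: "s \<in> {l..m}" for s i
    unfolding \<gamma>_def
    using lin_on_add[OF \<alpha>d_lin[OF J(1)[OF s]] wsingle_in_wtangent[OF tan[OF s]] wsingle_in_wtangent[OF tan[OF s]]]
      lin_on_scaleR[OF \<alpha>d_lin[OF J(1)[OF s]] wsingle_in_wtangent[OF tan[OF s]]]
    by (intro linearI) (simp_all add: linear_add[OF lt[OF s]] linear_scale[OF lt[OF s]] wsingle_add wsingle_scaleR)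
  \<comment> \<open>\<open>gauge_tensor_eq\<close> replaces the gauge tensor by
    \<open>chart_tensor\<close>, and \<open>\<alpha>d s\<close> splits into its coefficients
    \<open>\<gamma> s i\<close>; the result has the form of the germ in
    \<open>local_almost_additive\<close>.\<close>
  have zt_chart: "zt s t = \<beta> s (?\<Psi> (a s) (a t) + apply_tensor_square (?S (a s)) (b s) (X s t))
      + (\<Sum>i\<in>UNIV. \<gamma> s i (b s (X s t $ i)))" if st: "l \<le> s" "s \<le> t" "t \<le> m" for s t
  proof -
    note J' = st_J[OF st]
    have "(y s, y t) \<in> D" using est[OF J'(1) st(2) J'(2,3)] by blast
    note ps = \<psi>_chart[OF this J'(4,5)]
    have gt: "gauge_tensor A \<psi> U (y s) (yd s w) (yd s w') = tangent_of A c (y s) (?S (a s) (b s w) (b s w'))" for w w'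
      unfolding a_def b_def
      by (rule gauge_tensor_eq[OF B c(1) yV(1)[OF J'(4)] yd_tangent[OF J(1)[OF J'(4)]] yd_tangent[OF J(1)[OF J'(4)]]])
    have sq: "apply_tensor_square (gauge_tensor A \<psi> U (y s)) (yd s) (X s t)
        = tangent_of A c (y s) (apply_tensor_square (?S (a s)) (b s) (X s t))"
      unfolding apply_tensor_square_def gt
      by (simp add: linear_sum[OF lt[OF J'(4)]] linear_scale[OF lt[OF J'(4)]])
    have "id_tensor_mat (yd s) (X s t) \<in> wtangent_space A (y s)"
      using yd_tangent[OF J(1)[OF J'(4)]] by (simp add: id_tensor_mat_def id_tensor_def wtangent_space_def)
    from \<alpha>d_expand[OF J(1)[OF J'(4)] this]
    have "\<alpha>d s (id_tensor_mat (yd s) (X s t)) = (\<Sum>i\<in>UNIV. \<gamma> s i (b s (X s t $ i)))"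
      by (simp add: \<gamma>_def id_tensor_mat_def id_tensor_def yd_eq[OF J'(4), symmetric])
    then show ?thesis unfolding ztilde_def ps sq by (simp add: \<beta>_def linear_add[OF lt[OF J'(4)]])
  qed
  have chart_bounds: "\<exists>K. (\<forall>s t v. l \<le> s \<longrightarrow> s \<le> t \<longrightarrow> t \<le> v \<longrightarrow> v \<le> m \<longrightarrow>
      norm ((\<beta> s (?\<Psi> (a s) (a v) + apply_tensor_square (?S (a s)) (b s) (X s v)) + (\<Sum>i\<in>UNIV. \<gamma> s i (b s (X s v $ i))))
        - (\<beta> s (?\<Psi> (a s) (a t) + apply_tensor_square (?S (a s)) (b s) (X s t)) + (\<Sum>i\<in>UNIV. \<gamma> s i (b s (X s t $ i))))
        - (\<beta> t (?\<Psi> (a t) (a v) + apply_tensor_square (?S (a t)) (b t) (X t v)) + (\<Sum>i\<in>UNIV. \<gamma> t i (b t (X t v $ i)))))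
      \<le> K * h s v ^ 3) \<and>
    (\<forall>s t. l \<le> s \<longrightarrow> s \<le> t \<longrightarrow> t \<le> m \<longrightarrow>
      norm ((\<beta> s (?\<Psi> (a s) (a t) + apply_tensor_square (?S (a s)) (b s) (X s t)) + (\<Sum>i\<in>UNIV. \<gamma> s i (b s (X s t $ i))))
        - \<beta> s (b s (x t - x s))) \<le> K * (h s t)\<^sup>2 \<and>
      (\<forall>w. norm (\<beta> t (b t w) - \<beta> s (b s w)) \<le> K * (h s t * norm w)))"
  \<comment> \<open>The factor \<open>\<kappa>\<close> in the constant comes from the change of
    norm, once in each estimate: on the target for \<open>y\<close> and \<open>yd\<close>, on the
    source for the one-forms.\<close>
  proof (rule local_almost_additive[where G = G and H = "h 0 T" and ?C0.0 = C0 and Cb = Cb and ?C1.0 = "\<kappa> * C", OF B lm])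
    show "norm (?\<Psi> a c' - ?\<Psi> a b - (c' - b)) \<le> C0 * (norm (c' - b) * (norm (c' - b) + norm (b - a)))"
      and "norm (?u b a (?\<Psi> a c' - ?\<Psi> a b) - ?\<Psi> b c' - ?S b (a - b) (c' - b))
        \<le> C0 * (norm (a - b) * norm (c' - b) * (norm (a - b) + norm (c' - b)))"
      if "a \<in> G" "b \<in> G" "c' \<in> G" for a b c'
      using E G(1) that by blast+
    show "norm (?u b a e - e) \<le> C0 * (norm (b - a) * norm e)"
      and "norm (?S a v w - ?S b v w) \<le> C0 * (norm (a - b) * norm v * norm w)"
      if "a \<in> G" "b \<in> G" for a b e v w
      using E G(1) that by blast+
    show "norm (?S a v w) \<le> C0 * (norm v * norm w)" if "a \<in> G" for a v w
      using E G(1) that by blast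
    show "?\<Psi> a a = 0" for a by (rule chart_log_diag)
    show "linear (?S a v)" "linear (\<lambda>v. ?S a v w)" if "a \<in> G" for a v w
      by (rule chart_tensor_linear[OF B c(1) G(3)[OF that]])+
    show "a s \<in> G" if "s \<in> {l..m}" for s using yV(2)[OF that] by (simp add: a_def)
    show "0 \<le> h s t \<and> h s t \<le> h 0 T" if "l \<le> s" "s \<le> t" "t \<le> m" for s t
      using st_J[OF that] that h_mono[of 0 s t T] by simp
    show "h t t' \<le> h s v" if "l \<le> s" "s \<le> t" "t \<le> t'" "t' \<le> v" "v \<le> m" for s t t' v
      using st_J[of s v] that by (intro h_mono) auto
    show "norm (x t - x s) \<le> h s t" "norm (X s t) \<le> (h s t)\<^sup>2" if "l \<le> s" "s \<le> t" "t \<le> m" for s t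
      using st_J[OF that] that by (auto intro: x_increment X_bound)
    show "X s v = X s t + X t v + outer (x t - x s) (x v - x t)" if "l \<le> s" "s \<le> t" "t \<le> v" "v \<le> m" for s t v
      using st_J[of s v] that by (intro chen) auto
    show "0 \<le> Cb" unfolding Cb_def by (intro sum_nonneg) auto
    show "0 \<le> \<kappa> * C" using r2(2) C(1) by simp
    fix s t assume st: "l \<le> s" "s \<le> t" "t \<le> m"
    note J' = st_J[OF st]
    note e = est[OF J'(1) st(2) J'(2,3)]
    have DD: "(y s, y t) \<in> D" "(y t, y s) \<in> D" using e by blast+
    have hh: "0 \<le> h s t" by simp
    show "norm (?\<Psi> (a s) (a t) - b s (x t - x s)) \<le> \<kappa> * C * (h s t)\<^sup>2"
    proof -
      let ?v = "\<psi> (y s) (y t) - yd s (x t - x s)"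
      have "?v \<in> tangent_space A (y s)"
        by (intro subspace_diff[OF subspace_tangent_space] \<psi>_tangent DD yd_tangent J J')
      then have "norm (?v c) \<le> \<kappa> * gnorm g (y s) ?v" by (rule lower[OF J'(4)])
      also have "\<dots> \<le> \<kappa> * (C * (h s t)\<^sup>2)" using e r2(2) by (intro mult_left_mono) auto
      finally show ?thesis using \<psi>_chart[OF DD(1) J'(4,5)] c yV(1)[OF J'(4)] by (simp add: b_def mult.assoc)
    qed
    show "norm (?u (a s) (a t) (b t w) - b s w) \<le> \<kappa> * C * h s t * norm w" for w
    proof -
      let ?v = "U (y s) (y t) (yd t w) - yd s w"
      have "?v \<in> tangent_space A (y s)"
        by (intro subspace_diff[OF subspace_tangent_space] U_tangent DD yd_tangent J J')
      then have "norm (?v c) \<le> \<kappa> * gnorm g (y s) ?v" by (rule lower[OF J'(4)])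
      also have "\<dots> \<le> \<kappa> * (C * h s t * norm w)" using e r2(2) by (intro mult_left_mono) auto
      also have "?v c = ?u (a s) (a t) (b t w) - b s w"
      proof -
        have "U (y s) (y t) (yd t w) = tangent_of A c (y s) (?u (a s) (a t) (b t w))"
          unfolding yd_eq[OF J'(5), of w] by (rule U_chart[OF DD(1) J'(5,4)])
        then show ?thesis using c yV(1)[OF J'(4)] by (simp add: b_def[of s])
      qed
      finally show ?thesis by (simp add: mult.assoc)
    qed
    show "norm (\<beta> t (?u (a t) (a s) e) - \<beta> s e - (\<Sum>i\<in>UNIV. (x t - x s) $ i *\<^sub>R \<gamma> s i e)) \<le> \<kappa> * C * (h s t)\<^sup>2 * norm e" for e
    proof -
      let ?v = "tangent_of A c (y s) e"
      have "norm (\<alpha> t (U (y t) (y s) ?v) - \<alpha> s ?v - \<alpha>d s (wtensor (x t - x s) ?v)) \<le> C * (h s t)\<^sup>2 * gnorm g (y s) ?v"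
        using e tan[OF J'(4)] by blast
      also have "\<dots> \<le> C * (h s t)\<^sup>2 * (\<kappa> * norm e)" using upper[OF J'(4)] C(1) by (intro mult_left_mono) auto
      finally show ?thesis
        by (simp add: \<beta>_def \<gamma>_def U_chart[OF DD(2) J'(4,5)] \<alpha>d_wtensor[OF J(1)[OF J'(4)] tan[OF J'(4)]] mult_ac)
    qed
    show "norm (\<gamma> t i (?u (a t) (a s) e) - \<gamma> s i e) \<le> \<kappa> * C * h s t * norm e" for i e
    proof -
      let ?v = "tangent_of A c (y s) e"
      have "norm (\<alpha>d t (wsingle i (U (y t) (y s) ?v)) - \<alpha>d s (wsingle i ?v)) \<le> C * h s t * gnorm g (y s) ?v"
        using e tan[OF J'(4)] by blast
      also have "\<dots> \<le> C * h s t * (\<kappa> * norm e)" using upper[OF J'(4)] C(1) by (intro mult_left_mono) auto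
      finally show ?thesis by (simp add: \<gamma>_def U_chart[OF DD(2) J'(4,5)] mult_ac)
    qed
  qed (use r(2) G_small blin bb \<beta>lin \<gamma>lin in auto)
  obtain K where K: "\<And>s t v. l \<le> s \<Longrightarrow> s \<le> t \<Longrightarrow> t \<le> v \<Longrightarrow> v \<le> m \<Longrightarrow> norm (zt s v - zt s t - zt t v) \<le> K * h s v ^ 3"
    "\<And>s t. l \<le> s \<Longrightarrow> s \<le> t \<Longrightarrow> t \<le> m \<Longrightarrow> norm (zt s t - \<beta> s (b s (x t - x s))) \<le> K * (h s t)\<^sup>2 \<and>
      (\<forall>w. norm (\<beta> t (b t w) - \<beta> s (b s w)) \<le> K * (h s t * norm w))"
  proof -
    from chart_bounds show thesis
    proof (elim exE conjE, goal_cases)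
      case (1 K)
      show ?case
      proof (rule that)
        show "norm (zt s v - zt s t - zt t v) \<le> K * h s v ^ 3" if "l \<le> s" "s \<le> t" "t \<le> v" "v \<le> m" for s t v
          using 1(1)[rule_format, OF that] zt_chart[of s v] zt_chart[of s t] zt_chart[of t v] that by simp
        show "norm (zt s t - \<beta> s (b s (x t - x s))) \<le> K * (h s t)\<^sup>2 \<and>
          (\<forall>w. norm (\<beta> t (b t w) - \<beta> s (b s w)) \<le> K * (h s t * norm w))" if "l \<le> s" "s \<le> t" "t \<le> m" for s t
          using 1(2)[rule_format, OF that] zt_chart[OF that] by simp
      qed
    qed
  qed
  have \<beta>b: "\<beta> s (b s w) = \<alpha> s (yd s w)" if "s \<in> {l..m}" for s w by (simp add: \<beta>_def yd_eq[OF that])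
  show ?thesis
  proof (rule exI[of _ \<epsilon>], rule conjI[OF \<epsilon>(1)], rule exI[of _ K], intro conjI allI impI)
    fix s v assume *: "0 \<le> s" "s \<le> v" "v \<le> T" "\<bar>s - s0\<bar> \<le> \<epsilon>" "\<bar>v - s0\<bar> \<le> \<epsilon>"
    then have lmv: "l \<le> s" "v \<le> m" "s \<in> {l..m}" "v \<in> {l..m}" by (auto simp: l_def m_def)
    show "norm (zt s v - zt s t - zt t v) \<le> K * h s v ^ 3" if "s \<le> t" "t \<le> v" for t
      using K(1)[of s t v] lmv that by auto
    show "norm (zt s v - \<alpha> s (yd s (x v - x s))) \<le> K * (h s v)\<^sup>2"
      using K(2)[OF lmv(1) *(2) lmv(2)] \<beta>b[OF lmv(3)] by simp
    show "norm (\<alpha> v (yd v w) - \<alpha> s (yd s w)) \<le> K * (h s v * norm w)" for w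
      using K(2)[OF lmv(1) *(2) lmv(2)] \<beta>b[OF lmv(3)] \<beta>b[OF lmv(4)] by simp
  qed
qed

end

section \<open>The rough integral\<close>

context rough_setting
begin

lemma h_le_total: "0 \<le> s \<Longrightarrow> s \<le> t \<Longrightarrow> t \<le> T \<Longrightarrow> h s t \<le> h 0 T"
  by (rule h_mono) auto

lemma ztilde_uniform:
  obtains \<delta> K where "\<delta> > 0" "K \<ge> 0"
    "\<And>s t v. 0 \<le> s \<Longrightarrow> s \<le> t \<Longrightarrow> t \<le> v \<Longrightarrow> v \<le> T \<Longrightarrow> v - s \<le> \<delta> \<Longrightarrow>
      norm (zt s v - zt s t - zt t v) \<le> K * \<omega> s v powr (3 / p)"
    "\<And>s t. 0 \<le> s \<Longrightarrow> s \<le> t \<Longrightarrow> t \<le> T \<Longrightarrow> t - s \<le> \<delta> \<Longrightarrow> (y s, y t) \<in> D \<and>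
      norm (zt s t - \<alpha> s (yd s (x t - x s))) \<le> K * (h s t)\<^sup>2 \<and>
      (\<forall>w. norm (\<alpha> t (yd t w) - \<alpha> s (yd s w)) \<le> K * (h s t * norm w))"
proof -
  let ?Q = "\<lambda>K s v. (\<forall>t. s \<le> t \<longrightarrow> t \<le> v \<longrightarrow> norm (zt s v - zt s t - zt t v) \<le> K * h s v ^ 3) \<and>
    norm (zt s v - \<alpha> s (yd s (x v - x s))) \<le> K * (h s v)\<^sup>2 \<and>
    (\<forall>w. norm (\<alpha> v (yd v w) - \<alpha> s (yd s w)) \<le> K * (h s v * norm w))"
  have mono: "?Q K' s v" if "K \<le> K'" "?Q K s v" for K K' s v
  proof -
    have "z \<le> K' * w" if "z \<le> K * w" "0 \<le> w" for z w :: real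
      using that(1) mult_right_mono[OF \<open>K \<le> K'\<close> that(2)] by linarith
    then show ?thesis using that(2) by simp
  qed
  have "\<exists>\<delta>>0. \<exists>K. \<forall>s t. 0 \<le> s \<longrightarrow> s \<le> t \<longrightarrow> t \<le> T \<longrightarrow> t - s \<le> \<delta> \<longrightarrow> ?Q K s t"
    by (rule uniform_from_local[OF mono ztilde_local])
  then obtain \<delta> K where d: "\<delta> > 0" and Q: "\<And>s t. 0 \<le> s \<Longrightarrow> s \<le> t \<Longrightarrow> t \<le> T \<Longrightarrow> t - s \<le> \<delta> \<Longrightarrow> ?Q K s t"
    by blast
  obtain C \<delta>' where d': "\<delta>' > 0" "\<And>s t. 0 \<le> s \<Longrightarrow> s \<le> t \<Longrightarrow> t \<le> T \<Longrightarrow> t - s \<le> \<delta>' \<Longrightarrow> (y s, y t) \<in> D"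
    using controlled_estimates by metis
  have Q': "?Q (max K 0) s t" if "0 \<le> s" "s \<le> t" "t \<le> T" "t - s \<le> min \<delta> \<delta>'" for s t
    by (rule mono[OF max.cobounded1 Q]) (use that in auto)
  show thesis
  proof
    show "min \<delta> \<delta>' > 0" "max K 0 \<ge> 0" using d d' by auto
    show "norm (zt s v - zt s t - zt t v) \<le> max K 0 * \<omega> s v powr (3 / p)"
      if "0 \<le> s" "s \<le> t" "t \<le> v" "v \<le> T" "v - s \<le> min \<delta> \<delta>'" for s t v
      using Q'[of s v] h_power[of s v 3] that by simp
    show "(y s, y t) \<in> D \<and> norm (zt s t - \<alpha> s (yd s (x t - x s))) \<le> max K 0 * (h s t)\<^sup>2 \<and>
      (\<forall>w. norm (\<alpha> t (yd t w) - \<alpha> s (yd s w)) \<le> max K 0 * (h s t * norm w))"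
      if "0 \<le> s" "s \<le> t" "t \<le> T" "t - s \<le> min \<delta> \<delta>'" for s t
      using Q'[OF that] d'(2)[of s t] that by simp
  qed
qed

text \<open>The control is uniformly small near the diagonal, so that its root is a modulus of
  continuity; the threshold \<open>q powr p\<close> undoes the root in \<open>h\<close>.\<close>

lemma continuous_of_h_bound:
  fixes f :: "real \<Rightarrow> 'b::real_normed_vector"
  assumes "\<And>s t. 0 \<le> s \<Longrightarrow> s \<le> t \<Longrightarrow> t \<le> T \<Longrightarrow> norm (f t - f s) \<le> C * h s t"
  shows "continuous_on {0..T} f"
  unfolding continuous_on_iff
proof (intro ballI allI impI)
  fix s0 e :: real assume s0: "s0 \<in> {0..T}" and e: "e > 0"
  define q where "q = e / (\<bar>C\<bar> + 1)"
  have q: "q > 0" "\<bar>C\<bar> * q < e" using e by (simp_all add: q_def field_simps)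
  obtain \<eta> where \<eta>: "\<eta> > 0" "\<And>s t. 0 \<le> s \<Longrightarrow> s \<le> t \<Longrightarrow> t \<le> T \<Longrightarrow> t - s \<le> \<eta> \<Longrightarrow> \<omega> s t < q powr p"
    using control_uniformly_small[OF \<omega>, of "q powr p"] q(1) by auto
  have close: "norm (f t - f s) < e" if st: "0 \<le> s" "s \<le> t" "t \<le> T" "t - s \<le> \<eta>" for s t
  proof -
    have "h s t \<le> (q powr p) powr (1 / p)"
      using \<eta>(2)[OF st] control_nonneg[OF \<omega> st(1-3)] p by (intro powr_mono2) auto
    then have hq: "h s t \<le> q" using q(1) p by (simp add: powr_powr)
    have "norm (f t - f s) \<le> C * h s t" by (rule assms[OF st(1-3)])
    also have "\<dots> \<le> \<bar>C\<bar> * q" using hq by (intro mult_mono) auto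
    finally show ?thesis using q(2) by linarith
  qed
  have "dist (f t) (f s0) < e" if "t \<in> {0..T}" "dist t s0 < \<eta>" for t
    using close[of s0 t] close[of t s0] that s0 by (cases "s0 \<le> t") (auto simp: dist_norm norm_minus_commute)
  then show "\<exists>d>0. \<forall>t\<in>{0..T}. dist t s0 < d \<longrightarrow> dist (f t) (f s0) < e" using \<eta>(1) by blast
qed

text \<open>Joining two intervals at the midpoint \<open>r\<close> adds their two remainders and the
  correction by \<open>zd r - zd s\<close> applied to \<open>x t - x r\<close>, itself of order 2.
  Doubling the admissible length therefore triples the constant, and finitely many doublings reach
  \<open>T\<close>.\<close>

lemma controlled_local_to_global:
  fixes z :: "real \<Rightarrow> 'v" and zd :: "real \<Rightarrow> (real ^ 'k) \<Rightarrow>\<^sub>L 'v"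
  assumes "\<delta> > 0" and small: "\<And>s t. 0 \<le> s \<Longrightarrow> s \<le> t \<Longrightarrow> t \<le> T \<Longrightarrow> t - s \<le> \<delta> \<Longrightarrow>
    norm (z t - z s - blinfun_apply (zd s) (x t - x s)) \<le> C * (h s t)\<^sup>2 \<and> norm (zd t - zd s) \<le> C * h s t"
  obtains C' where "C' \<ge> 0" "\<And>s t. 0 \<le> s \<Longrightarrow> s \<le> t \<Longrightarrow> t \<le> T \<Longrightarrow>
    norm (z t - z s - blinfun_apply (zd s) (x t - x s)) \<le> C' * (h s t)\<^sup>2 \<and> norm (zd t - zd s) \<le> C' * h s t"
proof -
  have "\<exists>C'\<ge>0. \<forall>s t. 0 \<le> s \<longrightarrow> s \<le> t \<longrightarrow> t \<le> T \<longrightarrow> t - s \<le> 2 ^ n * \<delta> \<longrightarrow>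
    norm (z t - z s - blinfun_apply (zd s) (x t - x s)) \<le> C' * (h s t)\<^sup>2 \<and> norm (zd t - zd s) \<le> C' * h s t" for n
  proof (induction n)
    case 0
    have "a \<le> max C 0 * b" if "a \<le> C * b" "0 \<le> b" for a b :: real
      using that(1) mult_right_mono[OF max.cobounded1 that(2), of C 0] by linarith
    then show ?case using small by (intro exI[of _ "max C 0"]) auto
  next
    case (Suc n)
    then obtain C' where C': "C' \<ge> 0" and IH: "\<And>s t. 0 \<le> s \<Longrightarrow> s \<le> t \<Longrightarrow> t \<le> T \<Longrightarrow> t - s \<le> 2 ^ n * \<delta> \<Longrightarrow>
      norm (z t - z s - blinfun_apply (zd s) (x t - x s)) \<le> C' * (h s t)\<^sup>2 \<and> norm (zd t - zd s) \<le> C' * h s t"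
      by blast
    have "norm (z t - z s - blinfun_apply (zd s) (x t - x s)) \<le> (3 * C') * (h s t)\<^sup>2 \<and> norm (zd t - zd s) \<le> (3 * C') * h s t"
      if st: "0 \<le> s" "s \<le> t" "t \<le> T" "t - s \<le> 2 ^ Suc n * \<delta>" for s t
    proof -
      define r where "r = (s + t) / 2"
      have r: "s \<le> r" "r \<le> t" "r - s \<le> 2 ^ n * \<delta>" "t - r \<le> 2 ^ n * \<delta>"
        using st by (simp_all add: r_def field_simps)
      have hs: "h s r \<le> h s t" "h r t \<le> h s t" using h_mono[of s s r t] h_mono[of s r t t] r st by auto
      have IH1: "norm (z r - z s - blinfun_apply (zd s) (x r - x s)) \<le> C' * (h s r)\<^sup>2" "norm (zd r - zd s) \<le> C' * h s r"
        using IH[of s r] r st by auto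
      have IH2: "norm (z t - z r - blinfun_apply (zd r) (x t - x r)) \<le> C' * (h r t)\<^sup>2" "norm (zd t - zd r) \<le> C' * h r t"
        using IH[of r t] r st by auto
      have up: "C' * h s r \<le> C' * h s t" "C' * h r t \<le> C' * h s t"
          "C' * (h s r)\<^sup>2 \<le> C' * (h s t)\<^sup>2" "C' * (h r t)\<^sup>2 \<le> C' * (h s t)\<^sup>2"
        using hs C' by (auto intro!: mult_left_mono power_mono)
      have xr: "norm (x t - x r) \<le> h s t" using x_increment[of r t] r st hs by auto
      have "norm (blinfun_apply (zd r - zd s) (x t - x r)) \<le> norm (zd r - zd s) * norm (x t - x r)" by (rule norm_blinfun)
      also have "\<dots> \<le> (C' * h s t) * h s t" using IH1(2) up(1) xr C' by (intro mult_mono) auto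
      finally have 3: "norm (blinfun_apply (zd r - zd s) (x t - x r)) \<le> C' * (h s t)\<^sup>2" by (simp add: power2_eq_square mult.assoc)
      have eq: "z t - z s - blinfun_apply (zd s) (x t - x s)
        = (z r - z s - blinfun_apply (zd s) (x r - x s)) + (z t - z r - blinfun_apply (zd r) (x t - x r))
          + blinfun_apply (zd r - zd s) (x t - x r)"
        by (simp add: blinfun.diff_left blinfun.diff_right)
      have "norm (z t - z s - blinfun_apply (zd s) (x t - x s)) \<le> C' * (h s t)\<^sup>2 + C' * (h s t)\<^sup>2 + C' * (h s t)\<^sup>2"
        unfolding eq
        by (rule norm_triangle_le[OF add_mono[OF norm_triangle_le[OF add_mono[OF order_trans[OF IH1(1) up(3)] order_trans[OF IH2(1) up(4)]]] 3]])
      moreover have "norm (zd t - zd s) \<le> C' * h s t + C' * h s t"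
      proof -
        have eq: "zd t - zd s = (zd r - zd s) + (zd t - zd r)" by simp
        show ?thesis unfolding eq
          by (rule norm_triangle_le[OF add_mono[OF order_trans[OF IH1(2) up(1)] order_trans[OF IH2(2) up(2)]]])
      qed
      moreover have "0 \<le> C' * h s t" using C' by simp
      ultimately show ?thesis by (simp add: algebra_simps)
    qed
    then show ?case using C' by (intro exI[of _ "3 * C'"]) auto
  qed
  moreover obtain n where "T / \<delta> < 2 ^ n" using real_arch_pow[of 2 "T / \<delta>"] by auto
  moreover have "t - s \<le> 2 ^ n * \<delta>" if "T / \<delta> < 2 ^ n" "0 \<le> s" "t \<le> T" for s t
    using that assms(1) by (simp add: field_simps)
  ultimately show thesis using that by meson
qed

text \<open>Existence comes from sewing the germ with exponent \<open>3 / p > 1\<close>. As to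
  uniqueness, the derivative path is prescribed on the time interval and extensional outside, and
  two admissible paths differ by a function whose increments are bounded by a multiple of
  \<open>\<omega> s t powr (3 / p)\<close>, hence by a constant, which the value at 0 fixes.\<close>

lemma rough_integral_exists_unique:
  "\<exists>!zz. zz \<in> CRP_space T p \<omega> x \<and>
    (case zz of (z, zd) \<Rightarrow>
      z 0 = 0 \<and>
      approx T p \<omega> 3 (\<lambda>s t. (y s, y t) \<in> D) (\<lambda>s. norm) (\<lambda>s t. z t - z s) zt \<and>
      (\<forall>s\<in>{0..T}. blinfun_apply (zd s) = \<alpha> s \<circ> yd s))"
proof -
  obtain \<delta> K where \<delta>: "\<delta> > 0" and K: "K \<ge> 0"
    and almost: "\<And>s t v. 0 \<le> s \<Longrightarrow> s \<le> t \<Longrightarrow> t \<le> v \<Longrightarrow> v \<le> T \<Longrightarrow> v - s \<le> \<delta> \<Longrightarrow>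
      norm (zt s v - zt s t - zt t v) \<le> K * \<omega> s v powr (3 / p)"
    and first: "\<And>s t. 0 \<le> s \<Longrightarrow> s \<le> t \<Longrightarrow> t \<le> T \<Longrightarrow> t - s \<le> \<delta> \<Longrightarrow> (y s, y t) \<in> D \<and>
      norm (zt s t - \<alpha> s (yd s (x t - x s))) \<le> K * (h s t)\<^sup>2 \<and>
      (\<forall>w. norm (\<alpha> t (yd t w) - \<alpha> s (yd s w)) \<le> K * (h s t * norm w))"
    using ztilde_uniform by blast
  have \<theta>: "3 / p > 1" using p by simp
  have T0: "T \<ge> 0" using T by simp
  obtain z0 K1 where z0: "z0 0 = 0" and sew: "\<And>s t. 0 \<le> s \<Longrightarrow> s \<le> t \<Longrightarrow> t \<le> T \<Longrightarrow> t - s \<le> \<delta> \<Longrightarrow>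
      norm (z0 t - z0 s - zt s t) \<le> K1 * \<omega> s t powr (3 / p)"
    using sewing[OF \<omega> \<theta> T0 \<delta> almost] by blast
  \<comment> \<open>Sewing says nothing outside the time interval; restriction sets the default
    value there, so that paths are equal as functions.\<close>
  define z where "z = restrict z0 {0..T}"
  define zd where "zd = restrict (\<lambda>s. Blinfun (\<alpha> s \<circ> yd s)) {0..T}"
  have zd: "blinfun_apply (zd s) = \<alpha> s \<circ> yd s" if s: "s \<in> {0..T}" for s
  proof -
    have "linear (\<alpha> s \<circ> yd s)"
      using lin_on_add[OF \<alpha>_lin[OF s] yd_tangent[OF s] yd_tangent[OF s]] lin_on_scaleR[OF \<alpha>_lin[OF s] yd_tangent[OF s]]
      by (intro linearI) (auto simp: linear_add[OF yd_lin[OF s]] linear_scale[OF yd_lin[OF s]])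
    then have "bounded_linear (\<alpha> s \<circ> yd s)" by (simp add: linear_conv_bounded_linear)
    then show ?thesis using s by (simp add: zd_def bounded_linear_Blinfun_apply)
  qed
  have z_eq: "z s = z0 s" if "s \<in> {0..T}" for s using that by (simp add: z_def)
  \<comment> \<open>The sewing error has order 3; bounding one factor \<open>h s t\<close> by
    \<open>h 0 T\<close> brings it to the order 2 of a controlled remainder, to which the germ's
    distance from its leading term adds \<open>K\<close>.\<close>
  have small: "norm (z t - z s - blinfun_apply (zd s) (x t - x s)) \<le> (\<bar>K1\<bar> * h 0 T + K) * (h s t)\<^sup>2 \<and>
      norm (zd t - zd s) \<le> (\<bar>K1\<bar> * h 0 T + K) * h s t"
    if st: "0 \<le> s" "s \<le> t" "t \<le> T" "t - s \<le> \<delta>" for s t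
  proof
    have ins: "s \<in> {0..T}" "t \<in> {0..T}" using st by auto
    have "norm (z0 t - z0 s - zt s t) \<le> K1 * h s t ^ 3" using sew[OF st] h_power[OF st(1-3), of 3] by simp
    also have "\<dots> \<le> \<bar>K1\<bar> * h s t ^ 3" by (intro mult_right_mono) auto
    also have "\<dots> = (\<bar>K1\<bar> * h s t) * (h s t)\<^sup>2" by (simp add: power3_eq_cube power2_eq_square)
    also have "\<dots> \<le> (\<bar>K1\<bar> * h 0 T) * (h s t)\<^sup>2"
      using h_le_total[OF st(1-3)] by (intro mult_right_mono mult_left_mono) auto
    finally have 1: "norm (z0 t - z0 s - zt s t) \<le> (\<bar>K1\<bar> * h 0 T) * (h s t)\<^sup>2" .
    have 2: "norm (zt s t - \<alpha> s (yd s (x t - x s))) \<le> K * (h s t)\<^sup>2" using first[OF st] by blast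
    have eq: "z t - z s - blinfun_apply (zd s) (x t - x s) = (z0 t - z0 s - zt s t) + (zt s t - \<alpha> s (yd s (x t - x s)))"
      using z_eq[OF ins(1)] z_eq[OF ins(2)] zd[OF ins(1)] by simp
    have "norm (z t - z s - blinfun_apply (zd s) (x t - x s)) \<le> (\<bar>K1\<bar> * h 0 T) * (h s t)\<^sup>2 + K * (h s t)\<^sup>2"
      unfolding eq by (rule norm_triangle_le[OF add_mono[OF 1 2]])
    then show "norm (z t - z s - blinfun_apply (zd s) (x t - x s)) \<le> (\<bar>K1\<bar> * h 0 T + K) * (h s t)\<^sup>2"
      by (simp add: algebra_simps)
    have "norm (zd t - zd s) \<le> K * h s t"
    proof (rule norm_blinfun_bound)
      show "0 \<le> K * h s t" using K by simp
      show "norm (blinfun_apply (zd t - zd s) w) \<le> K * h s t * norm w" for w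
        using first[OF st] by (simp add: blinfun.diff_left zd[OF ins(1)] zd[OF ins(2)] mult.assoc)
    qed
    also have "\<dots> \<le> (\<bar>K1\<bar> * h 0 T + K) * h s t" by (intro mult_right_mono) auto
    finally show "norm (zd t - zd s) \<le> (\<bar>K1\<bar> * h 0 T + K) * h s t" .
  qed
  obtain C where C: "C \<ge> 0" and global: "\<And>s t. 0 \<le> s \<Longrightarrow> s \<le> t \<Longrightarrow> t \<le> T \<Longrightarrow>
    norm (z t - z s - blinfun_apply (zd s) (x t - x s)) \<le> C * (h s t)\<^sup>2 \<and> norm (zd t - zd s) \<le> C * h s t"
    using controlled_local_to_global[OF \<delta> small] by blast
  have zd_cont: "continuous_on {0..T} zd" using global by (intro continuous_of_h_bound) blast
  \<comment> \<open>The increment of \<open>z\<close> has order 1 because of its leading term, for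
    which \<open>zd\<close> has to be bounded uniformly; its value at 0 and its Lipschitz bound do
    this.\<close>
  have z_cont: "continuous_on {0..T} z"
  proof (rule continuous_of_h_bound)
    fix s t assume st: "0 \<le> s" "s \<le> t" "t \<le> T"
    have "norm (zd s) \<le> norm (zd 0) + C * h 0 T"
    proof -
      have "norm (zd s - zd 0) \<le> C * h 0 s" using global[of 0 s] st by simp
      also have "\<dots> \<le> C * h 0 T" using h_le_total[of 0 s] st C by (intro mult_left_mono) auto
      finally show ?thesis using norm_triangle_ineq2[of "zd s" "zd 0"] by linarith
    qed
    then have "norm (zd s) * norm (x t - x s) \<le> (norm (zd 0) + C * h 0 T) * h s t"
      using x_increment[OF st] C by (intro mult_mono) auto
    then have 1: "norm (blinfun_apply (zd s) (x t - x s)) \<le> (norm (zd 0) + C * h 0 T) * h s t"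
      using norm_blinfun[of "zd s" "x t - x s"] by linarith
    have "C * (h s t)\<^sup>2 \<le> C * (h 0 T * h s t)"
      using h_le_total[OF st] C by (intro mult_left_mono) (auto simp: power2_eq_square intro: mult_right_mono)
    then have 2: "norm (z t - z s - blinfun_apply (zd s) (x t - x s)) \<le> C * (h 0 T * h s t)" using global[OF st] by linarith
    have eq: "z t - z s = (z t - z s - blinfun_apply (zd s) (x t - x s)) + blinfun_apply (zd s) (x t - x s)" by simp
    have "norm (z t - z s) \<le> C * (h 0 T * h s t) + (norm (zd 0) + C * h 0 T) * h s t"
      using norm_triangle_le[OF add_mono[OF 2 1]] by simp
    then show "norm (z t - z s) \<le> (2 * C * h 0 T + norm (zd 0)) * h s t" by (simp add: algebra_simps)
  qed
  have crp: "(z, zd) \<in> CRP_space T p \<omega> x"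
    unfolding CRP_space_def mem_Collect_eq case_prod_conv
  proof (intro conjI)
    show "z \<in> extensional {0..T}" "zd \<in> extensional {0..T}" by (simp_all add: z_def zd_def)
    have "norm (z t - z s - blinfun_apply (zd s) (x t - x s)) \<le> C * \<omega> s t powr (2 / p) \<and>
        norm (zd t - zd s) \<le> C * \<omega> s t powr (1 / p)" if "0 \<le> s" "s \<le> t" "t \<le> T" for s t
      using global[OF that] h_power[OF that, of 2] by simp
    then show "\<exists>C. \<forall>(s, t)\<in>Delta T. norm (z t - z s - blinfun_apply (zd s) (x t - x s)) \<le> C * \<omega> s t powr (2 / p) \<and>
        norm (zd t - zd s) \<le> C * \<omega> s t powr (1 / p)"
      by (auto simp: Delta_def)
  qed (rule z_cont zd_cont)+
  have approx: "approx T p \<omega> 3 (\<lambda>s t. (y s, y t) \<in> D) (\<lambda>s. norm) (\<lambda>s t. z t - z s) zt"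
    unfolding approx_def
  proof (intro exI conjI ballI)
    show "\<delta> > 0" by fact
    fix st assume "st \<in> Delta T"
    then show "case st of (s, t) \<Rightarrow> t - s \<le> \<delta> \<longrightarrow> (y s, y t) \<in> D \<and> norm (z t - z s - zt s t) \<le> K1 * \<omega> s t powr (real 3 / p)"
      using sew first by (auto simp: Delta_def z_eq)
  qed
  show ?thesis
  proof (rule ex1I[of _ "(z, zd)"])
    show "(z, zd) \<in> CRP_space T p \<omega> x \<and> (case (z, zd) of (z, zd) \<Rightarrow> z 0 = 0 \<and>
      approx T p \<omega> 3 (\<lambda>s t. (y s, y t) \<in> D) (\<lambda>s. norm) (\<lambda>s t. z t - z s) zt \<and>
      (\<forall>s\<in>{0..T}. blinfun_apply (zd s) = \<alpha> s \<circ> yd s))"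
      using crp approx z0 T zd by (simp add: z_eq)
  next
    fix zz :: "(real \<Rightarrow> 'v) \<times> (real \<Rightarrow> (real ^ 'k) \<Rightarrow>\<^sub>L 'v)"
    assume zz: "zz \<in> CRP_space T p \<omega> x \<and> (case zz of (z, zd) \<Rightarrow> z 0 = 0 \<and>
      approx T p \<omega> 3 (\<lambda>s t. (y s, y t) \<in> D) (\<lambda>s. norm) (\<lambda>s t. z t - z s) zt \<and>
      (\<forall>s\<in>{0..T}. blinfun_apply (zd s) = \<alpha> s \<circ> yd s))"
    obtain z' zd' where zz': "zz = (z', zd')" by (rule prod.exhaust)
    have ext: "z' \<in> extensional {0..T}" "zd' \<in> extensional {0..T}" and z'0: "z' 0 = 0"
      and ap: "approx T p \<omega> 3 (\<lambda>s t. (y s, y t) \<in> D) (\<lambda>s. norm) (\<lambda>s t. z' t - z' s) zt"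
      and zd': "\<And>s. s \<in> {0..T} \<Longrightarrow> blinfun_apply (zd' s) = \<alpha> s \<circ> yd s"
      using zz by (auto simp: zz' CRP_space_def)
    have "zd' = zd"
    proof (rule extensionalityI[OF ext(2)])
      show "zd \<in> extensional {0..T}" by (simp add: zd_def)
      show "zd' s = zd s" if "s \<in> {0..T}" for s
        by (rule blinfun_eqI) (simp add: zd[OF that] zd'[OF that])
    qed
    moreover have "z' = z"
    proof (rule extensionalityI[OF ext(1)])
      show "z \<in> extensional {0..T}" by (simp add: z_def)
      obtain C2 \<delta>2 where 2: "\<delta>2 > 0" "\<And>s t. 0 \<le> s \<Longrightarrow> s \<le> t \<Longrightarrow> t \<le> T \<Longrightarrow> t - s \<le> \<delta>2 \<Longrightarrow>
          (y s, y t) \<in> D \<and> norm (z' t - z' s - zt s t) \<le> C2 * \<omega> s t powr (real 3 / p)"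
        by (rule approxD[OF ap]) blast
      \<comment> \<open>Both paths follow the same germ up to order 3, so the germ cancels in the
        increments of their difference.\<close>
      have "z' t - z0 t = z' 0 - z0 0" if "t \<in> {0..T}" for t
      proof (rule additive_small_imp_const[OF \<omega> \<theta> T0, of "min \<delta> \<delta>2" "\<lambda>t. z' t - z0 t" "C2 + K1"])
        fix s t assume st: "0 \<le> s" "s \<le> t" "t \<le> T" "t - s \<le> min \<delta> \<delta>2"
        have 1: "norm (z' t - z' s - zt s t) \<le> C2 * \<omega> s t powr (3 / p)" using 2(2)[of s t] st by simp
        have 3: "norm (z0 t - z0 s - zt s t) \<le> K1 * \<omega> s t powr (3 / p)" using sew[of s t] st by simp
        have eq: "(z' t - z0 t) - (z' s - z0 s) = (z' t - z' s - zt s t) - (z0 t - z0 s - zt s t)" by simp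
        have "norm ((z' t - z0 t) - (z' s - z0 s)) \<le> C2 * \<omega> s t powr (3 / p) + K1 * \<omega> s t powr (3 / p)"
          unfolding eq by (rule norm_triangle_le_diff[OF add_mono[OF 1 3]])
        then show "norm ((z' t - z0 t) - (z' s - z0 s)) \<le> (C2 + K1) * \<omega> s t powr (3 / p)" by (simp add: algebra_simps)
      qed (use \<delta> 2(1) that in auto)
      then show "z' t = z t" if "t \<in> {0..T}" for t using that z0 z'0 by (simp add: z_eq)
    qed
    ultimately show "zz = (z, zd)" by (simp add: zz')
  qed
qed

end

theorem theorem3p21:
  fixes A :: "('m::{t2_space, second_countable_topology}, 'e::real_normed_vector) chart set"
    and g :: "'m \<Rightarrow> ('m, 'e) tvec \<Rightarrow> ('m, 'e) tvec \<Rightarrow> real"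
    and D :: "('m \<times> 'm) set"
    and \<psi> :: "'m \<Rightarrow> 'm \<Rightarrow> ('m, 'e) tvec"
    and U :: "'m \<Rightarrow> 'm \<Rightarrow> ('m, 'e) tvec \<Rightarrow> ('m, 'e) tvec"
    and T p :: real
    and \<omega> :: "real \<Rightarrow> real \<Rightarrow> real"
    and x :: "real \<Rightarrow> real ^ 'k"
    and X :: "real \<Rightarrow> real \<Rightarrow> real ^ 'k ^ 'k"
    and y :: "real \<Rightarrow> 'm"
    and yd :: "real \<Rightarrow> real ^ 'k \<Rightarrow> ('m, 'e) tvec"
    and \<alpha> :: "real \<Rightarrow> ('m, 'e) tvec \<Rightarrow> 'v::banach"
    and \<alpha>d :: "real \<Rightarrow> ('k \<Rightarrow> ('m, 'e) tvec) \<Rightarrow> 'v"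
  assumes "0 < T" and "1 \<le> p" and "p < 3"
    and "control T \<omega>"
    and "weak_geometric_rough_path T p \<omega> x X"
    and "smooth_manifold A"
    and "riemannian_metric A g"
    and "manifold_gauge A D \<psi> U"
    and "(y, yd) \<in> CRP_manifold A g D \<psi> U T p \<omega> x"
    and "(\<alpha>, \<alpha>d) \<in> CRP_forms A g D U T p \<omega> x y"
  shows "\<exists>!zz. zz \<in> CRP_space T p \<omega> x \<and>
    (case zz of (z, zd) \<Rightarrow>
      z 0 = 0 \<and>
      approx T p \<omega> 3 (\<lambda>s t. (y s, y t) \<in> D) (\<lambda>s. norm)
        (\<lambda>s t. z t - z s) (ztilde A \<psi> U X y yd \<alpha> \<alpha>d) \<and>
      (\<forall>s\<in>{0..T}. blinfun_apply (zd s) = \<alpha> s \<circ> yd s))"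
proof -
  interpret rough_setting A g D \<psi> U T p \<omega> x X y yd \<alpha> \<alpha>d
    using assms by unfold_locales
  show ?thesis by (rule rough_integral_exists_unique)
qed

end
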